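(* Let $\mathcal H$ be a Hilbert space with scalar product $(\cdot,\cdot)$ and let $A:D(A)\subset\mathcal H\to\mathcal H$ be a self-adjoint operator with form domain $\mathcal F(A)$. Let $\mathcal H=\mathcal H_+\oplus\mathcal H_-$ be an orthogonal decomposition into closed subspaces, with orthogonal projectors $\Lambda^+,\Lambda^-$ onto $\mathcal H_+,\mathcal H_-$. Assume there is a core $F$ of $A$ (a subspace of $D(A)$ dense for the graph norm of $A$) such that (i) $F_+:=\Lambda^+F$ and $F_-:=\Lambda^-F$ are subspaces of $\mathcal F(A)$. Define, for $k\ge1$, $$\lambda_k^+:=\inf_{V\subset F_+,\ \dim V=k}\ \sup_{x\in (V\oplus F_-)\setminus\{0\}}\frac{(x,Ax)}{\|x\|^2_{\mathcal H}},\qquad \lambda_k^-:=\sup_{V\subset F_-,\ \dim V=k}\ \inf_{x\in (V\oplus F_+)\setminus\{0\}}\frac{(x,Ax)}{\|x\|^2_{\mathcal H}},$$ where $V$ ranges over subspaces of the indicated space. (1) Assume $a^-:=\sup_{x_-\in F_-\setminus\{0\}}\frac{(x_-,Ax_-)}{\|x_-\|^2_{\mathcal H}}<+\infty$ and that the set $\{k\ge1:\lambda_k^+>a^-\}$ is nonempty; let $k_0^+$ be its minimum, and let $b^-:=\inf\big(\sigma_{\rm ess}(A)\cap(a^-,\infty)\big)$. Then for every $k\ge k_0^+$, either $\lambda_k^+$ is the $(k-k_0^++1)$-th eigenvalue of $A$ in the interval $(a^-,b^-)$ (eigenvalues counted with multiplicity, in increasing order), or $\lambda_k^+=b^-$.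 (2) Assume $a^+:=\inf_{x_+\in F_+\setminus\{0\}}\frac{(x_+,Ax_+)}{\|x_+\|^2_{\mathcal H}}>-\infty$ and that the set $\{k\ge1:\lambda_k^-<a^+\}$ is nonempty; let $k_0^-$ be its minimum, and let $b^+:=\sup\big(\sigma_{\rm ess}(A)\cap(-\infty,a^+)\big)$. Then for every $k\ge k_0^-$, either $\lambda_k^-$ is the $(k-k_0^-+1)$-th eigenvalue of $A$ in the interval $(b^+,a^+)$ (eigenvalues counted with multiplicity, in decreasing order), or $\lambda_k^-=b^+$.
   Context: $\sigma_{\rm ess}(A)$ denotes the essential spectrum of $A$. The form domain $\mathcal F(A)$ is the domain of the closed quadratic form associated with $A$, and $(x,Ax)$ for $x\in\mathcal F(A)$ denotes the value of that form. *)

theory Defs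
  imports "HOL-Analysis.Analysis" "HOL-Library.Extended_Nat"
begin

text \<open>Setting. A complex Hilbert space is represented by its realification: a real Hilbert
space (type class real_inner + complete_space, real inner product = real part of the complex
scalar product) together with the complex structure J (multiplication by the imaginary unit):
J is real linear, J (J x) = - x and J is isometric for the real inner product.
Complex subspaces are the J-invariant real subspaces; the complex dimension of such a
subspace is half its real dimension.
An (unbounded) operator is a pair of a domain D and a map A (values outside D irrelevant).\<close>

definition complex_structure :: "('a::real_inner \<Rightarrow> 'a) \<Rightarrow> bool" where
  "complex_structure J \<longleftrightarrow> linear J \<and> (\<forall>x. J (J x) = - x) \<and> (\<forall>x y. inner (J x) (J y) = inner x y)"

definition self_adjoint_op :: "'a::real_inner set \<Rightarrow> ('a \<Rightarrow> 'a) \<Rightarrow> bool" where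
  "self_adjoint_op D A \<longleftrightarrow>
     subspace D \<and> closure D = UNIV \<and>
     (\<forall>x\<in>D. \<forall>y\<in>D. A (x + y) = A x + A y) \<and> (\<forall>c. \<forall>x\<in>D. A (c *\<^sub>R x) = c *\<^sub>R A x) \<and>
     (\<forall>y z. (\<forall>x\<in>D. inner (A x) y = inner x z) \<longleftrightarrow> (y \<in> D \<and> z = A y))"

text \<open>(DS,S) is |A|^(1/2): the nonnegative self-adjoint operator whose square is |A|,
i.e. S^2 is nonnegative self-adjoint with domain D(A) and norm (S^2 x) = norm (A x).\<close>
definition is_abs_sqrt :: "'a::real_inner set \<Rightarrow> ('a \<Rightarrow> 'a) \<Rightarrow> 'a set \<Rightarrow> ('a \<Rightarrow> 'a) \<Rightarrow> bool" where
  "is_abs_sqrt D A DS S \<longleftrightarrow>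
     self_adjoint_op DS S \<and> (\<forall>x\<in>DS. 0 \<le> inner x (S x)) \<and>
     D = {x \<in> DS. S x \<in> DS} \<and> (\<forall>x\<in>D. norm (S (S x)) = norm (A x))"

definition form_dom :: "'a::real_inner set \<Rightarrow> ('a \<Rightarrow> 'a) \<Rightarrow> 'a set" where
  "form_dom D A = {x. \<exists>DS S. is_abs_sqrt D A DS S \<and> x \<in> DS}"

text \<open>The value (x,Ax) of the closed form: the limit of (x_n, A x_n) along any sequence of
D(A) converging to x in the form norm (D(A) is a core of |A|^(1/2)).\<close>
definition form_val :: "'a::real_inner set \<Rightarrow> ('a \<Rightarrow> 'a) \<Rightarrow> 'a \<Rightarrow> real" where
  "form_val D A x = (THE q. \<exists>DS S. is_abs_sqrt D A DS S \<and>
      (\<forall>X. (\<forall>n. X n \<in> D) \<and> X \<longlonglongrightarrow> x \<and> (\<lambda>n. S (X n)) \<longlonglongrightarrow> S x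
           \<longrightarrow> (\<lambda>n. inner (X n) (A (X n))) \<longlonglongrightarrow> q))"

definition rayleigh :: "'a::real_inner set \<Rightarrow> ('a \<Rightarrow> 'a) \<Rightarrow> 'a \<Rightarrow> ereal" where
  "rayleigh D A x = ereal (form_val D A x / (norm x)^2)"

text \<open>Spectrum (a self-adjoint operator has real spectrum; for real lambda, invertibility of
A - lambda as a complex operator is the same as bijectivity D \<rightarrow> H).\<close>
definition op_spectrum :: "'a::real_inner set \<Rightarrow> ('a \<Rightarrow> 'a) \<Rightarrow> real set" where
  "op_spectrum D A = {l. \<not> bij_betw (\<lambda>x. A x - l *\<^sub>R x) D UNIV}"

definition eigenspace_op :: "'a::real_inner set \<Rightarrow> ('a \<Rightarrow> 'a) \<Rightarrow> real \<Rightarrow> 'a set" where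
  "eigenspace_op D A l = {x \<in> D. A x = l *\<^sub>R x}"

definition fin_dim :: "'a::real_vector set \<Rightarrow> bool" where
  "fin_dim V \<longleftrightarrow> (\<exists>B. finite B \<and> V \<subseteq> span B)"

definition disc_spectrum :: "'a::real_inner set \<Rightarrow> ('a \<Rightarrow> 'a) \<Rightarrow> real set" where
  "disc_spectrum D A = {l \<in> op_spectrum D A.
      (\<exists>e>0. op_spectrum D A \<inter> ball l e = {l}) \<and> fin_dim (eigenspace_op D A l)}"

definition ess_spectrum :: "'a::real_inner set \<Rightarrow> ('a \<Rightarrow> 'a) \<Rightarrow> real set" where
  "ess_spectrum D A = op_spectrum D A - disc_spectrum D A"

definition eig_count :: "'a::real_inner set \<Rightarrow> ('a \<Rightarrow> 'a) \<Rightarrow> real set \<Rightarrow> enat" where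
  "eig_count D A I = (let E = span (\<Union>l\<in>I. eigenspace_op D A l) in
      if fin_dim E then enat (dim E div 2) else \<infinity>)"

definition kth_eig_incr :: "'a::real_inner set \<Rightarrow> ('a \<Rightarrow> 'a) \<Rightarrow> ereal \<Rightarrow> ereal \<Rightarrow> nat \<Rightarrow> real \<Rightarrow> bool" where
  "kth_eig_incr D A a b j mu \<longleftrightarrow> a < ereal mu \<and> ereal mu < b \<and> eigenspace_op D A mu \<noteq> {0} \<and>
     eig_count D A {t. a < ereal t \<and> t < mu} < enat j \<and>
     enat j \<le> eig_count D A {t. a < ereal t \<and> t \<le> mu}"

definition kth_eig_decr :: "'a::real_inner set \<Rightarrow> ('a \<Rightarrow> 'a) \<Rightarrow> ereal \<Rightarrow> ereal \<Rightarrow> nat \<Rightarrow> real \<Rightarrow> bool" where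
  "kth_eig_decr D A b a j mu \<longleftrightarrow> b < ereal mu \<and> ereal mu < a \<and> eigenspace_op D A mu \<noteq> {0} \<and>
     eig_count D A {t. mu < t \<and> ereal t < a} < enat j \<and>
     enat j \<le> eig_count D A {t. mu \<le> t \<and> ereal t < a}"

definition csubspaces_dim :: "('a::real_vector \<Rightarrow> 'a) \<Rightarrow> 'a set \<Rightarrow> nat \<Rightarrow> 'a set set" where
  "csubspaces_dim J W k = {V. V \<subseteq> W \<and> subspace V \<and> J ` V \<subseteq> V \<and> dim V = 2 * k}"

definition dsum :: "'a::real_vector set \<Rightarrow> 'a set \<Rightarrow> 'a set" where
  "dsum V W = {v + w | v w. v \<in> V \<and> w \<in> W}"

definition lambda_plus :: "'a::real_inner set \<Rightarrow> ('a \<Rightarrow> 'a) \<Rightarrow> ('a \<Rightarrow> 'a) \<Rightarrow> 'a set \<Rightarrow> 'a set \<Rightarrow> nat \<Rightarrow> ereal" where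
  "lambda_plus D A J Fp Fm k =
     (INF V \<in> csubspaces_dim J Fp k. SUP x \<in> dsum V Fm - {0}. rayleigh D A x)"

definition lambda_minus :: "'a::real_inner set \<Rightarrow> ('a \<Rightarrow> 'a) \<Rightarrow> ('a \<Rightarrow> 'a) \<Rightarrow> 'a set \<Rightarrow> 'a set \<Rightarrow> nat \<Rightarrow> ereal" where
  "lambda_minus D A J Fp Fm k =
     (SUP V \<in> csubspaces_dim J Fm k. INF x \<in> dsum V Fp - {0}. rayleigh D A x)"

end

theory Submission
  imports Defs
begin

text \<open>For \<open>c > a\<^sup>-\<close> maximize \<open>(x + y, A (x + y)) - c \<parallel>x + y\<parallel>\<^sup>2\<close> over \<open>y \<in> F\<^sub>-\<close>. Since \<open>x = \<Lambda>\<^sup>+ f\<close> with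
  \<open>f \<in> F \<subseteq> D(A)\<close>, shifting \<open>y\<close> by \<open>\<Lambda>\<^sup>- f\<close> turns the cross term into \<open>2 (A f - c f, y)\<close>, which is bounded in
  \<open>H\<close>; so the supremum is a finite quadratic form \<open>S\<^sub>c(f) = (A f - c f, f + G\<^sub>c (A f - c f))\<close> with a bounded
  symmetric \<open>G\<^sub>c\<close>. It extends to \<open>D(A)\<close>, is continuous in the graph norm and decreasing in \<open>c\<close>, and
  \<open>\<lambda>\<^sub>k\<^sup>+ < c\<close> iff \<open>S\<^sub>c\<close> is negative definite on some \<open>k\<close>-dimensional subspace of \<open>D(A)\<close>, where a core
  suffices. As \<open>c\<close> crosses a real number \<open>l\<close>, the negative index increases by exactly
  \<open>dim ker (A - l)\<close> if \<open>l\<close> lies outside the essential spectrum, and strictly whenever \<open>l\<close> is in the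
  spectrum; hence it is infinite beyond the essential spectrum. No spectral theorem is needed: the only
  spectral input is that \<open>A - l\<close> is bounded below on the orthogonal complement of its kernel when \<open>l\<close> is
  isolated in the spectrum. The second half is the first one for \<open>-A\<close>.\<close>

section \<open>Forms on subspaces and Riesz representation\<close>

text \<open>The obstacle behind \<open>G\<^sub>c\<close> is that the positive form
  \<open>c * inner y y - q y y\<close> on \<open>F\<^sub>-\<close> is neither complete nor assumed
  closable, so its maximizers cannot be sought in a form domain inside the Hilbert space. With
  \<iota> the continuous extension of the inclusion to the abstract completion, the operator is
  \<iota> composed with its adjoint. It makes sense even if \<iota> is not injective, and it is
  obtained as a limit in the ambient space of maximizing sequences. The form of \<open>A\<close> is
  a second difficulty: it is defined through any nonnegative \<open>S\<close> with
  \<open>norm (S (S x)) = norm (A x)\<close>, and without functional calculus both the independence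
  of \<open>S\<close> and the bound of the form by the square of \<open>norm (S x)\<close> have to
  come from Heinz's inequality. The offset \<open>k0 - 1\<close> in the final count is the negative
  index just above \<open>am\<close>: it is already present there, and only spectrum above
  \<open>am\<close> can add to it.\<close>

lemma self_mult_le_cancel: "s * s \<le> k * s \<Longrightarrow> 0 \<le> s \<Longrightarrow> 0 \<le> k \<Longrightarrow> s \<le> (k::real)"
  by (cases "s = 0") (auto simp only: mult_le_cancel_right)

text \<open>The axioms are relative to the carrier \<open>V\<close> because the form of
  \<open>A\<close> and the Schur form are controlled only on subspaces of the type; their values
  elsewhere are arbitrary.\<close>

locale sym_form =
  fixes V :: "'a::real_inner set" and b :: "'a \<Rightarrow> 'a \<Rightarrow> real"
  assumes sub: "subspace V"
    and add_left: "\<And>x y z. x \<in> V \<Longrightarrow> y \<in> V \<Longrightarrow> z \<in> V \<Longrightarrow> b (x + y) z = b x z + b y z"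
    and scale_left: "\<And>r x z. x \<in> V \<Longrightarrow> z \<in> V \<Longrightarrow> b (r *\<^sub>R x) z = r * b x z"
    and sym: "\<And>x y. x \<in> V \<Longrightarrow> y \<in> V \<Longrightarrow> b x y = b y x"
begin

lemma V_add [intro]: "x \<in> V \<Longrightarrow> y \<in> V \<Longrightarrow> x + y \<in> V"
  and V_diff [intro]: "x \<in> V \<Longrightarrow> y \<in> V \<Longrightarrow> x - y \<in> V"
  and V_scale [intro]: "x \<in> V \<Longrightarrow> r *\<^sub>R x \<in> V"
  and V_zero [intro, simp]: "0 \<in> V"
  and V_sum: "(\<And>i. i \<in> I \<Longrightarrow> g i \<in> V) \<Longrightarrow> sum g I \<in> V"
  using sub by (auto intro: subspace_add subspace_diff subspace_scale subspace_0 subspace_sum)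

lemma add_right: "x \<in> V \<Longrightarrow> y \<in> V \<Longrightarrow> z \<in> V \<Longrightarrow> b x (y + z) = b x y + b x z"
  using add_left[of y z x] sym[of x] V_add[of y z] by simp

lemma scale_right: "x \<in> V \<Longrightarrow> z \<in> V \<Longrightarrow> b x (r *\<^sub>R z) = r * b x z"
  using scale_left[of z x r] sym[of x] V_scale[of z r] by simp

lemma zero_left: "z \<in> V \<Longrightarrow> b 0 z = 0"
  using scale_left[of 0 z 0] by simp

lemma diff_left: "x \<in> V \<Longrightarrow> y \<in> V \<Longrightarrow> z \<in> V \<Longrightarrow> b (x - y) z = b x z - b y z"
  using add_left[of "x - y" y z] V_diff[of x y] by simp

lemma diff_right: "x \<in> V \<Longrightarrow> y \<in> V \<Longrightarrow> z \<in> V \<Longrightarrow> b x (y - z) = b x y - b x z"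
  using add_right[of x "y - z" z] V_diff[of y z] by simp

lemma quad_add: "x \<in> V \<Longrightarrow> y \<in> V \<Longrightarrow> b (x + y) (x + y) = b x x + 2 * b x y + b y y"
  by (simp add: add_left add_right V_add sym[of y x])

lemma quad_diff: "x \<in> V \<Longrightarrow> y \<in> V \<Longrightarrow> b (x - y) (x - y) = b x x - 2 * b x y + b y y"
  by (simp add: diff_left diff_right V_diff sym[of y x])

lemma quad_scale: "x \<in> V \<Longrightarrow> b (r *\<^sub>R x) (r *\<^sub>R x) = r\<^sup>2 * b x x"
  by (simp add: scale_left scale_right V_scale power2_eq_square)

lemma sum_left: "finite I \<Longrightarrow> (\<And>i. i \<in> I \<Longrightarrow> g i \<in> V) \<Longrightarrow> z \<in> V \<Longrightarrow> b (sum g I) z = (\<Sum>i\<in>I. b (g i) z)"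
  by (induction I rule: finite_induct) (auto simp: zero_left add_left V_sum)

text \<open>A quadratic polynomial without sign change has nonpositive discriminant. Keeping
  \<open>d\<close> and \<epsilon> free lets the criterion serve for Cauchy-Schwarz, for approximate
  maximizers, where \<epsilon> bounds the distance to the supremum, and for polarizing bounds on
  quadratic forms.\<close>

lemma discriminant:
  assumes "x \<in> V" "y \<in> V" and eps: "0 \<le> \<epsilon>" and nn: "\<And>t. 0 \<le> b (t *\<^sub>R y) (t *\<^sub>R y) + 2 * t * d + \<epsilon>"
  shows "d\<^sup>2 \<le> \<epsilon> * b y y"
proof -
  have q: "0 \<le> t\<^sup>2 * b y y + 2 * t * d + \<epsilon>" for t
    using nn[of t] assms by (simp add: quad_scale)
  show ?thesis
  proof (cases "b y y > 0")
    case True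
    then show ?thesis
      using q[of "- d / b y y"] by (simp add: power2_eq_square field_simps)
  next
    case False
    have "d = 0"
    proof (rule ccontr)
      assume d: "d \<noteq> 0"
      \<comment> \<open>The linear term becomes \<open>- 2 * (\<epsilon> + 1)\<close>, which
        outweighs \<epsilon>, while the quadratic term is nonpositive.\<close>
      define t where "t = - (\<epsilon> + 1) / d"
      have "t\<^sup>2 * b y y \<le> 0" using False by (simp add: mult_nonneg_nonpos)
      moreover have "2 * t * d = - 2 * (\<epsilon> + 1)" using d by (simp add: t_def)
      ultimately show False using q[of t] eps by (simp add: algebra_simps)
    qed
    moreover have "b y y \<ge> 0 \<or> \<epsilon> = 0"
    proof (rule ccontr)
      assume n: "\<not> (b y y \<ge> 0 \<or> \<epsilon> = 0)"
      then have "b y y < 0" "\<epsilon> > 0" using eps by auto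
      define t where "t = sqrt (2 * \<epsilon> / (- b y y))"
      have "t\<^sup>2 = 2 * \<epsilon> / (- b y y)" using \<open>b y y < 0\<close> \<open>\<epsilon> > 0\<close> by (simp add: t_def divide_nonneg_nonpos)
      then have "t\<^sup>2 * b y y = - 2 * \<epsilon>" using \<open>b y y < 0\<close> by (simp add: field_simps)
      then show False using q[of t] \<open>d = 0\<close> \<open>\<epsilon> > 0\<close> by simp
    qed
    ultimately show ?thesis using eps by auto
  qed
qed

text \<open>Positivity is asked only on \<open>W\<close>: the Schur form may be indefinite on
  \<open>V\<close> and is later used on the complement of a maximal negative subspace.\<close>

lemma Cauchy_Schwarz:
  assumes nn: "\<And>x. x \<in> W \<Longrightarrow> 0 \<le> b x x" and W: "subspace W" "W \<subseteq> V" and "x \<in> W" "y \<in> W"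
  shows "(b x y)\<^sup>2 \<le> b x x * b y y"
proof (rule discriminant)
  show "0 \<le> b (t *\<^sub>R y) (t *\<^sub>R y) + 2 * t * b x y + b x x" for t
  proof -
    have "0 \<le> b (x + t *\<^sub>R y) (x + t *\<^sub>R y)"
      using assms by (intro nn) (simp add: subspace_add subspace_scale)
    also have "\<dots> = b (t *\<^sub>R y) (t *\<^sub>R y) + 2 * t * b x y + b x x"
      using assms by (subst quad_add) (auto simp: scale_right subsetD)
    finally show ?thesis .
  qed
qed (use assms in auto)

end

section \<open>The Riesz map of a coercive form on an incomplete subspace\<close>

locale pos_form = sym_form V b for V :: "'a::{real_inner, complete_space} set" and b +
  fixes \<kappa> :: real
  assumes pos: "0 < \<kappa>" and coercive: "\<And>y. y \<in> V \<Longrightarrow> \<kappa> * (norm y)\<^sup>2 \<le> b y y"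
begin

lemma nonneg: "y \<in> V \<Longrightarrow> 0 \<le> b y y"
  using coercive[of y] pos by (smt (verit) mult_nonneg_nonneg zero_le_power2)

lemma norm_le_sqrt: "y \<in> V \<Longrightarrow> norm y \<le> sqrt (b y y) / sqrt \<kappa>"
proof -
  assume "y \<in> V"
  then have "sqrt (\<kappa> * (norm y)\<^sup>2) \<le> sqrt (b y y)" using coercive by simp
  then show ?thesis using pos by (simp add: real_sqrt_mult field_simps)
qed

text \<open>\<open>e n\<close> bounds the residual functional in the dual norm of \<open>b\<close>.
  Such a sequence is Cauchy for \<open>b\<close> and stands for the Riesz representer of
  \<open>h\<close> in the completion of \<open>V\<close>, an object that need not lie in
  \<open>V\<close> nor be determined by its limit in the ambient space.\<close>

definition represents :: "'a \<Rightarrow> (nat \<Rightarrow> 'a) \<Rightarrow> (nat \<Rightarrow> real) \<Rightarrow> bool" where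
  "represents h Y e \<longleftrightarrow> (\<forall>n. Y n \<in> V) \<and> e \<longlonglongrightarrow> 0 \<and>
     (\<forall>n. \<forall>y\<in>V. \<bar>b (Y n) y - inner h y\<bar> \<le> e n * sqrt (b y y))"

definition riesz_rel :: "'a \<Rightarrow> 'a \<Rightarrow> bool" where
  "riesz_rel h z \<longleftrightarrow> (\<exists>Y e. represents h Y e \<and> Y \<longlonglongrightarrow> z)"

text \<open>Testing the residual with \<open>Y n\<close> itself bounds the \<open>b\<close>-norm of
  \<open>Y n\<close> by the error, and coercivity passes this to the ambient norm. With linearity
  this is the uniqueness of represented limits.\<close>

lemma represents_small:
  assumes "represents 0 Y e" shows "Y \<longlonglongrightarrow> 0"
proof (rule Lim_null_comparison)
  have "norm (Y n) \<le> \<bar>e n\<bar> / sqrt \<kappa>" for n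
  proof -
    let ?s = "sqrt (b (Y n) (Y n))"
    have YV: "Y n \<in> V" and e: "\<bar>b (Y n) (Y n)\<bar> \<le> e n * ?s" using assms by (auto simp: represents_def)
    have "?s * ?s \<le> \<bar>e n\<bar> * ?s"
      using e nonneg[OF YV] by (smt (verit) real_sqrt_ge_zero mult_right_mono abs_ge_self real_sqrt_mult_self)
    then have "?s \<le> \<bar>e n\<bar>"
      by (rule self_mult_le_cancel) (use nonneg[OF YV] in auto)
    then show ?thesis
      using norm_le_sqrt[OF YV] pos by (smt (verit) divide_right_mono real_sqrt_gt_zero)
  qed
  then show "\<forall>\<^sub>F n in sequentially. norm (Y n) \<le> \<bar>e n\<bar> / sqrt \<kappa>" by simp
  have "e \<longlonglongrightarrow> 0" using assms by (simp add: represents_def)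
  from tendsto_divide[OF tendsto_rabs[OF this] tendsto_const, of "sqrt \<kappa>"]
  show "(\<lambda>n. \<bar>e n\<bar> / sqrt \<kappa>) \<longlonglongrightarrow> 0" using pos by simp
qed

lemma represents_add:
  assumes "represents h Y e" "represents h' Y' e'"
  shows "represents (h + h') (\<lambda>n. Y n + Y' n) (\<lambda>n. e n + e' n)"
  unfolding represents_def
proof (intro conjI allI ballI)
  show "Y n + Y' n \<in> V" for n using assms by (auto simp: represents_def)
  show "(\<lambda>n. e n + e' n) \<longlonglongrightarrow> 0" using tendsto_add[of e 0 _ e' 0] assms by (simp add: represents_def)
  fix n y assume y: "y \<in> V"
  have "\<bar>b (Y n) y - inner h y\<bar> \<le> e n * sqrt (b y y)" "\<bar>b (Y' n) y - inner h' y\<bar> \<le> e' n * sqrt (b y y)"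
    "Y n \<in> V" "Y' n \<in> V"
    using assms y by (auto simp: represents_def)
  then show "\<bar>b (Y n + Y' n) y - inner (h + h') y\<bar> \<le> (e n + e' n) * sqrt (b y y)"
    using y by (simp add: add_left inner_add_left algebra_simps)
qed

lemma represents_scale:
  assumes "represents h Y e"
  shows "represents (c *\<^sub>R h) (\<lambda>n. c *\<^sub>R Y n) (\<lambda>n. \<bar>c\<bar> * e n)"
  unfolding represents_def
proof (intro conjI allI ballI)
  show "c *\<^sub>R Y n \<in> V" for n using assms by (auto simp: represents_def)
  show "(\<lambda>n. \<bar>c\<bar> * e n) \<longlonglongrightarrow> 0" using tendsto_mult[of "\<lambda>_. \<bar>c\<bar>" "\<bar>c\<bar>" _ e 0] assms by (simp add: represents_def)
  fix n y assume y: "y \<in> V"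
  have *: "\<bar>b (Y n) y - inner h y\<bar> \<le> e n * sqrt (b y y)" "Y n \<in> V" using assms y by (auto simp: represents_def)
  have "\<bar>b (c *\<^sub>R Y n) y - inner (c *\<^sub>R h) y\<bar> = \<bar>c\<bar> * \<bar>b (Y n) y - inner h y\<bar>"
    using * y by (simp add: scale_left flip: abs_mult right_diff_distrib)
  also have "\<dots> \<le> \<bar>c\<bar> * (e n * sqrt (b y y))" using * by (intro mult_left_mono) auto
  finally show "\<bar>b (c *\<^sub>R Y n) y - inner (c *\<^sub>R h) y\<bar> \<le> \<bar>c\<bar> * e n * sqrt (b y y)" by (simp add: mult.assoc)
qed

lemma represents_diff:
  "represents h Y e \<Longrightarrow> represents h' Y' e' \<Longrightarrow> represents (h - h') (\<lambda>n. Y n - Y' n) (\<lambda>n. e n + e' n)"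
  using represents_add[OF _ represents_scale[of h' Y' e' "-1"], of h Y e] by simp

lemma riesz_unique:
  assumes "riesz_rel h z" "riesz_rel h z'" shows "z = z'"
proof -
  obtain Y e Y' e' where 1: "represents h Y e" "Y \<longlonglongrightarrow> z" and 2: "represents h Y' e'" "Y' \<longlonglongrightarrow> z'"
    using assms by (auto simp: riesz_rel_def)
  have "(\<lambda>n. Y n - Y' n) \<longlonglongrightarrow> 0"
    by (rule represents_small) (use represents_diff[OF 1(1) 2(1)] in simp)
  moreover have "(\<lambda>n. Y n - Y' n) \<longlonglongrightarrow> z - z'" using 1 2 by (intro tendsto_diff)
  ultimately show ?thesis using LIMSEQ_unique by fastforce
qed

lemma represents_bounded:
  assumes "represents h Y e"
  shows "sqrt (b (Y n) (Y n)) \<le> norm h / sqrt \<kappa> + \<bar>e n\<bar>"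
proof -
  let ?s = "sqrt (b (Y n) (Y n))"
  have YV: "Y n \<in> V" and e: "\<bar>b (Y n) (Y n) - inner h (Y n)\<bar> \<le> e n * ?s" using assms by (auto simp: represents_def)
  have s0: "?s \<ge> 0" using nonneg[OF YV] by simp
  have "?s * ?s = b (Y n) (Y n)" using nonneg[OF YV] by simp
  also have "\<dots> \<le> norm h * norm (Y n) + \<bar>e n\<bar> * ?s"
    using e norm_cauchy_schwarz[of h "Y n"] mult_right_mono[OF abs_ge_self s0, of "e n"] by linarith
  also have "\<dots> \<le> norm h * (?s / sqrt \<kappa>) + \<bar>e n\<bar> * ?s"
    using norm_le_sqrt[OF YV] by (intro add_mono mult_left_mono) auto
  also have "\<dots> = (norm h / sqrt \<kappa> + \<bar>e n\<bar>) * ?s" by (simp add: algebra_simps)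
  finally have "?s * ?s \<le> (norm h / sqrt \<kappa> + \<bar>e n\<bar>) * ?s" .
  moreover have "0 \<le> norm h / sqrt \<kappa> + \<bar>e n\<bar>" using pos by simp
  ultimately show ?thesis using s0 by (meson self_mult_le_cancel)
qed

text \<open>Substitute for the identity \<open>b z z' = inner h z'\<close>, whose left side is
  meaningless because the limits may leave \<open>V\<close>: the residual of \<open>Y n\<close> is
  tested with \<open>Y' n\<close>, which stays bounded in \<open>b\<close>.\<close>

lemma represents_pairing:
  assumes 1: "represents h Y e" and 2: "represents h' Y' e'" and lim: "Y' \<longlonglongrightarrow> z'"
  shows "(\<lambda>n. b (Y n) (Y' n)) \<longlonglongrightarrow> inner h z'"
proof -
  have e: "e \<longlonglongrightarrow> 0" "e' \<longlonglongrightarrow> 0" using 1 2 by (auto simp: represents_def)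
  have "(\<lambda>n. b (Y n) (Y' n) - inner h (Y' n)) \<longlonglongrightarrow> 0"
  proof (rule Lim_null_comparison)
    have "norm (b (Y n) (Y' n) - inner h (Y' n)) \<le> \<bar>e n\<bar> * (norm h' / sqrt \<kappa> + \<bar>e' n\<bar>)" for n
    proof -
      have YV: "Y' n \<in> V" using 2 by (auto simp: represents_def)
      have "\<bar>b (Y n) (Y' n) - inner h (Y' n)\<bar> \<le> e n * sqrt (b (Y' n) (Y' n))"
        using 1 YV by (auto simp: represents_def)
      also have "\<dots> \<le> \<bar>e n\<bar> * sqrt (b (Y' n) (Y' n))" using nonneg[OF YV] by (intro mult_right_mono) auto
      also have "\<dots> \<le> \<bar>e n\<bar> * (norm h' / sqrt \<kappa> + \<bar>e' n\<bar>)"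
        using represents_bounded[OF 2] by (intro mult_left_mono) auto
      finally show ?thesis by simp
    qed
    then show "\<forall>\<^sub>F n in sequentially. norm (b (Y n) (Y' n) - inner h (Y' n)) \<le> \<bar>e n\<bar> * (norm h' / sqrt \<kappa> + \<bar>e' n\<bar>)" by simp
    have "(\<lambda>n. \<bar>e n\<bar> * (norm h' / sqrt \<kappa> + \<bar>e' n\<bar>)) \<longlonglongrightarrow> \<bar>0\<bar> * (norm h' / sqrt \<kappa> + \<bar>0\<bar>)"
      using e by (intro tendsto_intros)
    then show "(\<lambda>n. \<bar>e n\<bar> * (norm h' / sqrt \<kappa> + \<bar>e' n\<bar>)) \<longlonglongrightarrow> 0" by simp
  qed
  moreover have "(\<lambda>n. inner h (Y' n)) \<longlonglongrightarrow> inner h z'" using lim by (intro tendsto_intros)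
  ultimately have "(\<lambda>n. (b (Y n) (Y' n) - inner h (Y' n)) + inner h (Y' n)) \<longlonglongrightarrow> 0 + inner h z'"
    by (rule tendsto_add)
  then show ?thesis by simp
qed

text \<open>Riesz representation without completing \<open>V\<close>: a maximizing sequence of
  \<open>2 \<langle>h, y\<rangle> - b(y, y)\<close> over \<open>V\<close> is Cauchy for \<open>b\<close>, hence convergent in the ambient space.\<close>

lemma riesz_exists: "\<exists>z. riesz_rel h z"
proof -
  define \<phi> where "\<phi> y = 2 * inner h y - b y y" for y
  have up: "\<phi> y \<le> (norm h)\<^sup>2 / \<kappa>" if "y \<in> V" for y
  proof -
    have "2 * (norm h * norm y) \<le> (norm h)\<^sup>2 / \<kappa> + \<kappa> * (norm y)\<^sup>2"
    proof -
      have "0 \<le> (norm h / sqrt \<kappa> - sqrt \<kappa> * norm y)\<^sup>2" by simp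
      also have "\<dots> = (norm h)\<^sup>2 / \<kappa> + \<kappa> * (norm y)\<^sup>2 - 2 * (norm h * norm y)"
        using pos by (simp add: power2_diff power_mult_distrib power_divide)
      finally show ?thesis by linarith
    qed
    then show ?thesis
      using coercive[OF that] norm_cauchy_schwarz[of h y] by (simp add: \<phi>_def)
  qed
  define g where "g = (SUP y\<in>V. \<phi> y)"
  have bdd: "bdd_above (\<phi> ` V)" using up by (intro bdd_aboveI2)
  have le_g: "\<phi> y \<le> g" if "y \<in> V" for y
    unfolding g_def using that bdd by (intro cSUP_upper)
  have "\<exists>y\<in>V. g - 1 / real (Suc n) < \<phi> y" for n
  proof -
    have "g - 1 / real (Suc n) < g" by simp
    then show ?thesis unfolding g_def using bdd V_zero by (subst (asm) less_cSUP_iff) auto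
  qed
  then obtain Y where Y: "\<And>n. Y n \<in> V" "\<And>n. g - 1 / real (Suc n) < \<phi> (Y n)" by metis
  \<comment> \<open>\<open>Y n\<close> misses the supremum by less than
    \<open>1 / real (Suc n)\<close>; the discriminant criterion turns this defect into a residual of
    the size of its square root.\<close>
  define e where "e n = sqrt (1 / real (Suc n))" for n
  have e: "e \<longlonglongrightarrow> 0"
    unfolding e_def using tendsto_real_sqrt[OF LIMSEQ_inverse_real_of_nat] by (simp add: inverse_eq_divide)
  have est: "\<bar>b (Y n) y - inner h y\<bar> \<le> e n * sqrt (b y y)" if y: "y \<in> V" for n y
  proof -
    have "(b (Y n) y - inner h y)\<^sup>2 \<le> (1 / real (Suc n)) * b y y"
    proof (rule discriminant[OF y y])
      fix t
      have "\<phi> (Y n + t *\<^sub>R y) \<le> g" using Y y by (intro le_g) auto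
      moreover have "\<phi> (Y n + t *\<^sub>R y) = \<phi> (Y n) - b (t *\<^sub>R y) (t *\<^sub>R y) - 2 * t * (b (Y n) y - inner h y)"
        using Y y by (simp add: \<phi>_def quad_add V_scale scale_right inner_add_right algebra_simps)
      ultimately show "0 \<le> b (t *\<^sub>R y) (t *\<^sub>R y) + 2 * t * (b (Y n) y - inner h y) + 1 / real (Suc n)"
        using Y(2)[of n] by linarith
    qed simp
    then have "sqrt ((b (Y n) y - inner h y)\<^sup>2) \<le> sqrt ((1 / real (Suc n)) * b y y)" by (rule real_sqrt_le_mono)
    then show ?thesis by (simp only: real_sqrt_abs real_sqrt_mult e_def)
  qed
  have rep: "represents h Y e" unfolding represents_def using Y e est by auto
  have "Cauchy Y"
  proof (rule CauchyI)
    fix r :: real assume r: "0 < r"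
    have "r * sqrt \<kappa> / 2 > 0" using r pos by simp
    then obtain M where M: "\<And>n. n \<ge> M \<Longrightarrow> norm (e n) < r * sqrt \<kappa> / 2"
      using LIMSEQ_D[OF e] by (metis diff_zero)
    show "\<exists>M. \<forall>m\<ge>M. \<forall>n\<ge>M. norm (Y m - Y n) < r"
    proof (intro exI allI impI)
      fix m n assume mn: "m \<ge> M" "n \<ge> M"
      let ?d = "Y m - Y n" let ?s = "sqrt (b ?d ?d)"
      have dV: "?d \<in> V" using Y by auto
      have "?s * ?s = b ?d ?d" using nonneg[OF dV] by simp
      also have "\<dots> = (b (Y m) ?d - inner h ?d) - (b (Y n) ?d - inner h ?d)" using Y dV by (simp add: diff_left)
      also have "\<dots> \<le> (e m + e n) * ?s" using est[OF dV, of m] est[OF dV, of n] by (simp add: algebra_simps)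
      finally have "?s * ?s \<le> (e m + e n) * ?s" .
      moreover have "0 \<le> e m + e n" by (simp add: e_def)
      ultimately have "?s \<le> e m + e n" using real_sqrt_ge_zero[OF nonneg[OF dV]] by (meson self_mult_le_cancel)
      also have "\<dots> < r * sqrt \<kappa>" using M[of m] M[of n] mn by simp
      finally have "?s / sqrt \<kappa> < r" using pos by (simp add: field_simps)
      then show "norm (Y m - Y n) < r" using norm_le_sqrt[OF dV] by linarith
    qed
  qed
  then show ?thesis using rep unfolding riesz_rel_def by (metis Cauchy_convergent convergent_def)
qed

text \<open>For \<iota> the map from the completion of \<open>V\<close> under \<open>b\<close> into
  the ambient space, this is \<iota> composed with its adjoint. For a closed, densely defined form
  it is the inverse of the associated operator.\<close>

definition riesz :: "'a \<Rightarrow> 'a" where "riesz h = (THE z. riesz_rel h z)"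

lemma riesz_rel_riesz: "riesz_rel h (riesz h)"
  unfolding riesz_def using riesz_exists riesz_unique by (metis theI)

lemma riesz_eqI: "riesz_rel h z \<Longrightarrow> riesz h = z"
  using riesz_unique riesz_rel_riesz by blast

lemma linear_riesz: "linear riesz"
proof (rule linearI)
  show "riesz (h + h') = riesz h + riesz h'" for h h'
    using riesz_rel_riesz[of h] riesz_rel_riesz[of h'] unfolding riesz_rel_def
    by (elim exE conjE, intro riesz_eqI)
      (unfold riesz_rel_def, rule exI, rule exI, rule conjI, erule (1) represents_add, intro tendsto_intros)
  show "riesz (c *\<^sub>R h) = c *\<^sub>R riesz h" for c h
    using riesz_rel_riesz[of h] unfolding riesz_rel_def
    by (elim exE conjE, intro riesz_eqI)
      (unfold riesz_rel_def, rule exI, rule exI, rule conjI, erule represents_scale, intro tendsto_intros)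
qed

text \<open>Both sides are limits of the same symmetric expression
  \<open>b (Y n) (Y' n)\<close>.\<close>

lemma riesz_symmetric: "inner (riesz h) h' = inner h (riesz h')"
proof -
  obtain Y e Y' e' where 1: "represents h Y e" "Y \<longlonglongrightarrow> riesz h" and 2: "represents h' Y' e'" "Y' \<longlonglongrightarrow> riesz h'"
    using riesz_rel_riesz by (metis riesz_rel_def)
  have "(\<lambda>n. b (Y n) (Y' n)) = (\<lambda>n. b (Y' n) (Y n))" using 1 2 sym by (auto simp: represents_def)
  then show ?thesis
    using LIMSEQ_unique[OF represents_pairing[OF 1(1) 2] ] represents_pairing[OF 2(1) 1] by (simp add: inner_commute)
qed

text \<open>One representing sequence with all its limits. The last clause, the Cauchy property for
  \<open>b\<close>, is what forces the operator values to converge in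
  \<open>closed_graph_riesz\<close>.\<close>

lemma riesz_approx:
  obtains Y where "\<And>n. Y n \<in> V" "Y \<longlonglongrightarrow> riesz h" "(\<lambda>n. b (Y n) (Y n)) \<longlonglongrightarrow> inner h (riesz h)"
    "\<And>y. y \<in> V \<Longrightarrow> (\<lambda>n. b (Y n) y) \<longlonglongrightarrow> inner h y"
    "\<And>r. 0 < r \<Longrightarrow> \<exists>M. \<forall>m\<ge>M. \<forall>n\<ge>M. b (Y m - Y n) (Y m - Y n) < r"
proof -
  obtain Y e where 1: "represents h Y e" "Y \<longlonglongrightarrow> riesz h"
    using riesz_rel_riesz by (metis riesz_rel_def)
  have e: "e \<longlonglongrightarrow> 0" and YV: "\<And>n. Y n \<in> V" using 1 by (auto simp: represents_def)
  have "(\<lambda>n. b (Y n) y) \<longlonglongrightarrow> inner h y" if y: "y \<in> V" for y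
  proof -
    have "(\<lambda>n. b (Y n) y - inner h y) \<longlonglongrightarrow> 0"
    proof (rule Lim_null_comparison)
      show "\<forall>\<^sub>F n in sequentially. norm (b (Y n) y - inner h y) \<le> e n * sqrt (b y y)"
        using 1 y by (simp add: represents_def)
      show "(\<lambda>n. e n * sqrt (b y y)) \<longlonglongrightarrow> 0" using tendsto_mult[OF e tendsto_const] by simp
    qed
    then show ?thesis by (rule LIM_zero_cancel)
  qed
  moreover have "\<exists>M. \<forall>m\<ge>M. \<forall>n\<ge>M. b (Y m - Y n) (Y m - Y n) < r" if r: "0 < r" for r
  proof -
    have "sqrt r / 2 > 0" using r by simp
    then obtain M where M: "\<And>n. n \<ge> M \<Longrightarrow> norm (e n) < sqrt r / 2"
      using LIMSEQ_D[OF e] by (metis diff_zero)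
    have "b (Y m - Y n) (Y m - Y n) < r" if mn: "m \<ge> M" "n \<ge> M" for m n
    proof -
      let ?d = "Y m - Y n" let ?s = "sqrt (b ?d ?d)"
      have dV: "?d \<in> V" using YV by auto
      have s0: "?s \<ge> 0" using nonneg[OF dV] by simp
      have "?s * ?s = b ?d ?d" using nonneg[OF dV] by simp
      also have "\<dots> = (b (Y m) ?d - inner h ?d) - (b (Y n) ?d - inner h ?d)" using YV dV by (simp add: diff_left)
      also have "\<dots> \<le> e m * ?s + e n * ?s" 
      proof -
        have "\<bar>b (Y m) ?d - inner h ?d\<bar> \<le> e m * ?s" "\<bar>b (Y n) ?d - inner h ?d\<bar> \<le> e n * ?s"
          using 1(1) dV unfolding represents_def by blast+
        then show ?thesis by linarith
      qed
      also have "\<dots> \<le> (\<bar>e m\<bar> + \<bar>e n\<bar>) * ?s" using s0 mult_right_mono[OF abs_ge_self s0, of "e m"] mult_right_mono[OF abs_ge_self s0, of "e n"]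
        by (simp add: distrib_right)
      finally have "?s * ?s \<le> (\<bar>e m\<bar> + \<bar>e n\<bar>) * ?s" .
      then have "?s \<le> \<bar>e m\<bar> + \<bar>e n\<bar>" using s0 by (rule self_mult_le_cancel) auto
      also have "\<dots> < sqrt r" using M[of m] M[of n] mn by simp
      finally show ?thesis by simp
    qed
    then show ?thesis by blast
  qed
  ultimately show ?thesis using that[OF YV 1(2) represents_pairing[OF 1(1) 1]] by blast
qed

lemma riesz_coercive: "\<kappa> * (norm (riesz h))\<^sup>2 \<le> inner h (riesz h)"
proof -
  obtain Y where Y: "\<And>n. Y n \<in> V" "Y \<longlonglongrightarrow> riesz h" "(\<lambda>n. b (Y n) (Y n)) \<longlonglongrightarrow> inner h (riesz h)"
    using riesz_approx by metis
  have "(\<lambda>n. \<kappa> * (norm (Y n))\<^sup>2) \<longlonglongrightarrow> \<kappa> * (norm (riesz h))\<^sup>2" using Y by (intro tendsto_intros)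
  then show ?thesis using Y coercive by (intro LIMSEQ_le[OF _ Y(3)]) auto
qed

lemma norm_riesz_le: "norm (riesz h) \<le> norm h / \<kappa>"
proof -
  have "\<kappa> * norm (riesz h) * norm (riesz h) \<le> norm h * norm (riesz h)"
    using riesz_coercive[of h] norm_cauchy_schwarz[of h "riesz h"] by (simp add: power2_eq_square mult.assoc)
  then have "\<kappa> * norm (riesz h) \<le> norm h" by (cases "riesz h = 0") (simp_all add: mult_le_cancel_right)
  then show ?thesis using pos by (simp add: field_simps)
qed

lemma inner_riesz_le: "inner h (riesz h) \<le> (norm h)\<^sup>2 / \<kappa>"
proof -
  have "inner h (riesz h) \<le> norm h * norm (riesz h)" by (rule norm_cauchy_schwarz)
  also have "\<dots> \<le> norm h * (norm h / \<kappa>)" using norm_riesz_le by (intro mult_left_mono) auto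
  finally show ?thesis by (simp add: power2_eq_square)
qed

text \<open>Expand \<open>0 \<le> b (Y n - y) (Y n - y)\<close> along a representing sequence and
  pass to the limit. Together with \<open>riesz_approx_sup\<close> this identifies
  \<open>inner h (riesz h)\<close> as a supremum.\<close>

lemma riesz_upper: "y \<in> V \<Longrightarrow> 2 * inner h y - b y y \<le> inner h (riesz h)"
proof -
  assume y: "y \<in> V"
  obtain Y where Y: "\<And>n. Y n \<in> V" "(\<lambda>n. b (Y n) (Y n)) \<longlonglongrightarrow> inner h (riesz h)" "(\<lambda>n. b (Y n) y) \<longlonglongrightarrow> inner h y"
    using riesz_approx y by metis
  have "(\<lambda>n. 2 * b (Y n) y - b y y) \<longlonglongrightarrow> 2 * inner h y - b y y" using Y by (intro tendsto_intros)
  moreover have "2 * b (Y n) y - b y y \<le> b (Y n) (Y n)" for n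
    using nonneg[of "Y n - y"] Y y by (simp add: quad_diff V_diff)
  ultimately show ?thesis by (intro LIMSEQ_le[OF _ Y(2)]) auto
qed

text \<open>The maximizing sequence converges in the ambient space as well as in value; the norms of
  its members then have a limit, on which the comparison of two levels \<open>c\<close>
  relies.\<close>

lemma riesz_approx_sup:
  obtains Y where "\<And>n. Y n \<in> V" "Y \<longlonglongrightarrow> riesz h"
    "(\<lambda>n. 2 * inner h (Y n) - b (Y n) (Y n)) \<longlonglongrightarrow> inner h (riesz h)"
proof -
  obtain Y where Y: "\<And>n. Y n \<in> V" "Y \<longlonglongrightarrow> riesz h" "(\<lambda>n. b (Y n) (Y n)) \<longlonglongrightarrow> inner h (riesz h)"
    using riesz_approx by metis
  have "(\<lambda>n. 2 * inner h (Y n) - b (Y n) (Y n)) \<longlonglongrightarrow> 2 * inner h (riesz h) - inner h (riesz h)"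
    using Y by (intro tendsto_intros)
  then show ?thesis using that[OF Y(1,2)] by simp
qed

end

text \<open>For the form of a closed operator a \<open>b\<close>-Cauchy sequence also makes
  \<open>T (Y n)\<close> converge, so the representer lies in \<open>V\<close>. It is used with
  \<open>t > 0\<close> for resolvents of squares, with \<open>t = 0\<close> when \<open>T\<close> is
  bounded below, and with \<open>T\<close> the zero map for projections.\<close>

lemma closed_graph_riesz:
  fixes V :: "'a::{real_inner, complete_space} set" and T :: "'a \<Rightarrow> 'a"
  assumes V: "subspace V"
    and add: "\<And>x y. x \<in> V \<Longrightarrow> y \<in> V \<Longrightarrow> T (x + y) = T x + T y"
    and scale: "\<And>r x. x \<in> V \<Longrightarrow> T (r *\<^sub>R x) = r *\<^sub>R T x"
    and closed: "\<And>X x y. (\<And>n. X n \<in> V) \<Longrightarrow> X \<longlonglongrightarrow> x \<Longrightarrow> (\<lambda>n. T (X n)) \<longlonglongrightarrow> y \<Longrightarrow> x \<in> V \<and> T x = y"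
    and t: "0 \<le> t" and k: "0 < k" "\<And>y. y \<in> V \<Longrightarrow> k * (norm y)\<^sup>2 \<le> t * (norm y)\<^sup>2 + (norm (T y))\<^sup>2"
  obtains z where "z \<in> V" "\<And>y. y \<in> V \<Longrightarrow> t * inner z y + inner (T z) (T y) = inner h y"
proof -
  define b where "b x y = t * inner x y + inner (T x) (T y)" for x y
  interpret pos_form V b k
    by unfold_locales
      (use V k in \<open>auto simp: b_def add scale inner_add_left inner_commute algebra_simps power2_norm_eq_inner\<close>)
  obtain Y where Y: "\<And>n. Y n \<in> V" "Y \<longlonglongrightarrow> riesz h" "\<And>y. y \<in> V \<Longrightarrow> (\<lambda>n. b (Y n) y) \<longlonglongrightarrow> inner h y"
    "\<And>r. 0 < r \<Longrightarrow> \<exists>M. \<forall>m\<ge>M. \<forall>n\<ge>M. b (Y m - Y n) (Y m - Y n) < r"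
    by (rule riesz_approx[of h]) blast
  have Tdiff: "T (x - y) = T x - T y" if "x \<in> V" "y \<in> V" for x y
    using add[of "x - y" y] that subspace_diff[OF V that] by simp
  have "Cauchy (\<lambda>n. T (Y n))"
  proof (rule CauchyI)
    fix r :: real assume "0 < r"
    then obtain M where M: "\<And>m n. m \<ge> M \<Longrightarrow> n \<ge> M \<Longrightarrow> b (Y m - Y n) (Y m - Y n) < r\<^sup>2"
      using Y(4)[of "r\<^sup>2"] by auto
    have "norm (T (Y m) - T (Y n)) < r" if "m \<ge> M" "n \<ge> M" for m n
    proof -
      have "(norm (T (Y m) - T (Y n)))\<^sup>2 \<le> b (Y m - Y n) (Y m - Y n)"
        using Y t by (simp add: b_def Tdiff power2_norm_eq_inner)
      also have "\<dots> < r\<^sup>2" using M that by simp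
      finally show ?thesis using \<open>0 < r\<close> by (meson less_eq_real_def power2_less_imp_less)
    qed
    then show "\<exists>M. \<forall>m\<ge>M. \<forall>n\<ge>M. norm (T (Y m) - T (Y n)) < r" by blast
  qed
  then have "convergent (\<lambda>n. T (Y n))" by (rule Cauchy_convergent)
  then obtain w where w: "(\<lambda>n. T (Y n)) \<longlonglongrightarrow> w" unfolding convergent_def by blast
  have z: "riesz h \<in> V" "T (riesz h) = w" using closed[OF Y(1,2) w] by auto
  have "t * inner (riesz h) y + inner (T (riesz h)) (T y) = inner h y" if y: "y \<in> V" for y
  proof (rule LIMSEQ_unique)
    show "(\<lambda>n. b (Y n) y) \<longlonglongrightarrow> inner h y" using Y y by simp
    show "(\<lambda>n. b (Y n) y) \<longlonglongrightarrow> t * inner (riesz h) y + inner (T (riesz h)) (T y)"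
      using Y(2) w z by (subst (1) b_def) (intro tendsto_intros, auto)
  qed
  then show ?thesis using that z by blast
qed

text \<open>The zero map on a closed \<open>V\<close> has closed graph, so
  \<open>closed_graph_riesz\<close> with \<open>t = 1\<close> yields the projection.\<close>

lemma orthogonal_projection:
  fixes V :: "'a::{real_inner, complete_space} set"
  assumes "subspace V" "closed V"
  obtains z where "z \<in> V" "\<And>y. y \<in> V \<Longrightarrow> inner (h - z) y = 0"
proof -
  obtain z where z: "z \<in> V" "\<And>y. y \<in> V \<Longrightarrow> 1 * inner z y + inner ((\<lambda>_. 0::'a) z) ((\<lambda>_. 0) y) = inner h y"
    by (rule closed_graph_riesz[of V "\<lambda>_. 0" 1 1 h])
      (use assms in \<open>auto simp: closed_sequential_limits LIMSEQ_const_iff\<close>)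
  then show ?thesis using that by (simp add: inner_diff_left)
qed

section \<open>Self-adjoint operators\<close>

lemma closure_approx:
  fixes x :: "'a::real_normed_vector"
  assumes "closure D = UNIV" "0 < r"
  obtains g where "g \<in> D" "norm (x - g) < r"
  using closure_approachable[of x D] assms by (metis UNIV_I dist_norm norm_minus_commute)

locale sa_op =
  fixes D :: "'a::{real_inner, complete_space} set" and A :: "'a \<Rightarrow> 'a"
  assumes sa: "self_adjoint_op D A"
begin

lemma subD: "subspace D"
  and dense: "closure D = UNIV"
  and A_add: "x \<in> D \<Longrightarrow> y \<in> D \<Longrightarrow> A (x + y) = A x + A y"
  and A_scale: "x \<in> D \<Longrightarrow> A (c *\<^sub>R x) = c *\<^sub>R A x"
  using sa by (simp_all add: self_adjoint_op_def)

lemma A_symmetric: "x \<in> D \<Longrightarrow> y \<in> D \<Longrightarrow> inner (A x) y = inner x (A y)"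
  using sa unfolding self_adjoint_op_def by (elim conjE) (metis (no_types))

text \<open>The maximality half of self-adjointness, and the usual route to membership in the
  domain.\<close>

lemma adjointI: "(\<And>x. x \<in> D \<Longrightarrow> inner (A x) y = inner x z) \<Longrightarrow> y \<in> D \<and> A y = z"
  using sa unfolding self_adjoint_op_def by (elim conjE) (metis (no_types))

lemma D_add [intro]: "x \<in> D \<Longrightarrow> y \<in> D \<Longrightarrow> x + y \<in> D"
  and D_diff [intro]: "x \<in> D \<Longrightarrow> y \<in> D \<Longrightarrow> x - y \<in> D"
  and D_scale [intro]: "x \<in> D \<Longrightarrow> r *\<^sub>R x \<in> D"
  and D_zero [intro, simp]: "0 \<in> D"
  by (simp_all add: subspace_add subspace_diff subspace_scale subspace_0 subD)

lemma A_diff: "x \<in> D \<Longrightarrow> y \<in> D \<Longrightarrow> A (x - y) = A x - A y"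
  using A_add[of "x - y" y] D_diff[of x y] by simp

lemma A_zero [simp]: "A 0 = 0"
  using A_scale[of 0 0] by simp

lemma A_minus: "x \<in> D \<Longrightarrow> A (- x) = - A x"
  using A_scale[of x "-1"] by simp

lemma closed_graph:
  assumes "\<And>n. X n \<in> D" "X \<longlonglongrightarrow> x" "(\<lambda>n. A (X n)) \<longlonglongrightarrow> y"
  shows "x \<in> D \<and> A x = y"
proof (rule adjointI)
  fix u assume u: "u \<in> D"
  have "(\<lambda>n. inner (A u) (X n)) \<longlonglongrightarrow> inner (A u) x" "(\<lambda>n. inner u (A (X n))) \<longlonglongrightarrow> inner u y"
    using assms by (auto intro!: tendsto_intros)
  moreover have "inner (A u) (X n) = inner u (A (X n))" for n using assms u A_symmetric by blast
  ultimately show "inner (A u) x = inner u y" using LIMSEQ_unique by auto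
qed

lemma sa_uminus: "self_adjoint_op D (\<lambda>x. - A x)"
  unfolding self_adjoint_op_def
proof (intro conjI ballI allI)
  show "subspace D" "closure D = UNIV" by (rule subD, rule dense)
  show "- A (x + y) = - A x + - A y" if "x \<in> D" "y \<in> D" for x y using A_add[OF that] by simp
  show "- A (c *\<^sub>R x) = c *\<^sub>R - A x" if "x \<in> D" for c x using A_scale[OF that] by simp
  show "(\<forall>x\<in>D. inner (- A x) y = inner x z) = (y \<in> D \<and> z = - A y)" for y z
  proof
    assume "\<forall>x\<in>D. inner (- A x) y = inner x z"
    then have "y \<in> D \<and> A y = - z" by (intro adjointI) (simp add: minus_equation_iff)
    then show "y \<in> D \<and> z = - A y" by simp
  qed (auto simp: A_symmetric)
qed

lemma sa_shift: "self_adjoint_op D (\<lambda>x. A x - c *\<^sub>R x)"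
  unfolding self_adjoint_op_def
proof (intro conjI ballI allI)
  show "subspace D" "closure D = UNIV" by (rule subD, rule dense)
  show "A (x + y) - c *\<^sub>R (x + y) = A x - c *\<^sub>R x + (A y - c *\<^sub>R y)" if "x \<in> D" "y \<in> D" for x y
    using A_add[OF that] by (simp add: algebra_simps)
  show "A (r *\<^sub>R x) - c *\<^sub>R (r *\<^sub>R x) = r *\<^sub>R (A x - c *\<^sub>R x)" if "x \<in> D" for r x
    using A_scale[OF that] by (simp add: algebra_simps)
  show "(\<forall>x\<in>D. inner (A x - c *\<^sub>R x) y = inner x z) = (y \<in> D \<and> z = A y - c *\<^sub>R y)" for y z
  proof
    assume "\<forall>x\<in>D. inner (A x - c *\<^sub>R x) y = inner x z"
    then have "y \<in> D \<and> A y = z + c *\<^sub>R y"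
      by (intro adjointI) (auto simp: inner_diff_left inner_add_right algebra_simps)
    then show "y \<in> D \<and> z = A y - c *\<^sub>R y" by simp
  qed (auto simp: A_symmetric inner_diff_left inner_diff_right)
qed

text \<open>The equation is solved weakly by Riesz representation on the graph of \<open>A\<close>;
  the weak equation is precisely the adjoint condition for \<open>A u\<close>, which yields
  \<open>A u \<in> D\<close>.\<close>

lemma square_resolvent_exists:
  assumes "0 < t" obtains u where "u \<in> D" "A u \<in> D" "t *\<^sub>R u + A (A u) = h"
proof -
  obtain u where u: "u \<in> D" "\<And>y. y \<in> D \<Longrightarrow> t * inner u y + inner (A u) (A y) = inner h y"
    by (rule closed_graph_riesz[where V=D and T=A and t=t and k=t and h=h, OF subD A_add A_scale closed_graph]) (use assms in auto)
  have "A u \<in> D \<and> A (A u) = h - t *\<^sub>R u"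
    by (rule adjointI) (use u(2) in \<open>force simp: inner_diff_right inner_commute\<close>)
  then show ?thesis using that u by auto
qed

lemma square_resolvent_bound:
  assumes "0 < t" "u \<in> D" "A u \<in> D" "t *\<^sub>R u + A (A u) = t *\<^sub>R h"
  shows "norm u \<le> norm h"
proof -
  have "t * (norm u)\<^sup>2 + (norm (A u))\<^sup>2 = inner (t *\<^sub>R u + A (A u)) u"
    using A_symmetric[of "A u" u] assms(2,3) by (simp add: inner_add_left power2_norm_eq_inner)
  also have "\<dots> \<le> t * (norm h * norm u)"
    using assms norm_cauchy_schwarz[of h u] by simp
  finally have "t * (norm u * norm u) \<le> t * (norm h * norm u)" by (smt (verit) power2_eq_square zero_le_power2)
  then have "norm u * norm u \<le> norm h * norm u" using assms(1) by simp
  then show ?thesis by (meson self_mult_le_cancel norm_ge_zero)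
qed

text \<open>Testing \<open>t *\<^sub>R (h - u) = A (A u)\<close> with \<open>h - u\<close> gives
  both estimates; the first is a rate of order \<open>1 / sqrt t\<close> for the convergence of
  \<open>u\<close> to \<open>h\<close>.\<close>

lemma square_resolvent_dist:
  assumes "0 < t" "u \<in> D" "A u \<in> D" "t *\<^sub>R u + A (A u) = t *\<^sub>R h" "h \<in> D"
  shows "t * (norm (h - u))\<^sup>2 \<le> (norm (A h))\<^sup>2" "norm (A u) \<le> norm (A h)"
proof -
  have "t *\<^sub>R (h - u) = A (A u)" using assms by (simp add: algebra_simps)
  then have "t * inner (h - u) (h - u) = inner (A (A u)) (h - u)" by (metis inner_scaleR_left)
  also have "\<dots> = inner (A u) (A h) - inner (A u) (A u)"
    using assms by (subst A_symmetric) (auto simp: A_diff inner_diff_right)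
  finally have e: "t * (norm (h - u))\<^sup>2 + (norm (A u))\<^sup>2 = inner (A u) (A h)" by (simp add: power2_norm_eq_inner)
  then have "norm (A u) * norm (A u) \<le> norm (A h) * norm (A u)"
    using norm_cauchy_schwarz[of "A u" "A h"] assms(1)
    by (smt (verit) mult.commute mult_nonneg_nonneg power2_eq_square zero_le_power2)
  then show 2: "norm (A u) \<le> norm (A h)" by (meson self_mult_le_cancel norm_ge_zero)
  have "t * (norm (h - u))\<^sup>2 \<le> norm (A u) * norm (A h)"
    using e norm_cauchy_schwarz[of "A u" "A h"] by (smt (verit) zero_le_power2)
  also have "\<dots> \<le> (norm (A h))\<^sup>2" using 2 by (simp add: power2_eq_square mult_right_mono)
  finally show "t * (norm (h - u))\<^sup>2 \<le> (norm (A h))\<^sup>2" .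
qed

text \<open>Strong convergence of \<open>t (t + A^2)^{-1}\<close> to the identity: the operators are
  contractions by \<open>square_resolvent_bound\<close>, and the rate known on the dense domain
  extends by a three-term estimate.\<close>

lemma square_resolvent_tendsto:
  assumes u: "\<And>n. u n \<in> D" "\<And>n. A (u n) \<in> D" "\<And>n. real (Suc n) *\<^sub>R u n + A (A (u n)) = real (Suc n) *\<^sub>R h"
  shows "u \<longlonglongrightarrow> h"
proof (rule LIMSEQ_I)
  fix r :: real assume r: "0 < r"
  obtain g where g: "g \<in> D" "norm (h - g) < r / 3" using closure_approx[OF dense] r by (metis divide_pos_pos zero_less_numeral)
  have "\<exists>w. w \<in> D \<and> A w \<in> D \<and> real (Suc n) *\<^sub>R w + A (A w) = real (Suc n) *\<^sub>R g" for n
    using square_resolvent_exists[of "real (Suc n)"] by (metis of_nat_0_less_iff zero_less_Suc)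
  then obtain w where w: "\<And>n. w n \<in> D" "\<And>n. A (w n) \<in> D" "\<And>n. real (Suc n) *\<^sub>R w n + A (A (w n)) = real (Suc n) *\<^sub>R g"
    by metis
  obtain N where N: "9 * (norm (A g))\<^sup>2 / r\<^sup>2 < real N" using reals_Archimedean2 by blast
  have "norm (u n - h) < r" if "n \<ge> N" for n
  proof -
    have "norm (u n - w n) \<le> norm (h - g)"
    proof (rule square_resolvent_bound[of "real (Suc n)"])
      show "real (Suc n) *\<^sub>R (u n - w n) + A (A (u n - w n)) = real (Suc n) *\<^sub>R (h - g)"
        using u[of n] w[of n] by (simp add: A_diff algebra_simps del: of_nat_Suc)
      show "A (u n - w n) \<in> D" using u w by (simp add: A_diff D_diff)
    qed (use u w in auto)
    moreover have "norm (g - w n) < r / 3"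
    proof -
      have "real (Suc n) * (norm (g - w n))\<^sup>2 \<le> (norm (A g))\<^sup>2"
        by (rule square_resolvent_dist) (use w g in auto)
      also have "\<dots> < real N * r\<^sup>2 / 9" using N r by (simp add: field_simps)
      also have "\<dots> \<le> real (Suc n) * (r / 3)\<^sup>2" using that by (simp add: power_divide mult_right_mono del: of_nat_Suc)
      finally have "(norm (g - w n))\<^sup>2 < (r / 3)\<^sup>2" by (rule mult_left_less_imp_less) simp
      then show ?thesis using r by (meson divide_nonneg_nonneg less_imp_le power2_less_imp_less zero_le_numeral)
    qed
    moreover have "norm (u n - h) \<le> norm (u n - w n) + norm (g - w n) + norm (h - g)"
    proof -
      have "u n - h = (u n - w n) - (g - w n) - (h - g)" by simp
      then show ?thesis
        using norm_triangle_ineq4[of "(u n - w n) - (g - w n)" "h - g"] norm_triangle_ineq4[of "u n - w n" "g - w n"] by simp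
    qed
    ultimately show ?thesis using g by linarith
  qed
  then show "\<exists>no. \<forall>n\<ge>no. norm (u n - h) < r" by blast
qed

text \<open>The domain of the square is a core. The approximants commute with \<open>A\<close>, so
  the same convergence result applies to \<open>x\<close> and to \<open>A x\<close>.\<close>

lemma graph_core_square:
  assumes x: "x \<in> D"
  obtains X where "\<And>n. X n \<in> D" "\<And>n. A (X n) \<in> D" "X \<longlonglongrightarrow> x" "(\<lambda>n. A (X n)) \<longlonglongrightarrow> A x"
proof -
  have "\<exists>w. w \<in> D \<and> A w \<in> D \<and> real (Suc n) *\<^sub>R w + A (A w) = real (Suc n) *\<^sub>R x" for n
    using square_resolvent_exists[of "real (Suc n)"] by (metis of_nat_0_less_iff zero_less_Suc)
  then obtain X where X: "\<And>n. X n \<in> D" "\<And>n. A (X n) \<in> D" "\<And>n. real (Suc n) *\<^sub>R X n + A (A (X n)) = real (Suc n) *\<^sub>R x"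
    by metis
  have "X \<longlonglongrightarrow> x" by (rule square_resolvent_tendsto[OF X])
  moreover have "(\<lambda>n. A (X n)) \<longlonglongrightarrow> A x"
  proof (rule square_resolvent_tendsto)
    fix n
    have e: "A (A (X n)) = real (Suc n) *\<^sub>R (x - X n)" using X(3)[of n] by (simp add: algebra_simps del: of_nat_Suc)
    show "A (X n) \<in> D" "A (A (X n)) \<in> D" using X x e by auto
    have "A (A (A (X n))) = real (Suc n) *\<^sub>R (A x - A (X n))"
      unfolding e using X(1) x by (simp add: A_scale A_diff D_diff del: of_nat_Suc)
    then show "real (Suc n) *\<^sub>R A (X n) + A (A (A (X n))) = real (Suc n) *\<^sub>R A x"
      by (simp add: algebra_simps del: of_nat_Suc)
  qed
  ultimately show ?thesis using that[OF X(1,2)] by simp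
qed

lemma self_adjoint_square:
  assumes dom: "D' = {x \<in> D. A x \<in> D}"
  shows "self_adjoint_op D' (\<lambda>x. A (A x))"
  unfolding self_adjoint_op_def
proof (intro conjI ballI allI)
  show "subspace D'" unfolding dom using A_add A_scale by (auto simp: subspace_def)
  show "closure D' = UNIV"
  proof (intro set_eqI iffI UNIV_I)
    fix x show "x \<in> closure D'"
      unfolding closure_approachable
    proof (intro allI impI)
      fix r :: real assume r: "0 < r"
      obtain g where g: "g \<in> D" "norm (x - g) < r / 2" using closure_approx[OF dense] r by (metis half_gt_zero)
      obtain X where X: "\<And>n. X n \<in> D" "\<And>n. A (X n) \<in> D" "X \<longlonglongrightarrow> g"
        by (rule graph_core_square[OF g(1)]) (rule that)
      obtain n where "norm (X n - g) < r / 2" using LIMSEQ_D[OF X(3), of "r/2"] r by auto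
      then have "dist (X n) x < r" using g norm_triangle_ineq4[of "X n - g" "x - g"] by (simp add: dist_norm)
      then show "\<exists>y\<in>D'. dist y x < r" using X by (auto simp: dom)
    qed
  qed
  show "A (A (x + y)) = A (A x) + A (A y)" if "x \<in> D'" "y \<in> D'" for x y using that by (auto simp: dom A_add)
  show "A (A (c *\<^sub>R x)) = c *\<^sub>R A (A x)" if "x \<in> D'" for c x using that by (auto simp: dom A_scale)
  show "(\<forall>x\<in>D'. inner (A (A x)) y = inner x z) = (y \<in> D' \<and> z = A (A y))" for y z
  proof
    assume h: "\<forall>x\<in>D'. inner (A (A x)) y = inner x z"
    \<comment> \<open>\<open>1 + A^2\<close> is onto. \<open>u\<close> is the vector that
      \<open>y\<close> must equal: testing the hypothesis with the \<open>x\<close> that solves the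
      equation for \<open>y - u\<close> gives \<open>inner (y - u) (y - u) = 0\<close>.\<close>
    obtain u where u: "u \<in> D" "A u \<in> D" "1 *\<^sub>R u + A (A u) = y + z" using square_resolvent_exists[of 1] by (metis zero_less_one)
    obtain x where x: "x \<in> D" "A x \<in> D" "1 *\<^sub>R x + A (A x) = y - u" using square_resolvent_exists[of 1] by (metis zero_less_one)
    have "inner (A (A x)) u = inner x (A (A u))" using u x by (simp add: A_symmetric)
    moreover have "inner (A (A x)) y = inner x z" using h x by (auto simp: dom)
    ultimately have "inner (x + A (A x)) (y - u) = inner x (y + z - (u + A (A u)))"
      by (simp add: inner_diff_right inner_add_left inner_add_right)
    then have "inner (y - u) (y - u) = 0" using u x by simp
    then show "y \<in> D' \<and> z = A (A y)" using u by (auto simp: dom)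
  qed (auto simp: dom A_symmetric)
qed

end

lemma sa_opI: "self_adjoint_op D A \<Longrightarrow> sa_op D A"
  by unfold_locales

text \<open>Heinz's inequality for exponent 1/2; the lowest approximate eigenvector \<open>x\<close> of \<open>B - C\<close> is
  tested against \<open>(B + C) x\<close>.\<close>

lemma heinz_bounded:
  fixes B C :: "'a::real_inner \<Rightarrow> 'a"
  assumes lin: "linear B" "linear C"
    and symm: "\<And>x y. inner (B x) y = inner x (B y)" "\<And>x y. inner (C x) y = inner x (C y)"
    and bound: "\<And>x. norm (B x) \<le> K * norm x" and K: "0 \<le> K"
    and nonneg: "\<And>x. 0 \<le> inner x (B x)" and CB: "\<And>x. norm (C x) \<le> norm (B x)"
  shows "inner x (C x) \<le> inner x (B x)"
proof (rule ccontr)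
  assume neg: "\<not> ?thesis"
  define M where "M x = B x - C x" for x
  have linM: "linear M" unfolding M_def using lin by (intro linear_compose_sub)
  have symM: "inner (M x) y = inner x (M y)" for x y by (simp add: M_def inner_diff_left inner_diff_right symm)
  have Mb: "norm (M x) \<le> 2 * K * norm x" for x
    using norm_triangle_ineq4[of "B x" "C x"] bound[of x] CB[of x] by (simp add: M_def)
  let ?S = "{x::'a. norm x = 1}"
  define m where "m = (INF x\<in>?S. inner x (M x))"
  have bdd: "bdd_below ((\<lambda>x. inner x (M x)) ` ?S)"
  proof (rule bdd_belowI2)
    fix x assume "x \<in> ?S"
    then show "- (2 * K) \<le> inner x (M x)" using Mb[of x] Cauchy_Schwarz_ineq2[of x "M x"] by simp
  qed
  have x0: "x \<noteq> 0" using neg lin by (auto simp: linear_0)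
  have lowM: "m * (norm x)\<^sup>2 \<le> inner x (M x)" for x
  proof (cases "x = 0")
    case False
    have "m \<le> inner (x /\<^sub>R norm x) (M (x /\<^sub>R norm x))"
      unfolding m_def using bdd False by (intro cINF_lower) auto
    also have "\<dots> = inner x (M x) / (norm x)\<^sup>2"
      using linM by (simp add: linear_scale power2_eq_square field_simps)
    finally show ?thesis using False by (simp add: field_simps)
  qed simp
  have "m * (norm x)\<^sup>2 < 0" using lowM[of x] neg by (simp add: M_def inner_diff_right)
  then have m: "m < 0" using x0 by (simp add: mult_less_0_iff)
  \<comment> \<open>An upper bound for the form of \<open>M - m\<close> on unit vectors, since
    \<open>norm (M x) \<le> 2 * K * norm x\<close>.\<close>
  define L where "L = 2 * K - m"
  have L: "L > 0" using K m by (simp add: L_def)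
  interpret N: sym_form UNIV "\<lambda>x y. inner x (M y) - m * inner x y"
  proof unfold_locales
    show "inner x (M y) - m * inner x y = inner y (M x) - m * inner y x" for x y
      by (metis inner_commute symM)
  qed (auto simp: inner_add_left algebra_simps)
  have Nn: "0 \<le> inner x (M x) - m * inner x x" for x using lowM[of x] by (simp add: power2_norm_eq_inner)
  \<comment> \<open>Cauchy-Schwarz for the nonnegative form of \<open>M - m\<close>, tested with the
    image of \<open>x\<close> itself: an approximate minimizer is an approximate
    eigenvector.\<close>
  have w: "(norm (M x - m *\<^sub>R x))\<^sup>2 \<le> L * (inner x (M x) - m * inner x x)" for x
  proof -
    let ?w = "M x - m *\<^sub>R x"
    let ?s = "(norm ?w)\<^sup>2"
    have "inner ?w (M ?w) - m * inner ?w ?w \<le> L * ?s"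
      using Cauchy_Schwarz_ineq2[of ?w "M ?w"] mult_left_mono[OF Mb[of ?w] norm_ge_zero[of ?w]]
      by (simp add: L_def power2_norm_eq_inner[symmetric] power2_eq_square algebra_simps)
    then have "(inner x (M x) - m * inner x x) * (inner ?w (M ?w) - m * inner ?w ?w) \<le> (inner x (M x) - m * inner x x) * (L * ?s)"
      using Nn by (intro mult_left_mono)
    moreover have "(inner x (M ?w) - m * inner x ?w)\<^sup>2 \<le> (inner x (M x) - m * inner x x) * (inner ?w (M ?w) - m * inner ?w ?w)"
      by (rule N.Cauchy_Schwarz[of UNIV]) (use Nn in auto)
    moreover have "inner x (M ?w) - m * inner x ?w = ?s"
      using symM[of x ?w] by (simp add: power2_norm_eq_inner inner_diff_left)
    ultimately have "?s * ?s \<le> (L * (inner x (M x) - m * inner x x)) * ?s" by (simp add: power2_eq_square mult_ac)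
    then show ?thesis by (rule self_mult_le_cancel) (use L Nn[of x] in auto)
  qed
  \<comment> \<open>The first bound keeps \<open>inner u (M u)\<close> below \<open>m / 2\<close>;
    the second makes the final comparison
    \<open>m ^ 4 / 4 \<le> 4 * K\<^sup>2 * (L * \<eta>)\<close> impossible. The summand
    \<open>16\<close> keeps the denominator positive when \<open>K = 0\<close>.\<close>
  define \<eta> where "\<eta> = min (- m / 2) (m ^ 4 / (16 * K\<^sup>2 * L + 16))"
  have "0 < 16 * K\<^sup>2 * L + 16" using L by (intro add_nonneg_pos mult_nonneg_nonneg) auto
  then have \<eta>: "\<eta> > 0" "\<eta> \<le> - m / 2" "4 * K\<^sup>2 * L * \<eta> < m ^ 4 / 4"
  proof -
    show "\<eta> > 0" using m \<open>0 < 16 * K\<^sup>2 * L + 16\<close> by (simp add: \<eta>_def)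
    show "\<eta> \<le> - m / 2" by (simp add: \<eta>_def)
    have "16 * K\<^sup>2 * L * \<eta> < (16 * K\<^sup>2 * L + 16) * \<eta>" using \<open>\<eta> > 0\<close> by (simp add: algebra_simps)
    also have "\<dots> \<le> m ^ 4"
      using pos_le_divide_eq[OF \<open>0 < 16 * K\<^sup>2 * L + 16\<close>, of \<eta> "m ^ 4"] by (simp add: \<eta>_def mult.commute)
    finally show "4 * K\<^sup>2 * L * \<eta> < m ^ 4 / 4" by simp
  qed
  have "\<exists>x\<in>?S. inner x (M x) < m + \<eta>"
  proof -
    have "m < m + \<eta>" using \<eta> by simp
    moreover have "x /\<^sub>R norm x \<in> ?S" using x0 by simp
    then have "?S \<noteq> {}" by blast
    ultimately show ?thesis using cINF_less_iff[OF _ bdd, of "m + \<eta>"] unfolding m_def[symmetric] by blast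
  qed
  then obtain u where u: "norm u = 1" "inner u (M u) < m + \<eta>" by auto
  have uu: "inner u u = 1" using u by (simp add: power2_norm_eq_inner[symmetric])
  let ?w = "M u - m *\<^sub>R u" and ?v = "B u + C u"
  have v: "norm ?v \<le> 2 * K" using norm_triangle_ineq[of "B u" "C u"] bound[of u] CB[of u] u by simp
  \<comment> \<open>In \<open>inner (B u - C u) (B u + C u)\<close> the mixed terms cancel and
    \<open>CB\<close> gives the sign, whereas an exact eigenvector at \<open>m\<close> would make
    the pairing \<open>m * inner u ?v\<close>, which is strictly negative.\<close>
  have "inner (M u) ?v = (norm (B u))\<^sup>2 - (norm (C u))\<^sup>2"
    by (simp add: M_def inner_diff_left inner_diff_right inner_add_right power2_norm_eq_inner inner_commute)
  also have "\<dots> \<ge> 0" using CB[of u] by (simp add: power_mono)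
  finally have "0 \<le> inner ?w ?v + m * inner u ?v" by (simp add: inner_diff_left)
  then have "- m * inner u ?v \<le> norm ?w * norm ?v" using norm_cauchy_schwarz[of ?w ?v] by linarith
  moreover have "- m / 2 \<le> inner u ?v"
    using nonneg[of u] u \<eta>(2) by (simp add: M_def inner_diff_right inner_add_right)
  then have "- m * (- m / 2) \<le> - m * inner u ?v" using m by (intro mult_left_mono) auto
  moreover have "norm ?w * norm ?v \<le> norm ?w * (2 * K)" using v by (intro mult_left_mono) auto
  ultimately have "m\<^sup>2 / 2 \<le> norm ?w * (2 * K)" by (simp add: power2_eq_square)
  then have "(m\<^sup>2 / 2)\<^sup>2 \<le> (norm ?w * (2 * K))\<^sup>2" by (intro power_mono) auto
  then have "m ^ 4 / 4 \<le> 4 * K\<^sup>2 * (norm ?w)\<^sup>2" by (simp add: power_mult_distrib power_divide mult_ac)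
  also have "\<dots> \<le> 4 * K\<^sup>2 * (L * (inner u (M u) - m * inner u u))" using w by (intro mult_left_mono) auto
  also have "\<dots> \<le> 4 * K\<^sup>2 * (L * \<eta>)" using u uu L by (intro mult_left_mono) auto
  finally show False using \<eta>(3) by (simp add: mult.assoc)
qed

text \<open>Reduction to bounded operators: with \<open>R = (t + T^2)^{-1}\<close>, the bounded case
  applies to \<open>T R\<close> and \<open>C R\<close>. Evaluated at \<open>(t + T^2) u\<close> it
  gives an inequality affine in \<open>t\<close>, whose leading coefficient is the claim as
  \<open>t\<close> grows; the core formed by the domain of \<open>T^2\<close> then covers all of
  \<open>D\<close>.\<close>

lemma heinz:
  fixes D :: "'a::{real_inner, complete_space} set"
  assumes T: "self_adjoint_op D T" "\<And>x. x \<in> D \<Longrightarrow> 0 \<le> inner x (T x)"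
    and C: "self_adjoint_op D C" and norms: "\<And>x. x \<in> D \<Longrightarrow> norm (C x) = norm (T x)" and y: "y \<in> D"
  shows "inner y (C y) \<le> inner y (T y)"
proof -
  interpret T: sa_op D T by (rule sa_opI[OF T(1)])
  interpret C: sa_op D C by (rule sa_opI[OF C])
  have polar: "inner (C x) (C y) = inner (T x) (T y)" if "x \<in> D" "y \<in> D" for x y
  proof -
    have "(norm (C (x + y)))\<^sup>2 = (norm (T (x + y)))\<^sup>2" "(norm (C x))\<^sup>2 = (norm (T x))\<^sup>2" "(norm (C y))\<^sup>2 = (norm (T y))\<^sup>2"
      using that norms T.D_add by auto
    then show ?thesis using that
      by (simp add: T.A_add C.A_add power2_norm_eq_inner inner_add_left inner_add_right inner_commute)
  qed
  \<comment> \<open>By \<open>polar\<close> the adjoint condition for \<open>C u\<close> transfers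
    from \<open>T\<close>, so \<open>C^2\<close> extends \<open>T^2\<close>.\<close>
  have CC: "C u \<in> D \<and> C (C u) = T (T u)" if "u \<in> D" "T u \<in> D" for u
    by (rule C.adjointI) (use that polar in \<open>simp add: T.A_symmetric\<close>)
  have step1: "inner u (C u) \<le> inner u (T u)" if u: "u \<in> D" "T u \<in> D" for u
  proof -
    define d where "d = inner u (C u) - inner u (T u)"
    define q where "q = inner (T (T u)) (T u) - inner (T (T u)) (C u)"
    have ineq: "t * d \<le> q" if t: "0 < t" for t
    proof -
      define P where "P h u \<longleftrightarrow> u \<in> D \<and> T u \<in> D \<and> t *\<^sub>R u + T (T u) = h" for h u
      have Puniq: "u = v" if "P h u" "P h v" for h u v
      proof -
        have "norm (u - v) \<le> norm (0::'a)"
          by (rule T.square_resolvent_bound[OF t])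
            (use that in \<open>auto simp: P_def T.A_diff T.D_diff scaleR_diff_right algebra_simps\<close>)
        then show ?thesis by simp
      qed
      define R where "R h = (THE u. P h u)" for h
      have PR: "P h (R h)" for h
      proof -
        obtain u where "P h u" using T.square_resolvent_exists[OF t] unfolding P_def by metis
        then show ?thesis unfolding R_def using Puniq by (metis theI)
      qed
      have R: "R h \<in> D" "T (R h) \<in> D" "t *\<^sub>R R h + T (T (R h)) = h" for h using PR[of h] by (auto simp: P_def)
      have Req: "P h u \<Longrightarrow> R h = u" for h u using PR Puniq by blast
      have Radd: "R (h + h') = R h + R h'" for h h'
        by (rule Req) (use R[of h] R[of h'] in \<open>auto simp: P_def T.A_add T.D_add algebra_simps\<close>)
      have Rscale: "R (c *\<^sub>R h) = c *\<^sub>R R h" for c h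
      proof (rule Req)
        have "t *\<^sub>R (c *\<^sub>R R h) + c *\<^sub>R T (T (R h)) = c *\<^sub>R (t *\<^sub>R R h + T (T (R h)))"
          by (simp add: algebra_simps)
        then show "P (c *\<^sub>R h) (c *\<^sub>R R h)" using R(1,2)[of h] by (simp add: P_def T.A_scale T.D_scale R(3))
      qed
      have lin: "linear (\<lambda>h. T (R h))" "linear (\<lambda>h. C (R h))"
        by (auto intro!: linearI simp: Radd Rscale T.A_add C.A_add T.A_scale C.A_scale R)
      have CR: "C (R h) \<in> D" "C (C (R h)) = T (T (R h))" for h using CC R by blast+
      have symT: "inner (T (R h)) h' = inner h (T (R h'))" for h h'
      proof -
        have "inner (T (R h)) (t *\<^sub>R R h' + T (T (R h'))) = inner (t *\<^sub>R R h + T (T (R h))) (T (R h'))"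
          using R(1,2) by (simp add: inner_add_left inner_add_right T.A_symmetric)
        then show ?thesis by (simp add: R)
      qed
      have symC: "inner (C (R h)) h' = inner h (C (R h'))" for h h'
      proof -
        have "inner (C (R h)) (t *\<^sub>R R h' + C (C (R h'))) = inner (t *\<^sub>R R h + C (C (R h))) (C (R h'))"
          using R(1,2) CR(1) by (simp add: inner_add_left inner_add_right C.A_symmetric)
        then show ?thesis by (simp add: R CR)
      qed
      have bound: "norm (T (R h)) \<le> (1 / sqrt t) * norm h" for h
      proof -
        have "t * (norm (R h))\<^sup>2 + (norm (T (R h)))\<^sup>2 = inner (t *\<^sub>R R h + T (T (R h))) (R h)"
          using R(1,2) by (simp add: inner_add_left T.A_symmetric power2_norm_eq_inner)
        also have "\<dots> = inner h (R h)" by (simp add: R)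
        also have "\<dots> \<le> norm h * norm (R h)" by (rule norm_cauchy_schwarz)
        finally have 1: "(norm (T (R h)))\<^sup>2 \<le> norm h * norm (R h) - t * (norm (R h))\<^sup>2" by simp
        have "0 \<le> (norm h / sqrt t - sqrt t * norm (R h))\<^sup>2" by simp
        also have "\<dots> = (norm h)\<^sup>2 / t - 2 * (norm h * norm (R h)) + t * (norm (R h))\<^sup>2"
          using t by (simp add: power2_diff power_mult_distrib power_divide)
        finally have "(norm (T (R h)))\<^sup>2 \<le> (norm h)\<^sup>2 / t"
          using 1 mult_nonneg_nonneg[OF norm_ge_zero[of h] norm_ge_zero[of "R h"]] by linarith
        also have "\<dots> = ((1 / sqrt t) * norm h)\<^sup>2" using t by (simp add: power_mult_distrib power_divide)
        finally show ?thesis by (rule power2_le_imp_le) (use t in simp)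
      qed
      have pos: "0 \<le> inner h (T (R h))" for h
      proof -
        have "inner (t *\<^sub>R R h + T (T (R h))) (T (R h)) = t * inner (R h) (T (R h)) + inner (T (R h)) (T (T (R h)))"
          by (subst inner_add_left) (simp add: inner_commute[of "T (T (R h))"])
        also have "\<dots> \<ge> 0" using R(1,2) T(2)[of "R h"] T(2)[of "T (R h)"] t by simp
        finally show ?thesis by (simp add: R)
      qed
      let ?h = "t *\<^sub>R u + T (T u)"
      have "inner ?h (C (R ?h)) \<le> inner ?h (T (R ?h))"
        by (rule heinz_bounded[OF lin symT symC bound _ pos]) (use t norms R in auto)
      moreover have "R ?h = u" by (rule Req) (use u in \<open>auto simp: P_def\<close>)
      ultimately show ?thesis by (simp add: inner_add_left d_def q_def algebra_simps)
    qed
    have "d \<le> 0"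
    proof (rule ccontr)
      assume "\<not> d \<le> 0"
      then have d: "d > 0" by simp
      have "(\<bar>q\<bar> + 1) / d * d \<le> q" by (rule ineq) (use d in simp)
      then show False using d by simp
    qed
    then show ?thesis by (simp add: d_def)
  qed
  show ?thesis
  proof -
    obtain X where X: "\<And>n. X n \<in> D" "\<And>n. T (X n) \<in> D" "X \<longlonglongrightarrow> y" "(\<lambda>n. T (X n)) \<longlonglongrightarrow> T y"
      by (rule T.graph_core_square[OF y]) (rule that)
    have "(\<lambda>n. C (X n)) \<longlonglongrightarrow> C y"
    proof -
      have "(\<lambda>n. norm (T (X n) - T y)) \<longlonglongrightarrow> 0" using X(4) by (intro tendsto_norm_zero LIM_zero)
      moreover have "norm (T (X n) - T y) = norm (C (X n) - C y)" for n
        using norms[of "X n - y"] X(1) y by (simp add: T.A_diff C.A_diff T.D_diff)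
      ultimately have "(\<lambda>n. norm (C (X n) - C y)) \<longlonglongrightarrow> 0" by simp
      then show ?thesis by (rule LIM_zero_cancel[OF tendsto_norm_zero_cancel])
    qed
    then have "(\<lambda>n. inner (X n) (C (X n))) \<longlonglongrightarrow> inner y (C y)" using X by (intro tendsto_intros)
    moreover have "(\<lambda>n. inner (X n) (T (X n))) \<longlonglongrightarrow> inner y (T y)" using X by (intro tendsto_intros)
    ultimately show ?thesis using step1 X by (intro LIMSEQ_le) auto
  qed
qed

section \<open>The closed form\<close>

text \<open>The arithmetic of polarization: bounds on a form at \<open>x + t y\<close> and
  \<open>x - t y\<close>, together with the parallelogram law for the bounding form, produce the
  hypothesis of \<open>discriminant\<close>.\<close>

lemma polarization_bound:
  fixes p m p' m' u v a t :: real
  assumes "\<bar>p\<bar> \<le> p'" "\<bar>m\<bar> \<le> m'" "p - m = 4 * t * a" "p' + m' = 2 * (u + v)"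
  shows "0 \<le> v + 2 * t * a + u"
proof -
  have "- p' \<le> p" "m \<le> m'" using assms(1,2) by auto
  then show ?thesis using assms(3,4) by argo
qed

locale abs_sqrt = sa_op D A for D :: "'a::{real_inner, complete_space} set" and A +
  fixes DS S
  assumes abs_sqrt: "is_abs_sqrt D A DS S"
begin

sublocale S: sa_op DS S
  using abs_sqrt by unfold_locales (simp add: is_abs_sqrt_def)

lemma D_eq: "D = {x \<in> DS. S x \<in> DS}"
  and S_nonneg: "x \<in> DS \<Longrightarrow> 0 \<le> inner x (S x)"
  and norm_SS: "x \<in> D \<Longrightarrow> norm (S (S x)) = norm (A x)"
  using abs_sqrt unfolding is_abs_sqrt_def by blast+

lemma D_subset: "x \<in> D \<Longrightarrow> x \<in> DS" and S_D: "x \<in> D \<Longrightarrow> S x \<in> DS"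
  using D_eq by auto

lemma sa_SS: "self_adjoint_op D (\<lambda>x. S (S x))"
  by (rule S.self_adjoint_square[OF D_eq])

lemma inner_SS: "x \<in> D \<Longrightarrow> inner x (S (S x)) = (norm (S x))\<^sup>2"
  using S.A_symmetric[of x "S x"] D_subset S_D by (simp add: power2_norm_eq_inner)

text \<open>Heinz's inequality for \<open>S^2\<close> against \<open>A\<close> and against
  \<open>- A\<close>, all three having the same norms on \<open>D\<close>.\<close>

lemma abs_form_le: assumes "x \<in> D" shows "\<bar>inner x (A x)\<bar> \<le> (norm (S x))\<^sup>2"
proof -
  have nn: "0 \<le> inner x (S (S x))" if "x \<in> D" for x using inner_SS[OF that] by simp
  have "inner x (A x) \<le> inner x (S (S x))"
    by (rule heinz[OF sa_SS nn sa _ assms]) (auto simp: norm_SS)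
  moreover have "inner x (- A x) \<le> inner x (S (S x))"
    by (rule heinz[OF sa_SS nn sa_uminus _ assms]) (auto simp: norm_SS)
  ultimately show ?thesis using inner_SS[OF assms] by (simp add: abs_le_iff)
qed

interpretation SF: sym_form DS "\<lambda>x y. inner (S x) (S y)"
  by unfold_locales
    (auto simp: S.subD S.A_add S.A_scale inner_add_left inner_add_right inner_commute)

lemma abs_bilinear_le: assumes "x \<in> D" "y \<in> D" shows "\<bar>inner (A x) y\<bar> \<le> norm (S x) * norm (S y)"
proof -
  have "(inner (A x) y)\<^sup>2 \<le> inner (S x) (S x) * inner (S y) (S y)"
  proof (rule SF.discriminant)
    fix t
    have 1: "\<bar>inner (x + t *\<^sub>R y) (A (x + t *\<^sub>R y))\<bar> \<le> (norm (S (x + t *\<^sub>R y)))\<^sup>2"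
      "\<bar>inner (x - t *\<^sub>R y) (A (x - t *\<^sub>R y))\<bar> \<le> (norm (S (x - t *\<^sub>R y)))\<^sup>2"
      using assms by (auto intro!: abs_form_le)
    have 2: "inner (x + t *\<^sub>R y) (A (x + t *\<^sub>R y)) - inner (x - t *\<^sub>R y) (A (x - t *\<^sub>R y)) = 4 * t * inner (A x) y"
    proof -
      have "inner y (A x) = inner (A x) y" "inner x (A y) = inner (A x) y"
        using A_symmetric[OF assms] by (auto simp: inner_commute)
      then show ?thesis
        using assms by (simp add: A_add A_diff A_scale D_scale inner_add_left inner_add_right inner_diff_left inner_diff_right algebra_simps)
    qed
    have 3: "(norm (S (x + t *\<^sub>R y)))\<^sup>2 + (norm (S (x - t *\<^sub>R y)))\<^sup>2
        = 2 * (inner (S x) (S x) + inner (S (t *\<^sub>R y)) (S (t *\<^sub>R y)))"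
      using assms D_subset
      by (simp add: S.A_add S.A_diff S.D_scale power2_norm_eq_inner inner_add_left inner_add_right inner_diff_left inner_diff_right algebra_simps)
    show "0 \<le> inner (S (t *\<^sub>R y)) (S (t *\<^sub>R y)) + 2 * t * inner (A x) y + inner (S x) (S x)"
      by (rule polarization_bound[OF 1 2 3])
  qed (use assms D_subset in auto)
  then have "\<bar>inner (A x) y\<bar>\<^sup>2 \<le> (norm (S x) * norm (S y))\<^sup>2" by (simp add: power_mult_distrib power2_norm_eq_inner)
  then show ?thesis by (rule power2_le_imp_le) simp
qed

text \<open>Convergence in the form norm through vectors of \<open>D\<close>: these are the
  sequences over which \<open>form_val\<close> quantifies.\<close>

definition form_conv :: "(nat \<Rightarrow> 'a) \<Rightarrow> 'a \<Rightarrow> bool" where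
  "form_conv X x \<longleftrightarrow> (\<forall>n. X n \<in> D) \<and> X \<longlonglongrightarrow> x \<and> (\<lambda>n. S (X n)) \<longlonglongrightarrow> S x"

lemma form_conv_exists: assumes "x \<in> DS" obtains X where "form_conv X x"
proof -
  obtain X where X: "\<And>n. X n \<in> DS" "\<And>n. S (X n) \<in> DS" "X \<longlonglongrightarrow> x" "(\<lambda>n. S (X n)) \<longlonglongrightarrow> S x"
    by (rule S.graph_core_square[OF assms]) (rule that)
  then have "form_conv X x" unfolding form_conv_def using D_eq by blast
  then show ?thesis by (rule that)
qed

lemma form_conv_const: "x \<in> D \<Longrightarrow> form_conv (\<lambda>_. x) x"
  by (simp add: form_conv_def)

lemma form_conv_dom: "form_conv X x \<Longrightarrow> x \<in> DS"
  unfolding form_conv_def using S.closed_graph[of X x "S x"] D_subset by blast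

lemma form_conv_add:
  assumes X: "form_conv X x" and Y: "form_conv Y y" shows "form_conv (\<lambda>n. X n + Y n) (x + y)"
proof -
  have "S (x + y) = S x + S y" "\<And>n. S (X n + Y n) = S (X n) + S (Y n)"
    using form_conv_dom[OF X] form_conv_dom[OF Y] X Y D_subset by (auto simp: form_conv_def S.A_add)
  then show ?thesis
    using X Y unfolding form_conv_def by (simp add: D_add tendsto_add)
qed

lemma form_conv_scale:
  assumes X: "form_conv X x" shows "form_conv (\<lambda>n. c *\<^sub>R X n) (c *\<^sub>R x)"
proof -
  have "S (c *\<^sub>R x) = c *\<^sub>R S x" "\<And>n. S (c *\<^sub>R X n) = c *\<^sub>R S (X n)"
    using form_conv_dom[OF X] X D_subset by (auto simp: form_conv_def S.A_scale)
  then show ?thesis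
    using X unfolding form_conv_def by (simp add: D_scale tendsto_scaleR)
qed

lemma form_conv_diff: "form_conv X x \<Longrightarrow> form_conv Y y \<Longrightarrow> form_conv (\<lambda>n. X n - Y n) (x - y)"
  using form_conv_add[of X x "\<lambda>n. (-1) *\<^sub>R Y n" "(-1) *\<^sub>R y"] form_conv_scale[of Y y "-1"] by simp

lemma quad_diff_bound:
  assumes "x \<in> D" "y \<in> D"
  shows "\<bar>inner x (A x) - inner y (A y)\<bar> \<le> norm (S x - S y) * (norm (S x) + norm (S y))"
proof -
  have "inner x (A x) - inner y (A y) = inner (A (x - y)) (x + y)"
    using A_symmetric[OF assms] assms by (simp add: A_diff inner_diff_left inner_add_right inner_add_left inner_diff_right inner_commute)
  also have "\<bar>\<dots>\<bar> \<le> norm (S (x - y)) * norm (S (x + y))" using assms by (intro abs_bilinear_le) auto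
  also have "\<dots> \<le> norm (S x - S y) * (norm (S x) + norm (S y))"
    using assms D_subset by (simp add: S.A_diff S.A_add mult_left_mono norm_triangle_ineq)
  finally show ?thesis .
qed

lemma form_conv_close:
  assumes X: "form_conv X x" and Y: "form_conv Y x"
  shows "(\<lambda>n. inner (X n) (A (X n)) - inner (Y n) (A (Y n))) \<longlonglongrightarrow> 0"
proof (rule Lim_null_comparison)
  show "\<forall>\<^sub>F n in sequentially. norm (inner (X n) (A (X n)) - inner (Y n) (A (Y n)))
      \<le> norm (S (X n) - S (Y n)) * (norm (S (X n)) + norm (S (Y n)))"
    using X Y by (intro always_eventually allI) (auto simp: form_conv_def intro!: quad_diff_bound)
  have "(\<lambda>n. norm (S (X n) - S (Y n)) * (norm (S (X n)) + norm (S (Y n)))) \<longlonglongrightarrow> norm (S x - S x) * (norm (S x) + norm (S x))"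
    using X Y unfolding form_conv_def by (elim conjE) (intro tendsto_intros)
  then show "(\<lambda>n. norm (S (X n) - S (Y n)) * (norm (S (X n)) + norm (S (Y n)))) \<longlonglongrightarrow> 0" by simp
qed

lemma form_conv_convergent:
  assumes X: "form_conv X x" shows "convergent (\<lambda>n. inner (X n) (A (X n)))"
proof (rule Cauchy_convergent, rule CauchyI)
  have SX: "(\<lambda>n. S (X n)) \<longlonglongrightarrow> S x" using X by (simp add: form_conv_def)
  obtain K where K: "\<And>n. norm (S (X n)) \<le> K" "0 < K"
    using convergent_imp_Bseq[OF convergentI[OF SX]] by (auto simp: Bseq_def)
  fix r :: real assume r: "0 < r"
  then obtain M where M: "\<And>m n. m \<ge> M \<Longrightarrow> n \<ge> M \<Longrightarrow> norm (S (X m) - S (X n)) < r / (2 * K)"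
    using CauchyD[OF LIMSEQ_imp_Cauchy[OF SX], of "r / (2 * K)"] K by auto
  have "norm (inner (X m) (A (X m)) - inner (X n) (A (X n))) < r" if "m \<ge> M" "n \<ge> M" for m n
  proof -
    have "norm (inner (X m) (A (X m)) - inner (X n) (A (X n))) \<le> norm (S (X m) - S (X n)) * (norm (S (X m)) + norm (S (X n)))"
      using X quad_diff_bound by (simp add: form_conv_def)
    also have "\<dots> \<le> norm (S (X m) - S (X n)) * (2 * K)" using K(1)[of m] K(1)[of n] by (intro mult_left_mono) auto
    also have "\<dots> < r" using M[OF that] K by (simp add: field_simps)
    finally show ?thesis .
  qed
  then show "\<exists>M. \<forall>m\<ge>M. \<forall>n\<ge>M. norm (inner (X m) (A (X m)) - inner (X n) (A (X n))) < r" by blast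
qed

end

text \<open>The squares of two candidates for the square root have equal norms, so Heinz's
  inequality holds in both directions. This makes the form norm, and with it \<open>form_dom\<close>
  and \<open>form_val\<close>, independent of the choice.\<close>

lemma abs_sqrt_norm_eq:
  fixes D :: "'a::{real_inner, complete_space} set"
  assumes "abs_sqrt D A DS S" "abs_sqrt D A DS' S'" "x \<in> D"
  shows "norm (S x) = norm (S' x)"
proof -
  interpret L: abs_sqrt D A DS S by fact
  interpret R: abs_sqrt D A DS' S' by fact
  have "inner x (S (S x)) = inner x (S' (S' x))"
    by (rule antisym; rule heinz[OF _ _ _ _ assms(3)])
      (auto simp: L.sa_SS R.sa_SS L.inner_SS R.inner_SS L.norm_SS R.norm_SS)
  then show ?thesis using L.inner_SS[OF assms(3)] R.inner_SS[OF assms(3)] by simp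
qed

lemma abs_sqrt_form_conv:
  fixes D :: "'a::{real_inner, complete_space} set"
  assumes 1: "abs_sqrt D A DS S" and 2: "abs_sqrt D A DS' S'" and X: "abs_sqrt.form_conv D S X x"
  shows "abs_sqrt.form_conv D S' X x"
proof -
  interpret L: abs_sqrt D A DS S by fact
  interpret R: abs_sqrt D A DS' S' by fact
  have X': "\<And>n. X n \<in> D" "X \<longlonglongrightarrow> x" "(\<lambda>n. S (X n)) \<longlonglongrightarrow> S x" using X by (auto simp: L.form_conv_def)
  have d: "norm (S' (X m) - S' (X n)) = norm (S (X m) - S (X n))" for m n
    using abs_sqrt_norm_eq[OF 1 2, of "X m - X n"] X'(1)
    by (simp add: L.S.A_diff R.S.A_diff L.D_diff L.D_subset R.D_subset)
  have "Cauchy (\<lambda>n. S (X n))" using X'(3) by (rule LIMSEQ_imp_Cauchy)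
  then have "Cauchy (\<lambda>n. S' (X n))" by (simp add: Cauchy_def dist_norm d)
  then have "convergent (\<lambda>n. S' (X n))" by (rule Cauchy_convergent)
  then obtain w where w: "(\<lambda>n. S' (X n)) \<longlonglongrightarrow> w" by (auto simp: convergent_def)
  then have "x \<in> DS' \<and> S' x = w" using X' R.D_subset by (intro R.S.closed_graph) auto
  then show ?thesis using X' w by (simp add: R.form_conv_def)
qed

lemma abs_sqrt_dom_eq:
  fixes D :: "'a::{real_inner, complete_space} set"
  assumes 1: "abs_sqrt D A DS S" and 2: "abs_sqrt D A DS' S'"
  shows "DS = DS'"
proof -
  have "DS \<subseteq> DS'" if 1: "abs_sqrt D A DS S" and 2: "abs_sqrt D A DS' S'" for DS S DS' S'
    using abs_sqrt.form_conv_exists[OF 1] abs_sqrt.form_conv_dom[OF 2] abs_sqrt_form_conv[OF 1 2] by blast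
  then show ?thesis using 1 2 by blast
qed

section \<open>Independence of the form from the chosen square root\<close>

context abs_sqrt
begin

lemma abs_sqrt_self: "abs_sqrt D A DS S" by unfold_locales

lemma abs_sqrtI: "is_abs_sqrt D A DS' S' \<Longrightarrow> abs_sqrt D A DS' S'"
  by unfold_locales

lemma form_dom_eq: "form_dom D A = DS"
proof
  show "DS \<subseteq> form_dom D A" unfolding form_dom_def using abs_sqrt by blast
  show "form_dom D A \<subseteq> DS" unfolding form_dom_def using abs_sqrt_dom_eq[OF abs_sqrt_self abs_sqrtI] by blast
qed

lemma form_val_limit:
  assumes X: "form_conv X x" shows "(\<lambda>n. inner (X n) (A (X n))) \<longlonglongrightarrow> form_val D A x"
proof -
  obtain q where q: "(\<lambda>n. inner (X n) (A (X n))) \<longlonglongrightarrow> q"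
    using form_conv_convergent[OF X] by (auto simp: convergent_def)
  have "form_val D A x = q"
    unfolding form_val_def
  proof (rule the_equality)
    have "(\<lambda>n. inner (Y n) (A (Y n))) \<longlonglongrightarrow> q" if "form_conv Y x" for Y
      using tendsto_add[OF form_conv_close[OF that X] q] by simp
    then show "\<exists>DS S. is_abs_sqrt D A DS S \<and> (\<forall>X. (\<forall>n. X n \<in> D) \<and> X \<longlonglongrightarrow> x \<and> (\<lambda>n. S (X n)) \<longlonglongrightarrow> S x
           \<longrightarrow> (\<lambda>n. inner (X n) (A (X n))) \<longlonglongrightarrow> q)"
      using abs_sqrt by (auto simp: form_conv_def)
  next
    fix q'
    assume "\<exists>DS S. is_abs_sqrt D A DS S \<and> (\<forall>X. (\<forall>n. X n \<in> D) \<and> X \<longlonglongrightarrow> x \<and> (\<lambda>n. S (X n)) \<longlonglongrightarrow> S x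
           \<longrightarrow> (\<lambda>n. inner (X n) (A (X n))) \<longlonglongrightarrow> q')"
    then obtain DS' S' where 2: "is_abs_sqrt D A DS' S'"
      and lim: "\<And>X. (\<forall>n. X n \<in> D) \<and> X \<longlonglongrightarrow> x \<and> (\<lambda>n. S' (X n)) \<longlonglongrightarrow> S' x \<Longrightarrow> (\<lambda>n. inner (X n) (A (X n))) \<longlonglongrightarrow> q'"
      by blast
    interpret R: abs_sqrt D A DS' S' by (rule abs_sqrtI[OF 2])
    have "R.form_conv X x" by (rule abs_sqrt_form_conv[OF abs_sqrt_self R.abs_sqrt_self X])
    then have "(\<lambda>n. inner (X n) (A (X n))) \<longlonglongrightarrow> q'" by (intro lim) (simp add: R.form_conv_def)
    then show "q' = q" using q LIMSEQ_unique by blast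
  qed
  then show ?thesis using q by simp
qed

end

text \<open>Polarization is the way in because \<open>form_val\<close> is given only on the
  diagonal; bilinearity is then proved by approximation from \<open>D\<close>.\<close>

definition form_bilin :: "'a::real_inner set \<Rightarrow> ('a \<Rightarrow> 'a) \<Rightarrow> 'a \<Rightarrow> 'a \<Rightarrow> real" where
  "form_bilin D A x y = (form_val D A (x + y) - form_val D A (x - y)) / 4"

context abs_sqrt
begin

lemma form_bilin_limit:
  assumes X: "form_conv X x" and Y: "form_conv Y y"
  shows "(\<lambda>n. inner (A (X n)) (Y n)) \<longlonglongrightarrow> form_bilin D A x y"
proof -
  have XY: "X n \<in> D" "Y n \<in> D" for n using X Y by (auto simp: form_conv_def)
  have "inner (A (X n)) (Y n) = (inner (X n + Y n) (A (X n + Y n)) - inner (X n - Y n) (A (X n - Y n))) / 4" for n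
    using XY[of n] A_symmetric[OF XY, of n n]
    by (simp add: A_add A_diff inner_add_left inner_add_right inner_diff_left inner_diff_right inner_commute)
  moreover have "(\<lambda>n. (inner (X n + Y n) (A (X n + Y n)) - inner (X n - Y n) (A (X n - Y n))) / 4) \<longlonglongrightarrow> form_bilin D A x y"
    unfolding form_bilin_def
    by (intro tendsto_intros form_val_limit form_conv_add form_conv_diff X Y) simp
  ultimately show ?thesis by (simp only:)
qed

lemma form_bilin_op: "x \<in> D \<Longrightarrow> y \<in> DS \<Longrightarrow> form_bilin D A x y = inner (A x) y"
proof -
  assume x: "x \<in> D" and y: "y \<in> DS"
  obtain Y where Y: "form_conv Y y" using form_conv_exists[OF y] .
  have "(\<lambda>n. inner (A x) (Y n)) \<longlonglongrightarrow> inner (A x) y" using Y by (auto simp: form_conv_def intro!: tendsto_intros)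
  then show ?thesis using form_bilin_limit[OF form_conv_const[OF x] Y] LIMSEQ_unique by blast
qed

lemma sym_form_bilin: "sym_form DS (form_bilin D A)"
proof
  show "subspace DS" by (rule S.subD)
  fix x y z assume x: "x \<in> DS" and y: "y \<in> DS"
  obtain X Y where XY: "form_conv X x" "form_conv Y y" using form_conv_exists x y by metis
  then have XYD: "X n \<in> D" "Y n \<in> D" for n by (auto simp: form_conv_def)
  have "inner (A (X n)) (Y n) = inner (A (Y n)) (X n)" for n using A_symmetric[OF XYD] by (simp add: inner_commute)
  then show "form_bilin D A x y = form_bilin D A y x"
    using form_bilin_limit[OF XY] form_bilin_limit[OF XY(2,1)] LIMSEQ_unique by auto
  show "form_bilin D A (r *\<^sub>R x) y = r * form_bilin D A x y" for r
  proof (rule LIMSEQ_unique)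
    show "(\<lambda>n. inner (A (r *\<^sub>R X n)) (Y n)) \<longlonglongrightarrow> form_bilin D A (r *\<^sub>R x) y"
      by (intro form_bilin_limit form_conv_scale XY)
    show "(\<lambda>n. inner (A (r *\<^sub>R X n)) (Y n)) \<longlonglongrightarrow> r * form_bilin D A x y"
      using tendsto_mult[OF tendsto_const form_bilin_limit[OF XY], of r] by (simp add: A_scale XYD)
  qed
  assume z: "z \<in> DS"
  obtain Z where Z: "form_conv Z z" using form_conv_exists[OF z] .
  then have ZD: "Z n \<in> D" for n by (simp add: form_conv_def)
  show "form_bilin D A (x + y) z = form_bilin D A x z + form_bilin D A y z"
  proof (rule LIMSEQ_unique)
    show "(\<lambda>n. inner (A (X n + Y n)) (Z n)) \<longlonglongrightarrow> form_bilin D A (x + y) z"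
      by (intro form_bilin_limit form_conv_add XY Z)
    show "(\<lambda>n. inner (A (X n + Y n)) (Z n)) \<longlonglongrightarrow> form_bilin D A x z + form_bilin D A y z"
      using tendsto_add[OF form_bilin_limit[OF XY(1) Z] form_bilin_limit[OF XY(2) Z]]
      by (simp add: A_add XYD inner_add_left)
  qed
qed

lemma form_bilin_diag: "x \<in> DS \<Longrightarrow> form_bilin D A x x = form_val D A x"
proof -
  assume x: "x \<in> DS"
  obtain X where X: "form_conv X x" using form_conv_exists[OF x] .
  show ?thesis
    using form_bilin_limit[OF X X] form_val_limit[OF X] LIMSEQ_unique by (auto simp: inner_commute)
qed

lemma abs_sqrt_uminus: "abs_sqrt D (\<lambda>x. - A x) DS S"
proof -
  interpret m: sa_op D "\<lambda>x. - A x" by (rule sa_opI[OF sa_uminus])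
  show ?thesis by unfold_locales (use abs_sqrt in \<open>simp add: is_abs_sqrt_def\<close>)
qed

lemma form_val_uminus: "x \<in> DS \<Longrightarrow> form_val D (\<lambda>x. - A x) x = - form_val D A x"
proof -
  assume x: "x \<in> DS"
  interpret m: abs_sqrt D "\<lambda>x. - A x" DS S by (rule abs_sqrt_uminus)
  obtain X where X: "form_conv X x" using form_conv_exists[OF x] .
  have "(\<lambda>n. - inner (X n) (A (X n))) \<longlonglongrightarrow> form_val D (\<lambda>x. - A x) x"
    using m.form_val_limit[OF X] by simp
  then show ?thesis using tendsto_minus[OF form_val_limit[OF X]] LIMSEQ_unique by blast
qed

text \<open>\<open>S\<close> is not known to commute with \<open>J\<close>. Conjugating it by
  \<open>J\<close> gives another square root for the same operator, and independence of the choice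
  yields the invariance of domain and form.\<close>

lemma complex_structure_form:
  assumes J: "complex_structure J" and JD: "J ` D \<subseteq> D" "\<And>x. x \<in> D \<Longrightarrow> A (J x) = J (A x)" and x: "x \<in> DS"
  shows "J x \<in> DS" "form_val D A (J x) = form_val D A x"
proof -
  have lin: "linear J" and JJ: "\<And>x. J (J x) = - x" and iso: "\<And>x y. inner (J x) (J y) = inner x y"
    using J by (auto simp: complex_structure_def)
  have Jm: "J (- x) = - J x" for x using lin by (simp add: linear_neg)
  have skew: "inner (J x) y = - inner x (J y)" for x y using iso[of x "J y"] by (simp add: JJ)
  have norm: "norm (J x) = norm x" for x by (simp add: norm_eq_sqrt_inner iso)
  have bl: "bounded_linear J" using lin norm by (intro bounded_linear_intro[of J 1]) (auto simp: linear_add linear_scale)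
  define DS' where "DS' = {x. J x \<in> DS}"
  \<comment> \<open>The conjugate \<open>J^{-1} S J\<close>, with
    \<open>J^{-1} = - J\<close>.\<close>
  define S' where "S' x = - J (S (J x))" for x
  have mDS: "- x \<in> DS \<longleftrightarrow> x \<in> DS" for x using S.D_scale[of x "-1"] S.D_scale[of "-x" "-1"] by auto
  have JDiff: "J x \<in> D \<longleftrightarrow> x \<in> D" for x
  proof
    assume "J x \<in> D"
    then have "J (J x) \<in> D" using JD by blast
    then have "(-1) *\<^sub>R (- x) \<in> D" unfolding JJ by (rule D_scale)
    then show "x \<in> D" by simp
  qed (use JD in blast)
  have "self_adjoint_op DS' S'"
    unfolding self_adjoint_op_def
  proof (intro conjI ballI allI)
    show "subspace DS'" unfolding DS'_def using lin S.subD by (auto simp: subspace_def linear_add linear_scale linear_0)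
    have "x \<in> closure DS'" for x
      unfolding closure_approachable
    proof (intro allI impI)
      fix r :: real assume "0 < r"
      then obtain g where g: "g \<in> DS" "norm (J x - g) < r" using closure_approx[OF S.dense] by metis
      have "J (- J g) = g" by (simp add: Jm JJ)
      moreover have "norm (- J g - x) = norm (J x - g)"
        using norm[of "- J g - x"] lin by (simp add: linear_diff Jm JJ norm_minus_commute)
      ultimately show "\<exists>y\<in>DS'. dist y x < r" using g by (intro bexI[of _ "- J g"]) (auto simp: DS'_def dist_norm)
    qed
    then show "closure DS' = UNIV" by auto
    show "S' (x + y) = S' x + S' y" if "x \<in> DS'" "y \<in> DS'" for x y
      using that lin by (simp add: S'_def DS'_def linear_add S.A_add)
    show "S' (c *\<^sub>R x) = c *\<^sub>R S' x" if "x \<in> DS'" for c x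
      using that lin by (simp add: S'_def DS'_def linear_scale S.A_scale)
    show "(\<forall>x\<in>DS'. inner (S' x) y = inner x z) = (y \<in> DS' \<and> z = S' y)" for y z
    proof
      assume h: "\<forall>x\<in>DS'. inner (S' x) y = inner x z"
      have "J y \<in> DS \<and> S (J y) = J z"
      proof (rule S.adjointI)
        fix v assume v: "v \<in> DS"
        have "- J v \<in> DS'" using v by (simp add: DS'_def Jm JJ)
        then have "inner (S' (- J v)) y = inner (- J v) z" using h by blast
        then show "inner (S v) (J y) = inner v (J z)" by (simp add: S'_def Jm JJ skew)
      qed
      then show "y \<in> DS' \<and> z = S' y" by (auto simp: DS'_def S'_def JJ)
    next
      assume "y \<in> DS' \<and> z = S' y"
      then show "\<forall>x\<in>DS'. inner (S' x) y = inner x z"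
        by (auto simp: DS'_def S'_def skew S.A_symmetric)
    qed
  qed
  moreover have "0 \<le> inner x (S' x)" if "x \<in> DS'" for x
    using S_nonneg[of "J x"] that by (simp add: DS'_def S'_def skew)
  moreover have "D = {x \<in> DS'. S' x \<in> DS'}"
    using D_eq JDiff by (auto simp: DS'_def S'_def Jm JJ mDS)
  moreover have "norm (S' (S' x)) = norm (A x)" if "x \<in> D" for x
    using norm_SS[of "J x"] that JDiff JD(2) by (simp add: S'_def Jm JJ norm)
  ultimately have "is_abs_sqrt D A DS' S'" unfolding is_abs_sqrt_def by (intro conjI ballI)
  then interpret R: abs_sqrt D A DS' S' by (rule abs_sqrtI)
  have DS: "DS = DS'" by (rule abs_sqrt_dom_eq[OF abs_sqrt_self R.abs_sqrt_self])
  have "x \<in> DS'" using x unfolding DS .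
  then show "J x \<in> DS" by (simp add: DS'_def)
  obtain X where X: "form_conv X x" using form_conv_exists[OF x] .
  have XD: "X n \<in> D" for n using X by (simp add: form_conv_def)
  have SJ: "S' (J v) = J (S v)" if "v \<in> DS" for v
    using S.A_minus[OF that] by (simp add: S'_def JJ Jm)
  have "R.form_conv (\<lambda>n. J (X n)) (J x)"
    unfolding R.form_conv_def
  proof (intro conjI allI)
    show "J (X n) \<in> D" for n using XD JDiff by simp
    show "(\<lambda>n. J (X n)) \<longlonglongrightarrow> J x" using X unfolding form_conv_def by (elim conjE) (rule bounded_linear.tendsto[OF bl])
    have "(\<lambda>n. J (S (X n))) \<longlonglongrightarrow> J (S x)" using X unfolding form_conv_def by (elim conjE) (rule bounded_linear.tendsto[OF bl])
    then show "(\<lambda>n. S' (J (X n))) \<longlonglongrightarrow> S' (J x)" by (simp only: SJ[OF x] SJ[OF D_subset[OF XD]])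
  qed
  then have "(\<lambda>n. inner (J (X n)) (A (J (X n)))) \<longlonglongrightarrow> form_val D A (J x)" by (rule R.form_val_limit)
  then have "(\<lambda>n. inner (X n) (A (X n))) \<longlonglongrightarrow> form_val D A (J x)" using JD(2) XD iso by simp
  then show "form_val D A (J x) = form_val D A x" using form_val_limit[OF X] LIMSEQ_unique by blast
qed

end

section \<open>The spectrum\<close>

lemma subspace_closure:
  fixes S :: "'a::real_normed_vector set"
  assumes S: "subspace S" shows "subspace (closure S)"
  unfolding subspace_def
proof (intro conjI ballI allI)
  show "0 \<in> closure S" using subspace_0[OF S] closure_subset by blast
  fix x assume "x \<in> closure S"
  then obtain f where f: "\<And>n. f n \<in> S" "f \<longlonglongrightarrow> x" unfolding closure_sequential by blast
  show "c *\<^sub>R x \<in> closure S" for c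
    unfolding closure_sequential
    by (rule exI[of _ "\<lambda>n. c *\<^sub>R f n"]) (use f S in \<open>auto intro: subspace_scale tendsto_scaleR\<close>)
  fix y assume "y \<in> closure S"
  then obtain g where g: "\<And>n. g n \<in> S" "g \<longlonglongrightarrow> y" unfolding closure_sequential by blast
  show "x + y \<in> closure S"
    unfolding closure_sequential
    by (rule exI[of _ "\<lambda>n. f n + g n"]) (use f g S in \<open>auto intro: subspace_add tendsto_add\<close>)
qed

context sa_op
begin

text \<open>The inverse is symmetric and defined everywhere, hence bounded (Hellinger-Toeplitz). The
  argument is a gliding hump: for an unbounded inverse, signed steps of length
  \<open>(1/3) ^ n\<close> add up to a vector \<open>x\<close> whose pairings with the
  \<open>R (y n)\<close> are unbounded, although \<open>norm (R x)\<close> bounds them.\<close>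

lemma bounded_below_if_bij:
  assumes bij: "bij_betw A D UNIV"
  obtains \<delta> where "0 < \<delta>" "\<And>x. x \<in> D \<Longrightarrow> \<delta> * norm x \<le> norm (A x)"
proof -
  define R where "R = the_inv_into D A"
  have inj: "inj_on A D" and im: "A ` D = UNIV" using bij by (auto simp: bij_betw_def)
  have RD: "R h \<in> D" and AR: "A (R h) = h" for h
    using the_inv_into_into[OF inj, of h D] f_the_inv_into_f[OF inj, of h] im by (auto simp: R_def)
  have RA: "x \<in> D \<Longrightarrow> R (A x) = x" for x using the_inv_into_f_f[OF inj] by (simp add: R_def)
  have symR: "inner (R x) y = inner x (R y)" for x y
    using A_symmetric[OF RD RD, of x y] by (simp add: AR)
  have "\<exists>K. \<forall>y. norm (R y) \<le> K * norm y"
  proof (rule ccontr)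
    assume "\<not> ?thesis"
    then have un: "\<exists>y. K * norm y < norm (R y)" for K by (metis not_le)
    have "\<exists>y. norm y = 1 \<and> 4 ^ n < norm (R y)" for n :: nat
    proof -
      obtain y where y: "4 ^ n * norm y < norm (R y)" using un by blast
      have R0: "R 0 = 0" using RA[of 0] by simp
      then have y0: "y \<noteq> 0" using y by auto
      have "R (y /\<^sub>R norm y) = R y /\<^sub>R norm y"
        using RA[of "R y /\<^sub>R norm y"] RD[of y] by (simp add: A_scale D_scale AR)
      then have "4 ^ n < norm (R (y /\<^sub>R norm y))" using y y0 by (simp add: field_simps)
      then show ?thesis using y0 by (intro exI[of _ "y /\<^sub>R norm y"]) simp
    qed
    then obtain y where y: "\<And>n::nat. norm (y n) = 1" "\<And>n. 4 ^ n < norm (R (y n))" by metis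
    define v where "v n = R (y n) /\<^sub>R norm (R (y n))" for n
    have Rpos: "0 < norm (R (y n))" for n using y(2)[of n] by (smt (verit) zero_less_power)
    have v: "norm (v n) = 1" "inner (v n) (R (y n)) = norm (R (y n))" for n
      using Rpos[of n] by (auto simp: v_def power2_norm_eq_inner[symmetric] power2_eq_square field_simps)
    \<comment> \<open>The sign prevents the new step from cancelling the pairing reached so far. All
      later steps together have length at most half of \<open>(1/3) ^ n\<close>, so half of the gain
      survives in the limit.\<close>
    define step where "step n x = (if 0 \<le> inner x (R (y n)) then x + (1/3) ^ n *\<^sub>R v n else x - (1/3) ^ n *\<^sub>R v n)" for n x
    define X where "X = rec_nat 0 (\<lambda>n x. step n x)"
    have XS: "X (Suc n) = step n (X n)" for n by (simp add: X_def)
    have d: "norm (X (Suc n) - X n) = (1/3) ^ n" for n by (simp add: XS step_def v)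
    have big: "(1/3) ^ n * norm (R (y n)) \<le> \<bar>inner (X (Suc n)) (R (y n))\<bar>" for n
      using Rpos[of n] by (auto simp: XS step_def inner_add_left inner_diff_left v)
    have far: "norm (X (Suc n + k) - X (Suc n)) \<le> (1/2) * (1/3) ^ n * (1 - (1/3) ^ k)" for n k
    proof (induction k)
      case (Suc k)
      have "norm (X (Suc n + Suc k) - X (Suc n)) \<le> norm (X (Suc (Suc n + k)) - X (Suc n + k)) + norm (X (Suc n + k) - X (Suc n))"
        using norm_triangle_ineq[of "X (Suc (Suc n + k)) - X (Suc n + k)" "X (Suc n + k) - X (Suc n)"] by simp
      also have "\<dots> \<le> (1/3) ^ (Suc n + k) + (1/2) * (1/3) ^ n * (1 - (1/3) ^ k)" by (rule add_mono[OF eq_refl[OF d] Suc])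
      also have "\<dots> = (1/2) * (1/3) ^ n * (1 - (1/3) ^ Suc k)" by (simp add: power_add field_simps)
      finally show ?case .
    qed simp
    have far': "norm (X m - X (Suc n)) \<le> (1/2) * (1/3) ^ n" if mn: "m \<ge> Suc n" for m n
    proof -
      obtain k where k: "m = Suc n + k" using le_Suc_ex[OF mn] by blast
      show ?thesis unfolding k by (rule order_trans[OF far]) (simp add: right_diff_distrib)
    qed
    have "Cauchy X"
    proof (rule CauchyI)
      fix r :: real assume "0 < r"
      then obtain n where n: "(1/3) ^ n < r" using real_arch_pow_inv[of r "1/3"] by auto
      have "norm (X m - X k) < r" if "m \<ge> Suc n" "k \<ge> Suc n" for m k
        using far'[OF that(1)] far'[OF that(2)] n norm_triangle_ineq4[of "X m - X (Suc n)" "X k - X (Suc n)"] by simp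
      then show "\<exists>M. \<forall>m\<ge>M. \<forall>k\<ge>M. norm (X m - X k) < r" by blast
    qed
    then have "convergent X" by (rule Cauchy_convergent)
    then obtain x where x: "X \<longlonglongrightarrow> x" by (auto simp: convergent_def)
    have near: "norm (x - X (Suc n)) \<le> (1/2) * (1/3) ^ n" for n
    proof (rule LIMSEQ_le_const2)
      show "(\<lambda>m. norm (X m - X (Suc n))) \<longlonglongrightarrow> norm (x - X (Suc n))" using x by (intro tendsto_intros)
      show "\<exists>N. \<forall>m\<ge>N. norm (X m - X (Suc n)) \<le> (1/2) * (1/3) ^ n" using far' by blast
    qed
    have lowR: "(1/2) * (4/3) ^ n \<le> norm (R x)" for n
    proof -
      have "\<bar>inner (x - X (Suc n)) (R (y n))\<bar> \<le> norm (x - X (Suc n)) * norm (R (y n))" by (rule Cauchy_Schwarz_ineq2)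
      also have "\<dots> \<le> (1/2) * (1/3) ^ n * norm (R (y n))" using near by (intro mult_right_mono) auto
      finally have "(1/2) * (1/3) ^ n * norm (R (y n)) \<le> \<bar>inner x (R (y n))\<bar>"
        using big[of n] by (simp add: inner_diff_left) (smt (verit))
      also have "\<dots> = \<bar>inner (R x) (y n)\<bar>" by (simp add: symR)
      also have "\<dots> \<le> norm (R x)" using Cauchy_Schwarz_ineq2[of "R x" "y n"] y by simp
      finally have "(1/2) * (1/3) ^ n * norm (R (y n)) \<le> norm (R x)" .
      moreover have "(1/2) * (1/3) ^ n * 4 ^ n \<le> (1/2) * (1/3) ^ n * norm (R (y n))"
        using y(2)[of n] by (intro mult_left_mono) auto
      ultimately show ?thesis by (simp add: power_divide)
    qed
    obtain n where "2 * norm (R x) < (4/3) ^ n" using real_arch_pow[of "4/3"] by auto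
    then show False using lowR[of n] by simp
  qed
  then obtain K where K: "\<And>y. norm (R y) \<le> K * norm y" by blast
  show ?thesis
  proof
    show "0 < 1 / (\<bar>K\<bar> + 1)" by simp
    fix x assume x: "x \<in> D"
    have "norm x \<le> K * norm (A x)" using K[of "A x"] RA[OF x] by simp
    also have "\<dots> \<le> (\<bar>K\<bar> + 1) * norm (A x)" by (intro mult_right_mono) auto
    finally show "1 / (\<bar>K\<bar> + 1) * norm x \<le> norm (A x)" by (simp add: field_simps)
  qed
qed

text \<open>The equation is solved through \<open>A^2\<close>: the representer \<open>z\<close> of
  \<open>w\<close> for \<open>inner (A x) (A y)\<close> on the complement of \<open>K\<close>
  satisfies \<open>A (A z) = w\<close>, and \<open>g = A z\<close> is orthogonal to \<open>K\<close>
  because \<open>A\<close> is symmetric and vanishes on \<open>K\<close>.\<close>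

lemma solvable_on_complement:
  assumes K: "subspace K" "closed K" "K \<subseteq> D" "\<And>x. x \<in> K \<Longrightarrow> A x = 0"
    and \<delta>: "0 < \<delta>" "\<And>x. x \<in> D \<Longrightarrow> (\<And>k. k \<in> K \<Longrightarrow> inner x k = 0) \<Longrightarrow> \<delta> * norm x \<le> norm (A x)"
    and w: "\<And>k. k \<in> K \<Longrightarrow> inner w k = 0"
  obtains g where "g \<in> D" "A g = w" "\<delta> * norm g \<le> norm w"
proof -
  define V where "V = {x \<in> D. \<forall>k\<in>K. inner x k = 0}"
  have V: "subspace V" using subD by (auto simp: V_def subspace_def inner_add_left)
  have cl: "x \<in> V \<and> A x = y" if X: "\<And>n. X n \<in> V" "X \<longlonglongrightarrow> x" "(\<lambda>n. A (X n)) \<longlonglongrightarrow> y" for X x y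
  proof -
    have "x \<in> D \<and> A x = y" using X by (intro closed_graph[of X]) (auto simp: V_def)
    moreover have "inner x k = 0" if "k \<in> K" for k
    proof -
      have "(\<lambda>n. inner (X n) k) \<longlonglongrightarrow> inner x k" using X by (intro tendsto_intros)
      moreover have "inner (X n) k = 0" for n using X that by (auto simp: V_def)
      ultimately show ?thesis by (simp add: LIMSEQ_const_iff)
    qed
    ultimately show ?thesis by (auto simp: V_def)
  qed
  have k: "\<delta>\<^sup>2 * (norm y)\<^sup>2 \<le> 0 * (norm y)\<^sup>2 + (norm (A y))\<^sup>2" if "y \<in> V" for y
  proof -
    have "\<delta> * norm y \<le> norm (A y)" using that by (intro \<delta>) (auto simp: V_def)
    then show ?thesis using \<delta> by (metis add_0 less_imp_le mult_nonneg_nonneg mult_zero_left norm_ge_zero power_mono power_mult_distrib)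
  qed
  obtain z where z: "z \<in> V" "\<And>y. y \<in> V \<Longrightarrow> 0 * inner z y + inner (A z) (A y) = inner w y"
    by (rule closed_graph_riesz[where V = V and T = A and t = 0 and k = "\<delta>\<^sup>2" and h = w, OF V _ _ cl _ _ k])
      (use \<delta> A_add A_scale in \<open>auto simp: V_def\<close>)
  have zD: "z \<in> D" using z by (simp add: V_def)
  have "A z \<in> D \<and> A (A z) = w"
  proof (rule adjointI)
    fix x assume x: "x \<in> D"
    \<comment> \<open>The weak equation is known only for tests in \<open>V\<close>; subtracting the
      projection to \<open>K\<close> alters neither \<open>A x\<close> nor the pairing with
      \<open>w\<close>.\<close>
    obtain k where k: "k \<in> K" "\<And>y. y \<in> K \<Longrightarrow> inner (x - k) y = 0" using orthogonal_projection[OF K(1,2)] by metis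
    then have "x - k \<in> V" using x K(3) by (auto simp: V_def)
    then have "inner (A z) (A (x - k)) = inner w (x - k)" using z(2) by simp
    moreover have "A (x - k) = A x" using A_diff[OF x] k K by auto
    ultimately show "inner (A x) (A z) = inner x w" using w[OF k(1)] by (simp add: inner_diff_right inner_commute)
  qed
  moreover have "\<delta> * norm (A z) \<le> norm w"
  proof -
    have "inner (A z) k = 0" if "k \<in> K" for k using A_symmetric[OF zD, of k] K that by auto
    then have "\<delta> * norm (A z) \<le> norm (A (A z))" using calculation by (intro \<delta>) auto
    then show ?thesis using calculation by simp
  qed
  ultimately show ?thesis using that by blast
qed

lemma bij_if_bounded_below:
  assumes \<delta>: "0 < \<delta>" "\<And>x. x \<in> D \<Longrightarrow> \<delta> * norm x \<le> norm (A x)"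
  shows "bij_betw A D UNIV"
proof -
  have "inj_on A D"
  proof (rule inj_onI)
    fix x y assume xy: "x \<in> D" "y \<in> D" "A x = A y"
    then have "\<delta> * norm (x - y) \<le> norm (A (x - y))" by (intro \<delta>) auto
    then show "x = y" using xy \<delta>(1) by (simp add: A_diff mult_le_0_iff)
  qed
  moreover have "\<exists>g\<in>D. A g = w" for w
    by (rule solvable_on_complement[of "{0}" \<delta> w]) (use \<delta> in auto)
  ultimately show ?thesis by (auto simp: bij_betw_def image_iff) metis
qed

text \<open>The distance estimate \<open>\<parallel>A\<^sup>-\<^sup>1\<parallel> \<le> 1 / dist(0, \<sigma>(A))\<close>: an approximate minimizer of \<open>\<parallel>A x\<parallel>\<^sup>2\<close> at
  level \<open>s\<^sup>2\<close> is tested against \<open>(A - s)\<^sup>-\<^sup>1 (A + s)\<^sup>-\<^sup>1 x\<close>.\<close>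

lemma bounded_below_gap:
  assumes gap: "\<And>s. \<bar>s\<bar> < e \<Longrightarrow> bij_betw (\<lambda>x. A x - s *\<^sub>R x) D UNIV" and x: "x \<in> D"
  shows "e * norm x \<le> norm (A x)"
proof (rule ccontr)
  assume "\<not> ?thesis"
  then have lt: "norm (A x) < e * norm x" by simp
  then have x0: "x \<noteq> 0" using x by auto
  then have e: "0 < e" using lt by (smt (verit) norm_ge_zero mult_nonpos_nonneg)
  let ?U = "{u \<in> D. norm u = 1}"
  define s where "s = (INF u\<in>?U. norm (A u))"
  have bdd: "bdd_below ((\<lambda>u. norm (A u)) ` ?U)" by (rule bdd_belowI2[of _ 0]) simp
  have xU: "x /\<^sub>R norm x \<in> ?U" using x x0 by auto
  have "s \<le> norm (A (x /\<^sub>R norm x))" unfolding s_def using bdd xU by (rule cINF_lower)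
  also have "\<dots> < e" using lt x x0 by (simp add: A_scale field_simps)
  finally have se: "s < e" .
  have "bij_betw A D UNIV" using gap[of 0] e by simp
  then obtain \<delta> where \<delta>: "0 < \<delta>" "\<And>x. x \<in> D \<Longrightarrow> \<delta> * norm x \<le> norm (A x)" by (rule bounded_below_if_bij) (rule that)
  have "\<delta> \<le> s" unfolding s_def using \<delta>(2) xU by (intro cINF_greatest) fastforce+
  then have s: "0 < s" using \<delta> by simp
  have low: "s * norm u \<le> norm (A u)" if u: "u \<in> D" for u
  proof (cases "u = 0")
    case False
    have "s \<le> norm (A (u /\<^sub>R norm u))" unfolding s_def using bdd by (rule cINF_lower) (use u False in auto)
    then show ?thesis using u False by (simp add: A_scale field_simps)
  qed simp
  have bp: "bij_betw (\<lambda>x. A x - s *\<^sub>R x) D UNIV" and bm: "bij_betw (\<lambda>x. A x - (- s) *\<^sub>R x) D UNIV"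
    using gap[of s] gap[of "- s"] s se by auto
  interpret P: sa_op D "\<lambda>x. A x - s *\<^sub>R x" by (rule sa_opI[OF sa_shift])
  interpret M: sa_op D "\<lambda>x. A x - (- s) *\<^sub>R x" by (rule sa_opI[OF sa_shift])
  obtain \<delta>p where \<delta>p: "0 < \<delta>p" "\<And>x. x \<in> D \<Longrightarrow> \<delta>p * norm x \<le> norm (A x - s *\<^sub>R x)" by (rule P.bounded_below_if_bij[OF bp]) (rule that)
  obtain \<delta>m where \<delta>m: "0 < \<delta>m" "\<And>x. x \<in> D \<Longrightarrow> \<delta>m * norm x \<le> norm (A x - (- s) *\<^sub>R x)" by (rule M.bounded_below_if_bij[OF bm]) (rule that)
  \<comment> \<open>A bound of \<open>norm (A y)\<close> for
    \<open>y = (A - s)^{-1} (A + s)^{-1} u\<close> with a unit vector \<open>u\<close>.\<close>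
  define C where "C = s * (1 / (\<delta>m * \<delta>p)) + 1 / \<delta>m"
  have C: "0 < C" using s \<delta>p \<delta>m by (simp add: C_def add_pos_pos)
  interpret N: sym_form D "\<lambda>x y. inner (A x) (A y) - s\<^sup>2 * inner x y"
    by unfold_locales (auto simp: subD A_add A_scale inner_add_left algebra_simps inner_commute)
  have Nn: "0 \<le> inner (A u) (A u) - s\<^sup>2 * inner u u" if "u \<in> D" for u
    using power_mono[OF low[OF that], of 2] s by (simp add: power_mult_distrib power2_norm_eq_inner)
  \<comment> \<open>With this defect the Cauchy-Schwarz bound below is at most \<open>1 / 2\<close>,
    whereas the pairing of \<open>u\<close> and \<open>y\<close> equals \<open>1\<close>.\<close>
  define \<eta> where "\<eta> = 1 / (2 * C\<^sup>2)"
  have \<eta>: "0 < \<eta>" using C by (simp add: \<eta>_def)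
  have "s < sqrt (s\<^sup>2 + \<eta>)" using s \<eta> by (simp add: real_less_rsqrt)
  then obtain u where u: "u \<in> D" "norm u = 1" "norm (A u) < sqrt (s\<^sup>2 + \<eta>)"
    unfolding s_def using xU cINF_less_iff[OF _ bdd] by blast
  have "(norm (A u))\<^sup>2 < s\<^sup>2 + \<eta>" using u(3) by (metis norm_ge_zero real_sqrt_abs real_sqrt_less_iff abs_norm_cancel)
  then have Nu: "inner (A u) (A u) - s\<^sup>2 * inner u u < \<eta>" using u(2) by (simp add: power2_norm_eq_inner[symmetric])
  obtain z where z: "z \<in> D" "A z + s *\<^sub>R z = u" using bm by (auto simp: bij_betw_def image_iff set_eq_iff) metis
  obtain y where y: "y \<in> D" "A y - s *\<^sub>R y = z" using bp by (auto simp: bij_betw_def image_iff set_eq_iff) metis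
  have Ay: "A y = s *\<^sub>R y + z" using y(2) by (simp add: algebra_simps)
  then have AyD: "A y \<in> D" using y z by auto
  have "A (A y) - s\<^sup>2 *\<^sub>R y = A z + s *\<^sub>R A y - s\<^sup>2 *\<^sub>R y" using y z by (simp add: Ay A_add A_scale D_scale)
  also have "\<dots> = u" using z(2) by (simp add: Ay algebra_simps power2_eq_square)
  finally have AAy: "A (A y) - s\<^sup>2 *\<^sub>R y = u" .
  have "inner (A u) (A y) - s\<^sup>2 * inner u y = inner u (A (A y) - s\<^sup>2 *\<^sub>R y)"
    using A_symmetric[OF u(1) AyD] by (simp add: inner_diff_right)
  then have one: "inner (A u) (A y) - s\<^sup>2 * inner u y = 1" using u(2) by (simp add: AAy power2_norm_eq_inner[symmetric])
  have nz: "norm z \<le> 1 / \<delta>m" using \<delta>m(2)[OF z(1)] \<delta>m(1) z(2) u(2) by (simp add: field_simps)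
  have "\<delta>p * norm y \<le> 1 / \<delta>m" using \<delta>p(2)[OF y(1)] y(2) nz by simp
  then have ny: "norm y \<le> 1 / (\<delta>m * \<delta>p)" using \<delta>p(1) \<delta>m(1) by (simp add: field_simps)
  have "norm (A y) \<le> s * norm y + norm z" using norm_triangle_ineq[of "s *\<^sub>R y" z] s by (simp add: Ay)
  also have "\<dots> \<le> C" unfolding C_def using ny nz s by (intro add_mono mult_left_mono) auto
  finally have "(norm (A y))\<^sup>2 \<le> C\<^sup>2" by (intro power_mono) auto
  have Ny: "inner (A y) (A y) - s\<^sup>2 * inner y y \<le> C\<^sup>2"
  proof -
    have "0 \<le> s\<^sup>2 * inner y y" by simp
    then show ?thesis using \<open>(norm (A y))\<^sup>2 \<le> C\<^sup>2\<close> unfolding power2_norm_eq_inner by linarith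
  qed
  have "1 = (inner (A u) (A y) - s\<^sup>2 * inner u y)\<^sup>2" using one by simp
  also have "\<dots> \<le> (inner (A u) (A u) - s\<^sup>2 * inner u u) * (inner (A y) (A y) - s\<^sup>2 * inner y y)"
    by (rule N.Cauchy_Schwarz[OF Nn subD order_refl u(1) y(1)])
  also have "\<dots> \<le> \<eta> * C\<^sup>2" using Nu Ny Nn[OF y(1)] \<eta> by (intro mult_mono) auto
  also have "\<dots> = 1 / 2" using C by (simp add: \<eta>_def)
  finally show False by simp
qed

text \<open>For small \<open>s\<close> the gap estimate for \<open>A - s\<close>, once squared,
  bounds \<open>inner u (A u)\<close> by the square of \<open>norm (A u)\<close>. Polarized, it
  bounds \<open>inner v x\<close> by \<open>norm v * norm (A x)\<close> for \<open>v\<close> in the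
  range, and by density also for \<open>v = x\<close>, since orthogonality to the kernel puts
  \<open>x\<close> in the closure of the range.\<close>

lemma bounded_below_isolated:
  assumes e: "0 < e" and gap: "\<And>s. s \<noteq> 0 \<Longrightarrow> \<bar>s\<bar> < e \<Longrightarrow> bij_betw (\<lambda>x. A x - s *\<^sub>R x) D UNIV"
    and x: "x \<in> D" and orth: "\<And>k. k \<in> D \<Longrightarrow> A k = 0 \<Longrightarrow> inner x k = 0"
  shows "e / 2 * norm x \<le> norm (A x)"
proof -
  have near: "\<bar>s\<bar> * norm u \<le> norm (A u - s *\<^sub>R u)" if s: "\<bar>s\<bar> < e / 2" and u: "u \<in> D" for s u
  proof -
    interpret B: sa_op D "\<lambda>x. A x - s *\<^sub>R x" by (rule sa_opI[OF sa_shift])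
    show ?thesis
    proof (rule B.bounded_below_gap[OF _ u])
      fix t assume t: "\<bar>t\<bar> < \<bar>s\<bar>"
      then have "bij_betw (\<lambda>x. A x - (s + t) *\<^sub>R x) D UNIV" using s by (intro gap) auto
      then show "bij_betw (\<lambda>x. A x - s *\<^sub>R x - t *\<^sub>R x) D UNIV" by (simp add: scaleR_add_left diff_diff_eq)
    qed
  qed
  have quad: "e / 2 * \<bar>inner u (A u)\<bar> \<le> (norm (A u))\<^sup>2" if u: "u \<in> D" for u
  proof -
    have 1: "2 * s * inner u (A u) \<le> (norm (A u))\<^sup>2" if "\<bar>s\<bar> < e / 2" for s
    proof -
      have "(\<bar>s\<bar> * norm u)\<^sup>2 \<le> (norm (A u - s *\<^sub>R u))\<^sup>2" using near[OF that u] by (intro power_mono) auto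
      also have "\<dots> = (norm (A u))\<^sup>2 - 2 * s * inner u (A u) + s\<^sup>2 * (norm u)\<^sup>2"
        unfolding power2_norm_eq_inner
        by (simp add: inner_diff_left inner_diff_right inner_commute power2_eq_square algebra_simps)
      finally show ?thesis by (simp add: power_mult_distrib)
    qed
    show ?thesis using 1[of "e / 4"] 1[of "- e / 4"] e by (simp add: abs_if)
  qed
  have bil: "e / 2 * inner (A u) y \<le> norm (A u) * norm (A y)" if u: "u \<in> D" and y: "y \<in> D" for u y
  proof -
    interpret N: sym_form D "\<lambda>x y. inner (A x) (A y)"
      by unfold_locales (auto simp: subD A_add A_scale inner_add_left inner_add_right inner_commute)
    have "(e / 2 * inner (A u) y)\<^sup>2 \<le> inner (A u) (A u) * inner (A y) (A y)"
    proof (rule N.discriminant)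
      fix t
      have a: "\<bar>e / 2 * inner (u + t *\<^sub>R y) (A (u + t *\<^sub>R y))\<bar> \<le> (norm (A (u + t *\<^sub>R y)))\<^sup>2"
        using quad[OF D_add[OF u D_scale[OF y]]] e by (simp add: abs_mult)
      have a': "\<bar>e / 2 * inner (u - t *\<^sub>R y) (A (u - t *\<^sub>R y))\<bar> \<le> (norm (A (u - t *\<^sub>R y)))\<^sup>2"
        using quad[OF D_diff[OF u D_scale[OF y]]] e by (simp add: abs_mult)
      have b: "inner (u + t *\<^sub>R y) (A (u + t *\<^sub>R y)) - inner (u - t *\<^sub>R y) (A (u - t *\<^sub>R y)) = 4 * t * inner (A u) y"
      proof -
        have "inner y (A u) = inner (A u) y" "inner u (A y) = inner (A u) y"
          using A_symmetric[OF u y] by (auto simp: inner_commute)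
        then show ?thesis
          using u y by (simp add: A_add A_diff A_scale D_scale inner_add_left inner_add_right inner_diff_left inner_diff_right algebra_simps)
      qed
      have c: "(norm (A (u + t *\<^sub>R y)))\<^sup>2 + (norm (A (u - t *\<^sub>R y)))\<^sup>2 = 2 * (inner (A u) (A u) + inner (A (t *\<^sub>R y)) (A (t *\<^sub>R y)))"
        using u y by (simp add: A_add A_diff D_scale power2_norm_eq_inner inner_add_left inner_add_right inner_diff_left inner_diff_right algebra_simps)
      have b': "e / 2 * inner (u + t *\<^sub>R y) (A (u + t *\<^sub>R y)) - e / 2 * inner (u - t *\<^sub>R y) (A (u - t *\<^sub>R y))
          = 4 * t * (e / 2 * inner (A u) y)"
        unfolding right_diff_distrib[symmetric] b by simp
      show "0 \<le> inner (A (t *\<^sub>R y)) (A (t *\<^sub>R y)) + 2 * t * (e / 2 * inner (A u) y) + inner (A u) (A u)"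
        by (rule polarization_bound[OF a a' b' c])
    qed (use u y in auto)
    then have "(e / 2 * inner (A u) y)\<^sup>2 \<le> (norm (A u) * norm (A y))\<^sup>2" by (simp add: power_mult_distrib power2_norm_eq_inner)
    then show ?thesis by (rule power2_le_imp_le) simp
  qed
  let ?R = "closure (A ` D)"
  have "subspace (A ` D)"
    unfolding subspace_def
  proof (intro conjI ballI allI)
    show "0 \<in> A ` D" by (metis A_zero D_zero imageI)
  qed (auto simp flip: A_add A_scale)
  then have R: "subspace ?R" by (rule subspace_closure)
  obtain g where g: "g \<in> ?R" "\<And>y. y \<in> ?R \<Longrightarrow> inner (x - g) y = 0" using orthogonal_projection[OF R closed_closure] by metis
  \<comment> \<open>Orthogonality to the range puts \<open>x - g\<close> in the kernel, and
    \<open>orth\<close> then forces \<open>x = g\<close>.\<close>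
  have "x - g \<in> D \<and> A (x - g) = 0"
  proof (rule adjointI)
    fix u assume "u \<in> D"
    then have "A u \<in> ?R" by (intro subsetD[OF closure_subset] imageI)
    then show "inner (A u) (x - g) = inner u 0" using g(2) by (simp add: inner_commute)
  qed
  then have k: "x - g \<in> D" "A (x - g) = 0" by auto
  have "inner x (x - g) = 0" by (rule orth[OF k])
  then have "inner (x - g) (x - g) = 0" using g(2)[OF g(1)] by (simp add: inner_diff_left inner_diff_right inner_commute)
  then have xR: "x \<in> ?R" using g by simp
  have "e / 2 * inner v x \<le> norm v * norm (A x)" if "v \<in> A ` D" for v using that bil x by auto
  moreover have "closed {v. e / 2 * inner v x \<le> norm v * norm (A x)}" by (intro closed_Collect_le continuous_intros)
  ultimately have "?R \<subseteq> {v. e / 2 * inner v x \<le> norm v * norm (A x)}" by (intro closure_minimal) auto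
  then have "e / 2 * inner x x \<le> norm x * norm (A x)" using xR by blast
  then have "norm x * (e / 2 * norm x) \<le> norm x * norm (A x)"
    by (simp add: power2_norm_eq_inner[symmetric] power2_eq_square mult_ac)
  then show ?thesis by (cases "x = 0") simp_all
qed

text \<open>Contraposition of \<open>bij_if_bounded_below\<close>: a self-adjoint operator has no
  residual spectrum, so every spectral value has approximate eigenvectors.\<close>

lemma spectrum_approx:
  assumes "l \<in> op_spectrum D A" "0 < r"
  obtains u where "u \<in> D" "norm u = 1" "norm (A u - l *\<^sub>R u) < r"
proof -
  interpret B: sa_op D "\<lambda>x. A x - l *\<^sub>R x" by (rule sa_opI[OF sa_shift])
  have "\<exists>x\<in>D. norm (A x - l *\<^sub>R x) < r * norm x"
    using B.bij_if_bounded_below[of r] assms by (force simp: op_spectrum_def not_le)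
  then obtain x where x: "x \<in> D" "norm (A x - l *\<^sub>R x) < r * norm x" by blast
  have x0: "x \<noteq> 0" using x by auto
  have "A (x /\<^sub>R norm x) - l *\<^sub>R (x /\<^sub>R norm x) = (A x - l *\<^sub>R x) /\<^sub>R norm x"
    using x by (simp add: A_scale algebra_simps)
  then have "norm (A (x /\<^sub>R norm x) - l *\<^sub>R (x /\<^sub>R norm x)) = norm (A x - l *\<^sub>R x) / norm x"
    by (simp add: divide_inverse mult.commute)
  also have "\<dots> < r" using x x0 by (simp add: pos_divide_less_eq)
  finally have "norm (A (x /\<^sub>R norm x) - l *\<^sub>R (x /\<^sub>R norm x)) < r" .
  then show ?thesis using that[of "x /\<^sub>R norm x"] x x0 by auto
qed

lemma eigenspace_subspace: "subspace (eigenspace_op D A l)"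
  using subD by (auto simp: eigenspace_op_def subspace_def A_add A_scale algebra_simps)

lemma eigenspace_closed: "closed (eigenspace_op D A l)"
  unfolding closed_sequential_limits
proof (intro allI impI, elim conjE)
  fix X x assume X: "\<forall>n. X n \<in> eigenspace_op D A l" "X \<longlonglongrightarrow> x"
  have "(\<lambda>n. A (X n)) \<longlonglongrightarrow> l *\<^sub>R x"
    using X by (auto simp: eigenspace_op_def intro!: tendsto_intros)
  then show "x \<in> eigenspace_op D A l"
    using closed_graph[of X x "l *\<^sub>R x"] X by (auto simp: eigenspace_op_def)
qed

lemma eigenspace_trivial: "l \<notin> op_spectrum D A \<Longrightarrow> eigenspace_op D A l = {0}"
proof -
  assume "l \<notin> op_spectrum D A"
  then have inj: "inj_on (\<lambda>x. A x - l *\<^sub>R x) D" by (simp add: op_spectrum_def bij_betw_def)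
  have "x = 0" if "x \<in> D" "A x = l *\<^sub>R x" for x using inj_onD[OF inj, of x 0] that by simp
  then show ?thesis by (auto simp: eigenspace_op_def)
qed

text \<open>Isolation supplies the bound at a discrete spectral value, boundedness of the inverse
  outside the spectrum. Through this estimate the absence of essential spectrum bounds the negative
  index from above.\<close>

lemma nonessential_bounded_below:
  assumes l: "l \<notin> ess_spectrum D A"
  obtains \<delta> where "0 < \<delta>"
    "\<And>x. x \<in> D \<Longrightarrow> (\<And>k. k \<in> eigenspace_op D A l \<Longrightarrow> inner x k = 0) \<Longrightarrow> \<delta> * norm x \<le> norm (A x - l *\<^sub>R x)"
proof -
  interpret B: sa_op D "\<lambda>x. A x - l *\<^sub>R x" by (rule sa_opI[OF sa_shift])
  show ?thesis
  proof (cases "l \<in> op_spectrum D A")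
    case False
    then have "bij_betw (\<lambda>x. A x - l *\<^sub>R x) D UNIV" by (simp add: op_spectrum_def)
    then obtain \<delta> where "0 < \<delta>" "\<And>x. x \<in> D \<Longrightarrow> \<delta> * norm x \<le> norm (A x - l *\<^sub>R x)" by (rule B.bounded_below_if_bij) (rule that)
    then show ?thesis using that by blast
  next
    case True
    then have "l \<in> disc_spectrum D A" using l by (simp add: ess_spectrum_def)
    then obtain e where e: "0 < e" "op_spectrum D A \<inter> ball l e = {l}" by (auto simp: disc_spectrum_def)
    show ?thesis
    proof (rule that[of "e / 2"])
      fix x assume x: "x \<in> D" "\<And>k. k \<in> eigenspace_op D A l \<Longrightarrow> inner x k = 0"
      show "e / 2 * norm x \<le> norm (A x - l *\<^sub>R x)"
      proof (rule B.bounded_below_isolated[OF e(1) _ x(1)])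
        fix s :: real assume s: "s \<noteq> 0" "\<bar>s\<bar> < e"
        then have "l + s \<in> ball l e" "l + s \<noteq> l" by (auto simp: dist_real_def)
        then have "l + s \<notin> op_spectrum D A" using e(2) by blast
        then show "bij_betw (\<lambda>x. A x - l *\<^sub>R x - s *\<^sub>R x) D UNIV"
          by (simp add: op_spectrum_def scaleR_add_left diff_diff_eq)
      qed (use x in \<open>auto simp: eigenspace_op_def\<close>)
    qed (use e in simp)
  qed
qed

end

section \<open>Complex orthonormal families\<close>

text \<open>A list of \<open>2 * k\<close> real vectors encoding \<open>k\<close> complex ones: even
  positions carry the vectors, odd positions their multiples by the imaginary unit.\<close>

definition jfam :: "('a \<Rightarrow> 'a) \<Rightarrow> nat \<Rightarrow> (nat \<Rightarrow> 'a) \<Rightarrow> bool" where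
  "jfam J k e \<longleftrightarrow> (\<forall>i<k. e (2 * i + 1) = J (e (2 * i)))"

definition onfam :: "('a \<Rightarrow> 'a \<Rightarrow> real) \<Rightarrow> nat \<Rightarrow> (nat \<Rightarrow> 'a) \<Rightarrow> bool" where
  "onfam b m e \<longleftrightarrow> (\<forall>i<m. \<forall>j<m. b (e i) (e j) = (if i = j then 1 else 0))"

lemma onfamD: "onfam b m e \<Longrightarrow> i < m \<Longrightarrow> j < m \<Longrightarrow> b (e i) (e j) = (if i = j then 1 else 0)"
  by (simp add: onfam_def)

section \<open>Finite real families and homogeneous systems\<close>

lemma span_Un_span: "span (span S \<union> span T) = span (S \<union> T)"
proof (rule antisym)
  show "span (span S \<union> span T) \<subseteq> span (S \<union> T)"
    by (rule span_minimal) (simp_all add: span_mono subspace_span)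
  show "span (S \<union> T) \<subseteq> span (span S \<union> span T)"
    by (rule span_mono) (use span_superset in blast)
qed

lemma span_family:
  fixes f :: "nat \<Rightarrow> 'a::real_vector"
  shows "x \<in> span (f ` {..<m}) \<longleftrightarrow> (\<exists>\<alpha>. x = (\<Sum>i<m. \<alpha> i *\<^sub>R f i))"
proof (induction m arbitrary: x)
  case (Suc m)
  have "x \<in> span (f ` {..<Suc m}) \<longleftrightarrow> (\<exists>k \<alpha>. x - k *\<^sub>R f m = (\<Sum>i<m. \<alpha> i *\<^sub>R f i))"
    by (simp add: lessThan_Suc span_breakdown_eq Suc.IH)
  also have "\<dots> \<longleftrightarrow> (\<exists>\<alpha>. x = (\<Sum>i<Suc m. \<alpha> i *\<^sub>R f i))"
  proof
    assume "\<exists>k \<alpha>. x - k *\<^sub>R f m = (\<Sum>i<m. \<alpha> i *\<^sub>R f i)"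
    then obtain k \<alpha> where *: "x - k *\<^sub>R f m = (\<Sum>i<m. \<alpha> i *\<^sub>R f i)" by blast
    have "(\<Sum>i<Suc m. (\<alpha>(m := k)) i *\<^sub>R f i) = (\<Sum>i<m. \<alpha> i *\<^sub>R f i) + k *\<^sub>R f m" by simp
    then have "x = (\<Sum>i<Suc m. (\<alpha>(m := k)) i *\<^sub>R f i)" using * by (simp add: algebra_simps)
    then show "\<exists>\<alpha>. x = (\<Sum>i<Suc m. \<alpha> i *\<^sub>R f i)" by (rule exI[of _ "\<alpha>(m := k)"])
  next
    assume "\<exists>\<alpha>. x = (\<Sum>i<Suc m. \<alpha> i *\<^sub>R f i)"
    then obtain \<alpha> where "x = (\<Sum>i<Suc m. \<alpha> i *\<^sub>R f i)" by blast
    then have "x - \<alpha> m *\<^sub>R f m = (\<Sum>i<m. \<alpha> i *\<^sub>R f i)" by simp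
    then show "\<exists>k \<alpha>. x - k *\<^sub>R f m = (\<Sum>i<m. \<alpha> i *\<^sub>R f i)" by blast
  qed
  finally show ?case .
qed simp

lemma independent_family:
  fixes f :: "nat \<Rightarrow> 'a::real_vector"
  assumes ind: "\<And>\<alpha> i. (\<Sum>i<m. \<alpha> i *\<^sub>R f i) = 0 \<Longrightarrow> i < m \<Longrightarrow> \<alpha> i = 0"
  shows "inj_on f {..<m}" "independent (f ` {..<m})" "card (f ` {..<m}) = m" "dim (span (f ` {..<m})) = m"
proof -
  show inj: "inj_on f {..<m}"
  proof (rule inj_onI)
    fix i j assume ij: "i \<in> {..<m}" "j \<in> {..<m}" "f i = f j"
    show "i = j"
    proof (rule ccontr)
      assume ne: "i \<noteq> j"
      define \<alpha> where "\<alpha> l = (if l = i then 1 else if l = j then -1 else (0::real))" for l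
      have "(\<Sum>l<m. \<alpha> l *\<^sub>R f l) = (\<Sum>l\<in>{i, j}. \<alpha> l *\<^sub>R f l)"
        using ij by (intro sum.mono_neutral_right) (auto simp: \<alpha>_def)
      also have "\<dots> = 0" using ne ij by (simp add: \<alpha>_def)
      finally have "\<alpha> i = 0" using ind ij by blast
      then show False by (simp add: \<alpha>_def)
    qed
  qed
  show indep: "independent (f ` {..<m})"
  proof (rule independent_if_scalars_zero)
    fix u x assume s: "(\<Sum>x\<in>f ` {..<m}. u x *\<^sub>R x) = 0" and x: "x \<in> f ` {..<m}"
    have "(\<Sum>i<m. u (f i) *\<^sub>R f i) = 0" using s by (simp add: sum.reindex[OF inj])
    then show "u x = 0" using ind[of "\<lambda>i. u (f i)"] x by blast
  qed simp
  show card: "card (f ` {..<m}) = m" using inj by (simp add: card_image)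
  show "dim (span (f ` {..<m})) = m" using dim_span_eq_card_independent[OF indep] card by simp
qed

lemma linear_dependence:
  fixes y :: "nat \<Rightarrow> 'a::real_vector"
  assumes "finite T" "card T < M" "\<And>i. i < M \<Longrightarrow> y i \<in> span T"
  obtains \<alpha> where "(\<Sum>i<M. \<alpha> i *\<^sub>R y i) = 0" "\<exists>i<M. \<alpha> i \<noteq> 0"
proof (rule ccontr)
  assume "\<not> thesis"
  then have ind: "\<And>\<alpha> i. (\<Sum>i<M. \<alpha> i *\<^sub>R y i) = 0 \<Longrightarrow> i < M \<Longrightarrow> \<alpha> i = 0" using that by blast
  have "independent (y ` {..<M})" by (rule independent_family(2)) (rule ind)
  moreover have "card (y ` {..<M}) = M" by (rule independent_family(3)) (rule ind)
  moreover have "y ` {..<M} \<subseteq> span T" using assms by auto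
  ultimately have "M \<le> card T" using independent_span_bound[OF assms(1)] by metis
  then show False using assms(2) by simp
qed

text \<open>The independent vectors \<open>w\<close> act as coordinate axes: each row of
  \<open>a\<close> becomes a vector in the span of the first \<open>L\<close> of them, and
  \<open>M > L\<close> such vectors are dependent.\<close>

lemma homogeneous_system:
  fixes a :: "nat \<Rightarrow> nat \<Rightarrow> real" and w :: "nat \<Rightarrow> 'a::real_vector"
  assumes LM: "L < M" and ind: "\<And>\<alpha> i. (\<Sum>i<M. \<alpha> i *\<^sub>R w i) = 0 \<Longrightarrow> i < M \<Longrightarrow> \<alpha> i = 0"
  obtains \<alpha> where "\<exists>i<M. \<alpha> i \<noteq> 0" "\<And>j. j < L \<Longrightarrow> (\<Sum>i<M. \<alpha> i * a i j) = 0"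
proof -
  define y where "y i = (\<Sum>j<L. a i j *\<^sub>R w j)" for i
  have "card (w ` {..<L}) < M" using card_image_le[of "{..<L}" w] LM by simp
  then obtain \<alpha> where \<alpha>: "(\<Sum>i<M. \<alpha> i *\<^sub>R y i) = 0" "\<exists>i<M. \<alpha> i \<noteq> 0"
    using linear_dependence[of "w ` {..<L}" M y] unfolding y_def span_family by blast
  have "(\<Sum>i<M. \<alpha> i * a i j) = 0" if j: "j < L" for j
  proof -
    define \<beta> where "\<beta> j = (if j < L then \<Sum>i<M. \<alpha> i * a i j else 0)" for j
    have "(\<Sum>j<M. \<beta> j *\<^sub>R w j) = (\<Sum>j<L. (\<Sum>i<M. \<alpha> i * a i j) *\<^sub>R w j)"
      using LM by (intro sum.mono_neutral_cong_right) (auto simp: \<beta>_def)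
    also have "\<dots> = (\<Sum>j<L. \<Sum>i<M. (\<alpha> i * a i j) *\<^sub>R w j)" by (simp add: scaleR_sum_left)
    also have "\<dots> = (\<Sum>i<M. \<alpha> i *\<^sub>R y i)" by (subst sum.swap) (simp add: y_def scaleR_sum_right)
    also have "\<dots> = 0" by (rule \<alpha>)
    finally have "\<beta> j = 0" using ind j LM by force
    then show ?thesis using j by (simp add: \<beta>_def)
  qed
  then show ?thesis using that \<alpha> by blast
qed

context sym_form
begin

lemma comb_in: fixes e :: "nat \<Rightarrow> 'a" shows "(\<And>i. i < m \<Longrightarrow> e i \<in> V) \<Longrightarrow> (\<Sum>i<m. \<alpha> i *\<^sub>R e i) \<in> V"
  by (rule V_sum) auto

lemma comb_left: fixes e :: "nat \<Rightarrow> 'a" shows "(\<And>i. i < m \<Longrightarrow> e i \<in> V) \<Longrightarrow> z \<in> V \<Longrightarrow> b (\<Sum>i<m. \<alpha> i *\<^sub>R e i) z = (\<Sum>i<m. \<alpha> i * b (e i) z)"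
  by (subst sum_left) (auto simp: scale_left)

lemma comb_onfam:
  assumes on: "onfam b m e" and e: "\<And>i. i < m \<Longrightarrow> e i \<in> V" and j: "j < m"
  shows "b (\<Sum>i<m. \<alpha> i *\<^sub>R e i) (e j) = \<alpha> j"
proof -
  have "b (\<Sum>i<m. \<alpha> i *\<^sub>R e i) (e j) = (\<Sum>i<m. \<alpha> i * b (e i) (e j))" using comb_left e j by blast
  also have "\<dots> = (\<Sum>i<m. if i = j then \<alpha> i else 0)" using onfamD[OF on _ j] by (intro sum.cong) auto
  also have "\<dots> = \<alpha> j" using j by simp
  finally show ?thesis .
qed

lemma quad_onfam:
  assumes on: "onfam b m e" and e: "\<And>i. i < m \<Longrightarrow> e i \<in> V"
  shows "b (\<Sum>i<m. \<alpha> i *\<^sub>R e i) (\<Sum>i<m. \<alpha> i *\<^sub>R e i) = (\<Sum>i<m. (\<alpha> i)\<^sup>2)"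
proof -
  let ?x = "\<Sum>i<m. \<alpha> i *\<^sub>R e i"
  have xV: "?x \<in> V" using e by (rule comb_in)
  have "b ?x ?x = (\<Sum>i<m. \<alpha> i * b (e i) ?x)" using comb_left[OF e xV] .
  also have "\<dots> = (\<Sum>i<m. (\<alpha> i)\<^sup>2)"
    using comb_onfam[OF on e] sym[OF e xV] by (intro sum.cong) (auto simp: power2_eq_square)
  finally show ?thesis .
qed

lemma onfam_independent:
  assumes on: "onfam b m e" and e: "\<And>i. i < m \<Longrightarrow> e i \<in> V"
    and 0: "(\<Sum>i<m. \<alpha> i *\<^sub>R e i) = 0" and i: "i < m"
  shows "\<alpha> i = 0"
  using comb_onfam[OF on e i, of \<alpha>] zero_left[OF e[OF i]] by (simp add: 0)

end

locale jform = sym_form V b for V :: "'a::real_inner set" and b +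
  fixes J :: "'a \<Rightarrow> 'a"
  assumes linJ: "linear J" and JJ: "\<And>x. J (J x) = - x"
    and J_V: "\<And>x. x \<in> V \<Longrightarrow> J x \<in> V" and b_J: "\<And>x y. x \<in> V \<Longrightarrow> y \<in> V \<Longrightarrow> b (J x) (J y) = b x y"
begin

lemma minus_right: "x \<in> V \<Longrightarrow> y \<in> V \<Longrightarrow> b x (- y) = - b x y"
  using scale_right[of x y "-1"] by simp

lemma J_left: "x \<in> V \<Longrightarrow> y \<in> V \<Longrightarrow> b (J x) y = - b x (J y)"
  using b_J[of x "J y"] minus_right[of "J x" y] by (simp add: JJ J_V)

text \<open>\<open>J\<close> is skew for an invariant symmetric form, so a vector and its image are
  orthogonal and real Gram-Schmidt can proceed two vectors at a time.\<close>

lemma J_orth: "x \<in> V \<Longrightarrow> b x (J x) = 0"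
  using J_left[of x x] sym[of x "J x"] by (simp add: J_V)

lemma gram_schmidt_step:
  assumes W: "subspace W" "W \<subseteq> V" "\<And>x. x \<in> W \<Longrightarrow> J x \<in> W" and pos: "\<And>x. x \<in> W \<Longrightarrow> x \<noteq> 0 \<Longrightarrow> 0 < b x x"
    and e: "onfam b (2 * k) e" "jfam J k e" "\<And>i. i < 2 * k \<Longrightarrow> e i \<in> W"
    and v: "v \<in> W" "v \<notin> span (e ` {..<2 * k})"
  obtains e' where "onfam b (2 * Suc k) e'" "jfam J (Suc k) e'" "\<And>i. i < 2 * Suc k \<Longrightarrow> e' i \<in> W"
proof -
  have eV: "\<And>i. i < 2 * k \<Longrightarrow> e i \<in> V" using e W by blast
  define p where "p = (\<Sum>i<2*k. b v (e i) *\<^sub>R e i)"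
  have pW: "p \<in> W" unfolding p_def using e W by (intro subspace_sum subspace_scale) auto
  have "p \<in> span (e ` {..<2 * k})" unfolding p_def span_family by (rule exI[of _ "\<lambda>i. b v (e i)"]) simp
  then have vp: "v - p \<noteq> 0" using v by auto
  define u where "u = (1 / sqrt (b (v - p) (v - p))) *\<^sub>R (v - p)"
  have vpW: "v - p \<in> W" using v pW W by (simp add: subspace_diff)
  have pp: "0 < b (v - p) (v - p)" using pos vpW vp by blast
  have uW: "u \<in> W" unfolding u_def using vpW W by (simp add: subspace_scale)
  have uV: "u \<in> V" "v \<in> V" "p \<in> V" "J u \<in> V" using uW v pW W J_V by auto
  have uu: "b u u = 1" unfolding u_def using pp vpW W by (subst quad_scale) (auto simp: power_divide)
  have uJu: "b u (J u) = 0" "b (J u) u = 0" "b (J u) (J u) = 1"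
    using J_orth[OF uV(1)] sym[OF uV(1,4)] b_J[OF uV(1,1)] uu by auto
  have ue: "b u (e j) = 0" if j: "j < 2 * k" for j
  proof -
    have "b (v - p) (e j) = 0"
      using comb_onfam[OF e(1) eV j, of "\<lambda>i. b v (e i)"] uV eV[OF j] by (simp add: p_def[symmetric] diff_left)
    then show ?thesis unfolding u_def using vpW W eV[OF j] by (subst scale_left) auto
  qed
  have Jue: "b (J u) (e j) = 0" if j: "j < 2 * k" for j
  proof -
    \<comment> \<open>\<open>J\<close> permutes the family up to sign, so orthogonality of
      \<open>u\<close> to all \<open>e j\<close> carries over to \<open>J u\<close>.\<close>
    have "b u (J (e j)) = 0"
    proof (cases "even j")
      case True
      then obtain i where i: "j = 2 * i" by (elim evenE)
      then have "J (e j) = e (2 * i + 1)" using e(2) j by (simp add: jfam_def)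
      then show ?thesis using ue[of "2 * i + 1"] i j by simp
    next
      case False
      then obtain i where i: "j = 2 * i + 1" by (elim oddE)
      then have "J (e j) = - e (2 * i)" using e(2) j by (simp add: jfam_def JJ)
      then show ?thesis using ue[of "2 * i"] i j eV[of "2 * i"] uV by (simp add: minus_right)
    qed
    then show ?thesis using J_left[OF uV(1) eV[OF j]] by simp
  qed
  define e' where "e' = e(2 * k := u, 2 * k + 1 := J u)"
  have cases: "i < 2 * k \<or> i = 2 * k \<or> i = 2 * k + 1" if "i < 2 * Suc k" for i using that by auto
  have e'e: "i < 2 * k \<Longrightarrow> e' i = e i" "e' (2 * k) = u" "e' (2 * k + 1) = J u" "e' (Suc (2 * k)) = J u" for i
    by (auto simp: e'_def)
  have e'V: "i < 2 * Suc k \<Longrightarrow> e' i \<in> V" for i using cases[of i] eV uV by (auto simp: e'e)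
  show ?thesis
  proof (rule that[of e'])
    show "onfam b (2 * Suc k) e'"
      unfolding onfam_def
    proof (intro allI impI)
      fix i j assume ij: "i < 2 * Suc k" "j < 2 * Suc k"
      have eu: "b (e i) u = 0" "b (e i) (J u) = 0" if "i < 2 * k" for i
        using ue[OF that] Jue[OF that] sym[OF uV(1) eV[OF that]] sym[OF uV(4) eV[OF that]] by auto
      show "b (e' i) (e' j) = (if i = j then 1 else 0)"
        using cases[OF ij(1)] cases[OF ij(2)] onfamD[OF e(1), of i j]
        by (auto simp: e'e uu uJu ue Jue eu)
    qed
    show "jfam J (Suc k) e'" unfolding jfam_def
      using e(2) by (auto simp: less_Suc_eq e'e jfam_def)
    show "e' i \<in> W" if "i < 2 * Suc k" for i using cases[OF that] e(3) uW W(3) by (auto simp: e'e)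
  qed
qed

text \<open>A dichotomy free of dimensions: either the process reaches \<open>k\<close> complex
  vectors or it exhausts \<open>W\<close>. The finite and the infinite case are read off from
  it.\<close>

lemma gram_schmidt:
  assumes W: "subspace W" "W \<subseteq> V" "\<And>x. x \<in> W \<Longrightarrow> J x \<in> W" and pos: "\<And>x. x \<in> W \<Longrightarrow> x \<noteq> 0 \<Longrightarrow> 0 < b x x"
  shows "(\<exists>e. onfam b (2 * k) e \<and> jfam J k e \<and> (\<forall>i<2*k. e i \<in> W)) \<or>
    (\<exists>j e. onfam b (2 * j) e \<and> jfam J j e \<and> (\<forall>i<2*j. e i \<in> W) \<and> W = span (e ` {..<2*j}))"
proof (induction k)
  case 0
  show ?case by (auto simp: onfam_def jfam_def)
next
  case (Suc k)
  show ?case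
  proof (cases "\<exists>j e. onfam b (2 * j) e \<and> jfam J j e \<and> (\<forall>i<2*j. e i \<in> W) \<and> W = span (e ` {..<2*j})")
    case False
    then obtain e where e: "onfam b (2 * k) e" "jfam J k e" "\<And>i. i < 2 * k \<Longrightarrow> e i \<in> W" using Suc by blast
    have "span (e ` {..<2*k}) \<subseteq> W" using e(3) W by (intro span_minimal) auto
    then obtain v where v: "v \<in> W" "v \<notin> span (e ` {..<2*k})" using False e by blast
    obtain e' where "onfam b (2 * Suc k) e'" "jfam J (Suc k) e'" "\<And>i. i < 2 * Suc k \<Longrightarrow> e' i \<in> W"
      by (rule gram_schmidt_step[OF W pos e v]) (assumption | rule that)+
    then show ?thesis by blast
  qed blast
qed

text \<open>Besides a basis this shows that the real dimension is even, so halving it with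
  \<open>div 2\<close> loses nothing.\<close>

lemma gram_schmidt_fin:
  assumes W: "subspace W" "W \<subseteq> V" "\<And>x. x \<in> W \<Longrightarrow> J x \<in> W" and pos: "\<And>x. x \<in> W \<Longrightarrow> x \<noteq> 0 \<Longrightarrow> 0 < b x x"
    and fin: "fin_dim W"
  obtains k e where "onfam b (2 * k) e" "jfam J k e" "\<And>i. i < 2 * k \<Longrightarrow> e i \<in> W" "W = span (e ` {..<2*k})" "dim W = 2 * k"
proof -
  obtain B where B: "finite B" "W \<subseteq> span B" using fin by (auto simp: fin_dim_def)
  have ind: "independent (e ` {..<2*k}) \<and> card (e ` {..<2*k}) = 2 * k \<and> dim (span (e ` {..<2*k})) = 2 * k"
    if "onfam b (2 * k) e" "\<forall>i<2*k. e i \<in> W" for k e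
    using independent_family[of e "2 * k"] onfam_independent[OF that(1)] that(2) W(2) by blast
  have "\<not> (\<exists>e. onfam b (2 * Suc (card B)) e \<and> jfam J (Suc (card B)) e \<and> (\<forall>i<2 * Suc (card B). e i \<in> W))"
  proof
    assume "\<exists>e. onfam b (2 * Suc (card B)) e \<and> jfam J (Suc (card B)) e \<and> (\<forall>i<2 * Suc (card B). e i \<in> W)"
    then obtain e where e: "onfam b (2 * Suc (card B)) e" "\<forall>i<2 * Suc (card B). e i \<in> W" by blast
    have "e ` {..<2 * Suc (card B)} \<subseteq> span B" using e B by auto
    then have "card (e ` {..<2 * Suc (card B)}) \<le> card B" using independent_span_bound[OF B(1)] ind[OF e] by blast
    then show False using ind[OF e] by simp
  qed
  then obtain j e where e: "onfam b (2 * j) e" "jfam J j e" "\<forall>i<2*j. e i \<in> W" "W = span (e ` {..<2*j})"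
    using gram_schmidt[OF W pos, of "Suc (card B)"] by blast
  then show ?thesis using that[OF e(1,2)] ind[OF e(1,3)] by metis
qed

lemma gram_schmidt_infin:
  assumes W: "subspace W" "W \<subseteq> V" "\<And>x. x \<in> W \<Longrightarrow> J x \<in> W" and pos: "\<And>x. x \<in> W \<Longrightarrow> x \<noteq> 0 \<Longrightarrow> 0 < b x x"
    and inf: "\<not> fin_dim W"
  obtains e where "onfam b (2 * k) e" "jfam J k e" "\<And>i. i < 2 * k \<Longrightarrow> e i \<in> W"
proof -
  have "W \<noteq> span (e ` {..<2*j})" for e :: "nat \<Rightarrow> 'a" and j
    using inf span_superset by (auto simp: fin_dim_def)
  then show ?thesis using gram_schmidt[OF W pos, of k] that by blast
qed

lemma span_jfam_invariant:
  assumes f: "jfam J k f" and x: "x \<in> span (f ` {..<2*k})"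
  shows "J x \<in> span (f ` {..<2*k})"
proof -
  obtain \<alpha> where \<alpha>: "x = (\<Sum>i<2*k. \<alpha> i *\<^sub>R f i)" using x span_family by blast
  have "J (f i) \<in> span (f ` {..<2*k})" if i: "i < 2 * k" for i
  proof (cases "even i")
    case True
    then obtain j where j: "i = 2 * j" by (elim evenE)
    then have "J (f i) = f (2 * j + 1)" using f i by (simp add: jfam_def)
    moreover have "2 * j + 1 < 2 * k" using i j by simp
    ultimately show ?thesis by (simp add: span_base)
  next
    case False
    then obtain j where j: "i = 2 * j + 1" by (elim oddE)
    then have "J (f i) = - f (2 * j)" using f i by (simp add: jfam_def JJ)
    moreover have "f (2 * j) \<in> span (f ` {..<2*k})" using i j by (intro span_base imageI) simp
    ultimately show ?thesis by (simp add: span_neg)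
  qed
  moreover have "J x = (\<Sum>i<2*k. \<alpha> i *\<^sub>R J (f i))" using linJ by (simp add: \<alpha> linear_sum linear_scale)
  ultimately show ?thesis by (auto intro!: span_sum span_scale)
qed

text \<open>Positivity is stated on coefficients rather than on vectors, so that it also gives the
  linear independence of \<open>f\<close> and hence the length of the new family.\<close>

lemma gram_schmidt_family:
  assumes f: "jfam J k f" "\<And>i. i < 2 * k \<Longrightarrow> f i \<in> V"
    and pos: "\<And>\<alpha>. \<exists>i<2*k. \<alpha> i \<noteq> 0 \<Longrightarrow> 0 < b (\<Sum>i<2*k. \<alpha> i *\<^sub>R f i) (\<Sum>i<2*k. \<alpha> i *\<^sub>R f i)"
  obtains e where "onfam b (2 * k) e" "jfam J k e" "\<And>i. i < 2 * k \<Longrightarrow> e i \<in> span (f ` {..<2*k})"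
proof -
  let ?W = "span (f ` {..<2*k})"
  have WV: "?W \<subseteq> V" using f(2) sub by (intro span_minimal) auto
  have W: "0 < b x x" if x: "x \<in> ?W" "x \<noteq> 0" for x
  proof -
    obtain \<alpha> where \<alpha>: "x = (\<Sum>i<2*k. \<alpha> i *\<^sub>R f i)" using x(1) unfolding span_family by (rule exE)
    have "\<exists>i<2*k. \<alpha> i \<noteq> 0" using x(2) by (rule contrapos_np) (simp add: \<alpha>)
    then show ?thesis unfolding \<alpha> by (rule pos)
  qed
  have "\<alpha> i = 0" if "(\<Sum>i<2*k. \<alpha> i *\<^sub>R f i) = 0" "i < 2 * k" for \<alpha> i
    using pos[of \<alpha>] zero_left[OF V_zero] that by fastforce
  then have d: "dim ?W = 2 * k" using independent_family(4)[of f "2 * k"] by blast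
  have fd: "fin_dim ?W" unfolding fin_dim_def by (intro exI[of _ "f ` {..<2*k}"]) simp
  obtain k' e where "onfam b (2 * k') e" "jfam J k' e" "\<And>i. i < 2 * k' \<Longrightarrow> e i \<in> ?W" "dim ?W = 2 * k'"
    by (rule gram_schmidt_fin[OF subspace_span WV span_jfam_invariant[OF f(1)] W fd]) (assumption | rule that)+
  then show ?thesis using that[of e] d by simp
qed

end

lemma jform_inner:
  assumes "complex_structure J" shows "jform UNIV inner J"
  using assms by unfold_locales (auto simp: complex_structure_def inner_add_left inner_add_right inner_commute linear_add linear_scale)

lemma onfam_append:
  fixes e f :: "nat \<Rightarrow> 'a::real_inner"
  assumes e: "onfam inner m e" and f: "onfam inner n f" and orth: "\<And>i j. i < m \<Longrightarrow> j < n \<Longrightarrow> inner (e i) (f j) = 0"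
  obtains h where "onfam inner (m + n) h" "h ` {..<m+n} = e ` {..<m} \<union> f ` {..<n}"
proof
  define h where "h i = (if i < m then e i else f (i - m))" for i
  show "onfam inner (m + n) h"
    unfolding onfam_def
  proof (intro allI impI)
    fix i j assume "i < m + n" "j < m + n"
    then show "inner (h i) (h j) = (if i = j then 1 else 0)"
      using onfamD[OF e, of i j] onfamD[OF f, of "i - m" "j - m"] orth[of i "j - m"] orth[of j "i - m"]
      by (auto simp: h_def inner_commute)
  qed
  have "{..<m+n} = {..<m} \<union> (\<lambda>j. m + j) ` {..<n}"
  proof (intro set_eqI iffI)
    fix i assume i: "i \<in> {..<m+n}"
    then show "i \<in> {..<m} \<union> (\<lambda>j. m + j) ` {..<n}"
      by (cases "i < m") (auto intro!: image_eqI[of _ _ "i - m"])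
  qed auto
  then have "h ` {..<m+n} = h ` {..<m} \<union> (\<lambda>j. h (m + j)) ` {..<n}" by (simp add: image_Un image_image)
  then show "h ` {..<m+n} = e ` {..<m} \<union> f ` {..<n}" by (simp add: h_def)
qed

context sa_op
begin

lemma eigenvectors_orthogonal:
  assumes "s \<noteq> t" "x \<in> eigenspace_op D A s" "y \<in> eigenspace_op D A t"
  shows "inner x y = 0"
proof -
  have "inner (A x) y = inner x (A y)" using assms by (intro A_symmetric) (auto simp: eigenspace_op_def)
  then have "(s - t) * inner x y = 0" using assms by (simp add: eigenspace_op_def algebra_simps)
  then show ?thesis using assms(1) by simp
qed

text \<open>Eigenspaces of distinct eigenvalues are orthogonal, so their orthonormal bases can be
  concatenated; as each dimension is even, the halves add up exactly.\<close>

lemma eigenspaces_dim: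
  assumes J: "complex_structure J" and JD: "\<And>x. x \<in> D \<Longrightarrow> J x \<in> D" "\<And>x. x \<in> D \<Longrightarrow> A (J x) = J (A x)"
    and "finite I" and fin: "\<And>t. t \<in> I \<Longrightarrow> fin_dim (eigenspace_op D A t)"
  shows "fin_dim (span (\<Union>t\<in>I. eigenspace_op D A t)) \<and>
    dim (span (\<Union>t\<in>I. eigenspace_op D A t)) = 2 * (\<Sum>t\<in>I. dim (eigenspace_op D A t) div 2)"
proof -
  interpret jform UNIV inner J by (rule jform_inner[OF J])
  let ?E = "eigenspace_op D A"
  have "\<exists>e. onfam inner (2 * (\<Sum>t\<in>I. dim (?E t) div 2)) e \<and>
      span (e ` {..<2 * (\<Sum>t\<in>I. dim (?E t) div 2)}) = span (\<Union>t\<in>I. ?E t)"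
    using \<open>finite I\<close> fin
  proof (induction I rule: finite_induct)
    case empty
    show ?case by (auto simp: onfam_def)
  next
    case (insert t I)
    let ?m = "2 * (\<Sum>t\<in>I. dim (?E t) div 2)"
    obtain e where e: "onfam inner ?m e" "span (e ` {..<?m}) = span (\<Union>t\<in>I. ?E t)" using insert by blast
    have JE: "J x \<in> ?E t" if "x \<in> ?E t" for x
      using that JD linJ by (auto simp: eigenspace_op_def linear_scale)
    obtain k f where f: "onfam inner (2 * k) f" "\<And>i. i < 2 * k \<Longrightarrow> f i \<in> ?E t" "?E t = span (f ` {..<2*k})" "dim (?E t) = 2 * k"
      by (rule gram_schmidt_fin[OF eigenspace_subspace subset_UNIV JE _ insert.prems[OF insertI1]]) (auto intro: that)
    have orth: "inner (e i) (f j) = 0" if "i < ?m" "j < 2 * k" for i j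
    proof -
      have "e i \<in> span (\<Union>t\<in>I. ?E t)" using that unfolding e(2)[symmetric] by (auto intro: span_base)
      moreover have "subspace {x. inner x (f j) = 0}" by (auto simp: subspace_def inner_add_left)
      moreover have "(\<Union>t\<in>I. ?E t) \<subseteq> {x. inner x (f j) = 0}"
        using eigenvectors_orthogonal[OF _ _ f(2)[OF that(2)]] insert.hyps(2) by fastforce
      ultimately show ?thesis using span_minimal[of "\<Union>t\<in>I. ?E t" "{x. inner x (f j) = 0}"] by blast
    qed
    obtain h where h: "onfam inner (?m + 2 * k) h" "h ` {..<?m + 2*k} = e ` {..<?m} \<union> f ` {..<2*k}"
      by (rule onfam_append[OF e(1) f(1) orth]) (assumption | rule that)+
    have mk: "?m + 2 * k = 2 * (\<Sum>t\<in>insert t I. dim (?E t) div 2)" using insert.hyps f(4) by simp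
    have "span (e ` {..<?m} \<union> f ` {..<2*k}) = span (span (\<Union>t\<in>I. ?E t) \<union> span (span (f ` {..<2*k})))"
      unfolding e(2)[symmetric] span_span span_Un_span ..
    also have "\<dots> = span ((\<Union>t\<in>I. ?E t) \<union> ?E t)" unfolding span_Un_span f(3)[symmetric] ..
    also have "\<dots> = span (\<Union>t\<in>insert t I. ?E t)" by (simp add: Un_commute)
    finally show ?case using h mk by metis
  qed
  then obtain e where e: "onfam inner (2 * (\<Sum>t\<in>I. dim (?E t) div 2)) e"
      "span (e ` {..<2 * (\<Sum>t\<in>I. dim (?E t) div 2)}) = span (\<Union>t\<in>I. ?E t)" by blast
  show ?thesis
    using independent_family(4)[of e "2 * (\<Sum>t\<in>I. dim (?E t) div 2)"] onfam_independent[OF e(1)]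
    unfolding e(2)[symmetric] fin_dim_def by blast
qed

end

section \<open>The Schur complement over the gap\<close>

lemma sum_lessThan_add: "(\<Sum>i<m + n. g i) = (\<Sum>i<m. g i) + (\<Sum>j<n. g (m + j))"
  for g :: "nat \<Rightarrow> 'a::comm_monoid_add"
  by (induction n) (simp_all add: add.assoc)

lemma norm_comb_le:
  fixes v :: "nat \<Rightarrow> 'a::real_normed_vector"
  shows "(norm (\<Sum>i<m. \<alpha> i *\<^sub>R v i))\<^sup>2 \<le> (\<Sum>i<m. (norm (v i))\<^sup>2) * (\<Sum>i<m. (\<alpha> i)\<^sup>2)"
proof -
  have "norm (\<Sum>i<m. \<alpha> i *\<^sub>R v i) \<le> (\<Sum>i<m. norm (v i) * \<bar>\<alpha> i\<bar>)"
    by (rule order_trans[OF norm_sum]) (simp add: mult.commute)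
  then have "(norm (\<Sum>i<m. \<alpha> i *\<^sub>R v i))\<^sup>2 \<le> (\<Sum>i<m. norm (v i) * \<bar>\<alpha> i\<bar>)\<^sup>2" by (rule power_mono) simp
  also have "\<dots> \<le> (\<Sum>i<m. (norm (v i))\<^sup>2) * (\<Sum>i<m. \<bar>\<alpha> i\<bar>\<^sup>2)" by (rule Cauchy_Schwarz_ineq_sum)
  finally show ?thesis by simp
qed

lemma sum_squares_pos:
  fixes \<alpha> :: "nat \<Rightarrow> real"
  assumes "\<exists>i<m. \<alpha> i \<noteq> 0" shows "0 < (\<Sum>i<m. (\<alpha> i)\<^sup>2)"
proof -
  obtain i where "i < m" "\<alpha> i \<noteq> 0" using assms by blast
  then show ?thesis by (intro sum_pos2[of _ i]) auto
qed

text \<open>\<open>Y\<close> plays the role of \<open>F\<^sub>-\<close> and \<open>q\<close> that of the form of \<open>A\<close> on it. \<open>energy c f y\<close> is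
  \<open>(x, A x) - c \<parallel>x\<parallel>\<^sup>2\<close> at \<open>x = f + y\<close> and \<open>schur c\<close> the quadratic form obtained by maximizing over
  \<open>y\<close>; the maximizing sequences converge in \<open>H\<close> to \<open>dual c (A f - c f)\<close>, although the maximum need
  not be attained in \<open>Y\<close>.\<close>

locale gap_setting = sa_op D A for D :: "'a::{real_inner, complete_space} set" and A +
  fixes J :: "'a \<Rightarrow> 'a" and Y :: "'a set" and q :: "'a \<Rightarrow> 'a \<Rightarrow> real"
  assumes J: "complex_structure J" and J_D: "\<And>x. x \<in> D \<Longrightarrow> J x \<in> D" and A_J: "\<And>x. x \<in> D \<Longrightarrow> A (J x) = J (A x)"
    and q_form: "sym_form Y q" and J_Y: "\<And>y. y \<in> Y \<Longrightarrow> J y \<in> Y" and q_J: "\<And>y. y \<in> Y \<Longrightarrow> q (J y) (J y) = q y y"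
begin

sublocale q: sym_form Y q by (rule q_form)

sublocale JH: jform UNIV inner J by (rule jform_inner[OF J])

definition dual :: "real \<Rightarrow> 'a \<Rightarrow> 'a" where
  "dual c = pos_form.riesz Y (\<lambda>x y. c * inner x y - q x y)"

definition lift :: "real \<Rightarrow> 'a \<Rightarrow> 'a" where
  "lift c f = f + dual c (A f - c *\<^sub>R f)"

definition schur :: "real \<Rightarrow> 'a \<Rightarrow> 'a \<Rightarrow> real" where
  "schur c f g = inner (A g - c *\<^sub>R g) (lift c f)"

definition energy :: "real \<Rightarrow> 'a \<Rightarrow> 'a \<Rightarrow> real" where
  "energy c f y = inner (A f - c *\<^sub>R f) f + (2 * inner (A f - c *\<^sub>R f) y - (c * inner y y - q y y))"

text \<open>Says that the negative index of \<open>schur c\<close>, counted over the complex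
  numbers, is at least \<open>k\<close>. A predicate instead of a number accommodates an infinite
  index.\<close>

definition neg_index :: "nat \<Rightarrow> real \<Rightarrow> bool" where
  "neg_index k c \<longleftrightarrow> (\<exists>e. jfam J k e \<and> (\<forall>i<2*k. e i \<in> D) \<and> onfam (\<lambda>f g. - schur c f g) (2 * k) e)"

lemma energy_shift: "energy c f y = energy l f y - (c - l) * (norm (f + y))\<^sup>2"
  by (simp add: energy_def power2_norm_eq_inner inner_diff_left inner_add_left inner_add_right inner_commute algebra_simps)

lemma energy_J: "f \<in> D \<Longrightarrow> y \<in> Y \<Longrightarrow> energy c (J f) (J y) = energy c f y"
proof -
  assume f: "f \<in> D" and y: "y \<in> Y"
  have "A (J f) - c *\<^sub>R J f = J (A f - c *\<^sub>R f)"
    using A_J[OF f] by (simp add: linear_diff[OF JH.linJ] linear_scale[OF JH.linJ])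
  then show ?thesis unfolding energy_def using JH.b_J q_J[OF y] by simp
qed

lemma neg_index_0: "neg_index 0 c"
  by (simp add: neg_index_def jfam_def onfam_def)

lemma neg_index_antimono:
  assumes "neg_index k c" "j \<le> k" shows "neg_index j c"
proof -
  obtain e where "jfam J k e" "\<forall>i<2*k. e i \<in> D" "onfam (\<lambda>f g. - schur c f g) (2 * k) e"
    using assms(1) unfolding neg_index_def by blast
  then show ?thesis using assms(2) unfolding neg_index_def jfam_def onfam_def by (intro exI[of _ e]) auto
qed

lemma eigenspace_J: "x \<in> eigenspace_op D A l \<Longrightarrow> J x \<in> eigenspace_op D A l"
  using J_D A_J by (auto simp: eigenspace_op_def linear_scale[OF JH.linJ])

end

section \<open>Schur forms at levels above the bound of \<open>q\<close>\<close>

locale gap = gap_setting D A J Y q for D :: "'a::{real_inner, complete_space} set" and A J Y q +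
  fixes a :: real
  assumes q_le: "\<And>y. y \<in> Y \<Longrightarrow> q y y \<le> a * (norm y)\<^sup>2"
begin

lemma pos_form: "a < c \<Longrightarrow> pos_form Y (\<lambda>x y. c * inner x y - q x y) (c - a)"
proof -
  assume c: "a < c"
  show ?thesis
  proof unfold_locales
    show "c * inner x y - q x y = c * inner y x - q y x" if "x \<in> Y" "y \<in> Y" for x y
      using q.sym[OF that] by (simp add: inner_commute)
    show "(c - a) * (norm y)\<^sup>2 \<le> c * inner y y - q y y" if "y \<in> Y" for y
      using q_le[OF that] by (simp add: power2_norm_eq_inner algebra_simps)
  qed (use c in \<open>auto simp: q.sub q.add_left q.scale_left inner_add_left algebra_simps\<close>)
qed

context
  fixes c assumes c: "a < c"
begin

interpretation P: pos_form Y "\<lambda>x y. c * inner x y - q x y" "c - a"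
  by (rule pos_form[OF c])

lemma linear_dual: "linear (dual c)"
  and norm_dual_le: "norm (dual c h) \<le> norm h / (c - a)"
  and inner_dual_le: "inner h (dual c h) \<le> (norm h)\<^sup>2 / (c - a)"
  and dual_symmetric: "inner (dual c h) h' = inner h (dual c h')"
  unfolding dual_def by (rule P.linear_riesz P.norm_riesz_le P.inner_riesz_le P.riesz_symmetric)+

lemma bounded_linear_dual: "bounded_linear (dual c)"
  using linear_dual norm_dual_le
  by (intro bounded_linear_intro[where K = "1 / (c - a)"]) (auto simp: linear_add linear_scale)

lemma lift_add: "f \<in> D \<Longrightarrow> g \<in> D \<Longrightarrow> lift c (f + g) = lift c f + lift c g"
proof -
  assume "f \<in> D" "g \<in> D"
  then have "A (f + g) - c *\<^sub>R (f + g) = (A f - c *\<^sub>R f) + (A g - c *\<^sub>R g)" by (simp add: A_add algebra_simps)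
  then show ?thesis by (simp add: lift_def linear_add[OF linear_dual])
qed

lemma lift_scale: "f \<in> D \<Longrightarrow> lift c (r *\<^sub>R f) = r *\<^sub>R lift c f"
proof -
  assume "f \<in> D"
  then have "A (r *\<^sub>R f) - c *\<^sub>R (r *\<^sub>R f) = r *\<^sub>R (A f - c *\<^sub>R f)" by (simp add: A_scale algebra_simps)
  then show ?thesis unfolding lift_def by (simp only: linear_scale[OF linear_dual] scaleR_add_right)
qed

lemma lift_sum: "(\<And>i. i < m \<Longrightarrow> e i \<in> D) \<Longrightarrow> lift c (\<Sum>i<m. \<alpha> i *\<^sub>R e i) = (\<Sum>i<m. \<alpha> i *\<^sub>R lift c (e i))"
  for m :: nat
proof (induction m)
  case 0
  show ?case using lift_scale[of 0 0] by simp
next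
  case (Suc m)
  have "(\<Sum>i<m. \<alpha> i *\<^sub>R e i) \<in> D" using Suc.prems by (intro subspace_sum[OF subD]) auto
  then show ?case using Suc by (simp add: lift_add lift_scale D_scale)
qed

lemma norm_lift_le: "norm (lift c f) \<le> norm f + norm (A f - c *\<^sub>R f) / (c - a)"
  unfolding lift_def using norm_triangle_ineq[of f] norm_dual_le[of "A f - c *\<^sub>R f"] by (meson add_left_mono order_trans)

lemma schur_form: "sym_form D (schur c)"
proof
  show "subspace D" by (rule subD)
  fix x y assume x: "x \<in> D" and y: "y \<in> D"
  show "schur c x y = schur c y x"
  proof -
    have "inner (A y - c *\<^sub>R y) x = inner (A x - c *\<^sub>R x) y"
      using A_symmetric[OF x y] by (simp add: inner_diff_left inner_diff_right inner_commute)
    moreover have "inner (A y - c *\<^sub>R y) (dual c (A x - c *\<^sub>R x)) = inner (A x - c *\<^sub>R x) (dual c (A y - c *\<^sub>R y))"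
      using dual_symmetric by (simp add: inner_commute)
    ultimately show ?thesis by (simp add: schur_def lift_def inner_add_right)
  qed
  show "schur c (r *\<^sub>R x) y = r * schur c x y" for r using x by (simp add: schur_def lift_scale)
  show "schur c (x + y) z = schur c x z + schur c y z" if "z \<in> D" for z
    using x y by (simp add: schur_def lift_add inner_add_right)
qed

lemma energy_le: assumes "f \<in> D" "y \<in> Y" shows "energy c f y \<le> schur c f f"
  using P.riesz_upper[OF assms(2), of "A f - c *\<^sub>R f"]
  by (simp add: energy_def schur_def lift_def inner_add_right dual_def)

lemma energy_approx:
  assumes "f \<in> D"
  obtains X where "\<And>n. X n \<in> Y" "(\<lambda>n. f + X n) \<longlonglongrightarrow> lift c f" "(\<lambda>n. energy c f (X n)) \<longlonglongrightarrow> schur c f f"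
proof -
  let ?h = "A f - c *\<^sub>R f"
  obtain X where X: "\<And>n. X n \<in> Y" "X \<longlonglongrightarrow> P.riesz ?h"
    "(\<lambda>n. 2 * inner ?h (X n) - (c * inner (X n) (X n) - q (X n) (X n))) \<longlonglongrightarrow> inner ?h (P.riesz ?h)"
    by (rule P.riesz_approx_sup) (rule that)
  have "(\<lambda>n. f + X n) \<longlonglongrightarrow> lift c f"
    unfolding lift_def dual_def by (rule tendsto_add[OF tendsto_const X(2)])
  moreover have "(\<lambda>n. energy c f (X n)) \<longlonglongrightarrow> schur c f f"
    unfolding energy_def schur_def lift_def dual_def inner_add_right by (rule tendsto_add[OF tendsto_const X(3)])
  ultimately show ?thesis using that[OF X(1)] by simp
qed

text \<open>Invariance comes from the supremum: \<open>J\<close> maps competitors for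
  \<open>f\<close> to competitors for \<open>J f\<close> with equal energy. The reverse inequality
  follows by applying \<open>J\<close> once more, as \<open>J (J f) = - f\<close>.\<close>

lemma schur_J_ge: assumes f: "f \<in> D" shows "schur c f f \<le> schur c (J f) (J f)"
proof -
  obtain X where X: "\<And>n. X n \<in> Y" "(\<lambda>n. energy c f (X n)) \<longlonglongrightarrow> schur c f f" by (rule energy_approx[OF f]) (rule that)
  have "energy c f (X n) \<le> schur c (J f) (J f)" for n
    using energy_le[OF J_D[OF f] J_Y[OF X(1)], of n] energy_J[OF f X(1)] by simp
  then show ?thesis by (intro LIMSEQ_le_const2[OF X(2)]) auto
qed

lemma neg_schur_jform: "jform D (\<lambda>f g. - schur c f g) J"
proof -
  interpret S: sym_form D "schur c" by (rule schur_form)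
  have diag: "schur c (J f) (J f) = schur c f f" if f: "f \<in> D" for f
  proof -
    have "schur c (J (J f)) (J (J f)) = schur c f f" using S.quad_scale[OF f, of "-1"] by (simp add: JH.JJ)
    then show ?thesis using schur_J_ge[OF f] schur_J_ge[OF J_D[OF f]] by simp
  qed
  show ?thesis
  proof
    show "- schur c (J x) (J y) = - schur c x y" if "x \<in> D" "y \<in> D" for x y
    proof -
      have "schur c (J x + J y) (J x + J y) = schur c (x + y) (x + y)"
        using diag[of "x + y"] that by (simp add: linear_add[OF JH.linJ] D_add)
      then show ?thesis using that diag[OF that(1)] diag[OF that(2)] by (simp add: S.quad_add J_D)
    qed
  qed (simp_all add: S.sub S.add_left S.scale_left S.sym linear_add[OF JH.linJ] linear_scale[OF JH.linJ] JH.JJ J_D)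
qed

lemma schur_le_norms: "\<bar>schur c f g\<bar> \<le> norm (A g - c *\<^sub>R g) * norm (lift c f)"
  unfolding schur_def by (rule Cauchy_Schwarz_ineq2)

lemma neg_indexI:
  assumes f: "jfam J k f" "\<And>i. i < 2 * k \<Longrightarrow> f i \<in> D"
    and neg: "\<And>\<alpha>. \<exists>i<2*k. \<alpha> i \<noteq> 0 \<Longrightarrow> schur c (\<Sum>i<2*k. \<alpha> i *\<^sub>R f i) (\<Sum>i<2*k. \<alpha> i *\<^sub>R f i) < 0"
  shows "neg_index k c"
proof -
  interpret N: jform D "\<lambda>f g. - schur c f g" J by (rule neg_schur_jform)
  have "span (f ` {..<2*k}) \<subseteq> D" using f(2) by (intro span_minimal subD) auto
  moreover obtain e where "onfam (\<lambda>f g. - schur c f g) (2 * k) e" "jfam J k e" "\<And>i. i < 2 * k \<Longrightarrow> e i \<in> span (f ` {..<2*k})"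
    by (rule N.gram_schmidt_family[OF f]) (use neg in \<open>auto intro: that\<close>)
  ultimately show ?thesis unfolding neg_index_def by blast
qed

lemma neg_indexE:
  assumes "neg_index k c"
  obtains e where "jfam J k e" "\<And>i. i < 2 * k \<Longrightarrow> e i \<in> D" "onfam (\<lambda>f g. - schur c f g) (2 * k) e"
    "\<And>\<alpha>. schur c (\<Sum>i<2*k. \<alpha> i *\<^sub>R e i) (\<Sum>i<2*k. \<alpha> i *\<^sub>R e i) = - (\<Sum>i<2*k. (\<alpha> i)\<^sup>2)"
proof -
  interpret N: jform D "\<lambda>f g. - schur c f g" J by (rule neg_schur_jform)
  obtain e where e: "jfam J k e" "\<And>i. i < 2 * k \<Longrightarrow> e i \<in> D" "onfam (\<lambda>f g. - schur c f g) (2 * k) e"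
    using assms unfolding neg_index_def by blast
  show ?thesis
    by (rule that[OF e]) (use N.quad_onfam[OF e(3,2)] in \<open>simp_all add: minus_equation_iff\<close>)
qed

end

text \<open>The maximizing sequence at level \<open>l\<close> competes at level \<open>c\<close>,
  where its energy differs by \<open>c - l\<close> times a squared norm converging to that of
  \<open>lift l f\<close>. No order between \<open>l\<close> and \<open>c\<close> is imposed; this
  one comparison gives monotonicity, left continuity and the upper bound on the index.\<close>

lemma schur_shift_ge:
  assumes "a < l" "a < c" "f \<in> D" shows "schur l f f - (c - l) * (norm (lift l f))\<^sup>2 \<le> schur c f f"
proof -
  obtain X where X: "\<And>n. X n \<in> Y" "(\<lambda>n. f + X n) \<longlonglongrightarrow> lift l f" "(\<lambda>n. energy l f (X n)) \<longlonglongrightarrow> schur l f f"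
    by (rule energy_approx[OF assms(1,3)]) (rule that)
  have "(\<lambda>n. energy l f (X n) - (c - l) * (norm (f + X n))\<^sup>2) \<longlonglongrightarrow> schur l f f - (c - l) * (norm (lift l f))\<^sup>2"
    using X by (intro tendsto_intros)
  moreover have "energy l f (X n) - (c - l) * (norm (f + X n))\<^sup>2 \<le> schur c f f" for n
    using energy_le[OF assms(2,3) X(1)[of n]] energy_shift[of c f "X n" l] by simp
  ultimately show ?thesis by (intro LIMSEQ_le_const2) auto
qed

lemma schur_antimono:
  assumes "a < l" "l \<le> c" "f \<in> D" shows "schur c f f \<le> schur l f f"
proof -
  have "0 \<le> (c - l) * (norm (lift c f))\<^sup>2" using assms by simp
  then show ?thesis using schur_shift_ge[of c l f] assms by (simp add: algebra_simps)
qed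

lemma neg_index_mono:
  assumes "a < l" "l \<le> c" "neg_index k l" shows "neg_index k c"
proof -
  have c: "a < c" using assms by simp
  obtain e where e: "jfam J k e" "\<And>i. i < 2 * k \<Longrightarrow> e i \<in> D"
    "\<And>\<alpha>. schur l (\<Sum>i<2*k. \<alpha> i *\<^sub>R e i) (\<Sum>i<2*k. \<alpha> i *\<^sub>R e i) = - (\<Sum>i<2*k. (\<alpha> i)\<^sup>2)"
    by (rule neg_indexE[OF assms(1,3)]) (rule that)
  show ?thesis
  proof (rule neg_indexI[OF c e(1,2)])
    fix \<alpha> :: "nat \<Rightarrow> real" assume nz: "\<exists>i<2*k. \<alpha> i \<noteq> 0"
    let ?v = "\<Sum>i<2*k. \<alpha> i *\<^sub>R e i"
    have "?v \<in> D" using e(2) by (intro subspace_sum[OF subD]) auto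
    then have "schur c ?v ?v \<le> schur l ?v ?v" by (rule schur_antimono[OF assms(1,2)])
    then show "schur c ?v ?v < 0" using e(3)[of \<alpha>] sum_squares_pos[OF nz] by linarith
  qed
qed

text \<open>Negative definiteness on finitely many vectors is an open condition, and
  \<open>lift c'\<close> stays bounded on them as long as \<open>c'\<close> keeps its distance from
  \<open>a\<close>.\<close>

lemma neg_index_left_cont:
  assumes c: "a < c" and P: "neg_index k c"
  obtains c' where "a < c'" "c' < c" "neg_index k c'"
proof -
  obtain e where e: "jfam J k e" "\<And>i. i < 2 * k \<Longrightarrow> e i \<in> D"
    "\<And>\<alpha>. schur c (\<Sum>i<2*k. \<alpha> i *\<^sub>R e i) (\<Sum>i<2*k. \<alpha> i *\<^sub>R e i) = - (\<Sum>i<2*k. (\<alpha> i)\<^sup>2)"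
    by (rule neg_indexE[OF c P]) (rule that)
  \<comment> \<open>A bound of \<open>norm (lift c' (e i))\<close> for all \<open>c'\<close> between
    \<open>(a + c) / 2\<close> and \<open>c\<close>; there \<open>1 / (c' - a)\<close> is at most
    \<open>2 / (c - a)\<close>.\<close>
  define K where "K i = norm (e i) + (norm (A (e i)) + (\<bar>a\<bar> + \<bar>c\<bar>) * norm (e i)) * (2 / (c - a))" for i
  define M where "M = (\<Sum>i<2*k. (K i)\<^sup>2)"
  have M: "0 \<le> M" unfolding M_def by (intro sum_nonneg) simp
  \<comment> \<open>The second entry makes \<open>(c - c') * M < 1\<close>; adding \<open>1\<close>
    to \<open>M\<close> covers \<open>M = 0\<close>.\<close>
  define c' where "c' = max ((a + c) / 2) (c - 1 / (2 * (M + 1)))"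
  have "c - 1 / (2 * (M + 1)) \<le> c'" by (simp add: c'_def)
  then have c': "a < c'" "c' < c" "(a + c) / 2 \<le> c'" "c - c' \<le> 1 / (2 * (M + 1))" using c M by (auto simp: c'_def less_max_iff_disj)
  have "(c - c') * M \<le> 1 / (2 * (M + 1)) * M" using c' M by (intro mult_right_mono)
  also have "\<dots> < 1" using M by (simp add: field_simps)
  finally have small: "(c - c') * M < 1" .
  have KU: "norm (lift c' (e i)) \<le> K i" for i
  proof -
    have "norm (A (e i) - c' *\<^sub>R e i) \<le> norm (A (e i)) + \<bar>c'\<bar> * norm (e i)" using norm_triangle_ineq4[of "A (e i)" "c' *\<^sub>R e i"] by simp
    also have "\<dots> \<le> norm (A (e i)) + (\<bar>a\<bar> + \<bar>c\<bar>) * norm (e i)" using c' by (intro add_left_mono mult_right_mono) auto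
    finally have "norm (A (e i) - c' *\<^sub>R e i) / (c' - a) \<le> (norm (A (e i)) + (\<bar>a\<bar> + \<bar>c\<bar>) * norm (e i)) / (c' - a)"
      using c' by (intro divide_right_mono) auto
    also have "\<dots> \<le> (norm (A (e i)) + (\<bar>a\<bar> + \<bar>c\<bar>) * norm (e i)) / ((c - a) / 2)"
      using c' c by (intro divide_left_mono) auto
    finally show ?thesis using norm_lift_le[OF c'(1), of "e i"] by (simp add: K_def)
  qed
  have "neg_index k c'"
  proof (rule neg_indexI[OF c'(1) e(1,2)])
    fix \<alpha> :: "nat \<Rightarrow> real" assume nz: "\<exists>i<2*k. \<alpha> i \<noteq> 0"
    let ?v = "\<Sum>i<2*k. \<alpha> i *\<^sub>R e i" and ?s = "\<Sum>i<2*k. (\<alpha> i)\<^sup>2"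
    have vD: "?v \<in> D" using e(2) by (intro subspace_sum[OF subD]) auto
    have s: "0 < ?s" by (rule sum_squares_pos[OF nz])
    have "(norm (lift c' ?v))\<^sup>2 \<le> (\<Sum>i<2*k. (norm (lift c' (e i)))\<^sup>2) * ?s"
      using norm_comb_le[of \<alpha> "\<lambda>i. lift c' (e i)" "2 * k"] lift_sum[OF c'(1) e(2), where \<alpha> = \<alpha>] by simp
    also have "\<dots> \<le> M * ?s" unfolding M_def using KU s by (intro mult_right_mono sum_mono power_mono) auto
    finally have "(c - c') * (norm (lift c' ?v))\<^sup>2 \<le> (c - c') * (M * ?s)" using c' by (intro mult_left_mono) auto
    also have "\<dots> < ?s" using mult_strict_right_mono[OF small s] by (simp add: mult.assoc)
    finally show "schur c' ?v ?v < 0" using schur_shift_ge[OF c'(1) c vD] e(3)[of \<alpha>] by linarith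
  qed
  then show ?thesis using that c' by blast
qed

text \<open>Since \<open>A w - l w\<close> vanishes, eigenvectors at \<open>l\<close> lie in the
  radical of \<open>schur l\<close>: they contribute nothing at \<open>l\<close> itself and become
  negative only above it.\<close>

lemma schur_eigenvector:
  assumes "a < l" "w \<in> eigenspace_op D A l" "f \<in> D" shows "schur l f w = 0" "schur l w f = 0"
proof -
  interpret S: sym_form D "schur l" by (rule schur_form[OF assms(1)])
  show "schur l f w = 0" using assms by (simp add: schur_def eigenspace_op_def)
  then show "schur l w f = 0" using S.sym[of f w] assms by (simp add: eigenspace_op_def)
qed

text \<open>The summand \<open>- (c - l) + r\<close> comes from \<open>inner (A w - c w) w\<close>,
  the quotient from the bound \<open>1 / (c - a)\<close> for \<open>dual c\<close>.\<close>

lemma schur_approx_eigenvector: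
  assumes l: "a < l" "l < c" and w: "w \<in> D" and r: "0 \<le> r" "norm (A w - l *\<^sub>R w) \<le> r * norm w"
  shows "schur c w w \<le> (- (c - l) + r + (c - l + r)\<^sup>2 / (c - a)) * (norm w)\<^sup>2"
proof -
  let ?h = "A w - c *\<^sub>R w"
  have h: "?h = (A w - l *\<^sub>R w) - (c - l) *\<^sub>R w" by (simp add: algebra_simps)
  have "inner ?h w = inner (A w - l *\<^sub>R w) w - (c - l) * (norm w)\<^sup>2"
    unfolding h by (simp add: inner_diff_left power2_norm_eq_inner)
  also have "inner (A w - l *\<^sub>R w) w \<le> r * norm w * norm w"
    using norm_cauchy_schwarz[of "A w - l *\<^sub>R w" w] r(2) by (meson mult_right_mono norm_ge_zero order_trans)
  finally have 1: "inner ?h w \<le> (- (c - l) + r) * (norm w)\<^sup>2" by (simp add: power2_eq_square algebra_simps)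
  have "norm ?h \<le> norm (A w - l *\<^sub>R w) + (c - l) * norm w"
    unfolding h using norm_triangle_ineq4[of "A w - l *\<^sub>R w" "(c - l) *\<^sub>R w"] l by simp
  also have "\<dots> \<le> (c - l + r) * norm w" using r by (simp add: algebra_simps)
  finally have "(norm ?h)\<^sup>2 \<le> ((c - l + r) * norm w)\<^sup>2" by (rule power_mono) simp
  then have "(norm ?h)\<^sup>2 / (c - a) \<le> ((c - l + r) * norm w)\<^sup>2 / (c - a)" using l by (intro divide_right_mono) auto
  moreover have "inner ?h (dual c ?h) \<le> (norm ?h)\<^sup>2 / (c - a)" using l by (intro inner_dual_le) simp
  ultimately have 2: "inner ?h (dual c ?h) \<le> (c - l + r)\<^sup>2 / (c - a) * (norm w)\<^sup>2" by (simp add: power_mult_distrib)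
  have "schur c w w = inner ?h w + inner ?h (dual c ?h)" by (simp add: schur_def lift_def inner_add_right)
  then show ?thesis using 1 2 by (simp add: distrib_right)
qed

text \<open>The quantity equals \<open>(c - l) * (l - a) / (c - a)\<close>; it bounds from below how
  negative \<open>schur c\<close> is on a unit eigenvector at \<open>l\<close>.\<close>

lemma gap_factor_pos: "a < l \<Longrightarrow> l < c \<Longrightarrow> 0 < (c - l) - (c - l)\<^sup>2 / (c - a)"
proof -
  assume l: "a < l" "l < c"
  have "(c - l)\<^sup>2 < (c - l) * (c - a)" unfolding power2_eq_square using l by (intro mult_strict_left_mono) auto
  then show ?thesis using l by (simp add: field_simps)
qed

text \<open>On \<open>v + w\<close> with \<open>w\<close> in the eigenspace, \<open>schur l\<close>
  sees only \<open>v\<close>, and monotonicity carries its negativity to \<open>c\<close>. When the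
  coefficients of \<open>v\<close> vanish, strict negativity of \<open>schur c\<close> on
  eigenvectors takes over.\<close>

lemma neg_index_eigenspace:
  assumes l: "a < l" "l < c" and P: "neg_index n l"
    and g: "jfam J d g" "\<And>i. i < 2 * d \<Longrightarrow> g i \<in> eigenspace_op D A l" "onfam inner (2 * d) g"
  shows "neg_index (n + d) c"
proof -
  have c: "a < c" using l by simp
  interpret S: sym_form D "schur l" by (rule schur_form[OF l(1)])
  obtain e where e: "jfam J n e" "\<And>i. i < 2 * n \<Longrightarrow> e i \<in> D"
    "\<And>\<alpha>. schur l (\<Sum>i<2*n. \<alpha> i *\<^sub>R e i) (\<Sum>i<2*n. \<alpha> i *\<^sub>R e i) = - (\<Sum>i<2*n. (\<alpha> i)\<^sup>2)"
    by (rule neg_indexE[OF l(1) P]) (rule that)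
  define f where "f i = (if i < 2 * n then e i else g (i - 2 * n))" for i
  have gD: "i < 2 * d \<Longrightarrow> g i \<in> D" for i using g(2) by (auto simp: eigenspace_op_def)
  have fD: "f i \<in> D" if "i < 2 * (n + d)" for i using e(2) gD that by (auto simp: f_def)
  have jf: "jfam J (n + d) f"
    unfolding jfam_def
  proof (intro allI impI)
    fix i assume i: "i < n + d"
    show "f (2 * i + 1) = J (f (2 * i))"
    proof (cases "i < n")
      case True
      then show ?thesis using e(1) by (simp add: f_def jfam_def)
    next
      case False
      then have "2 * i + 1 - 2 * n = 2 * (i - n) + 1" "2 * i - 2 * n = 2 * (i - n)" "i - n < d" using i by auto
      then show ?thesis using g(1) False by (simp add: f_def jfam_def)
    qed
  qed
  show ?thesis
  proof (rule neg_indexI[OF c jf fD])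
    fix \<alpha> :: "nat \<Rightarrow> real" assume nz: "\<exists>i<2*(n+d). \<alpha> i \<noteq> 0"
    let ?v = "\<Sum>i<2*n. \<alpha> i *\<^sub>R e i" and ?w = "\<Sum>j<2*d. \<alpha> (2 * n + j) *\<^sub>R g j"
    have split: "(\<Sum>i<2*(n+d). \<alpha> i *\<^sub>R f i) = ?v + ?w"
      unfolding distrib_left sum_lessThan_add by (simp add: f_def)
    have vD: "?v \<in> D" using e(2) by (intro subspace_sum[OF subD]) auto
    have wE: "?w \<in> eigenspace_op D A l"
      using g(2) eigenspace_subspace by (intro subspace_sum subspace_scale) auto
    then have wD: "?w \<in> D" and Aw: "A ?w = l *\<^sub>R ?w" by (simp_all add: eigenspace_op_def)
    have Sl: "schur l (?v + ?w) (?v + ?w) = - (\<Sum>i<2*n. (\<alpha> i)\<^sup>2)"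
      using S.quad_add[OF vD wD] schur_eigenvector[OF l(1) wE vD] schur_eigenvector[OF l(1) wE wD] e(3)[of \<alpha>] by simp
    have le: "schur c (?v + ?w) (?v + ?w) \<le> schur l (?v + ?w) (?v + ?w)"
      by (rule schur_antimono) (use l vD wD in auto)
    show "schur c (\<Sum>i<2*(n+d). \<alpha> i *\<^sub>R f i) (\<Sum>i<2*(n+d). \<alpha> i *\<^sub>R f i) < 0"
    proof (cases "\<exists>i<2*n. \<alpha> i \<noteq> 0")
      case True
      then show ?thesis unfolding split using le Sl sum_squares_pos[OF True] by linarith
    next
      case False
      then have v0: "?v = 0" by (intro sum.neutral) auto
      obtain i where i: "i < 2 * (n + d)" "\<alpha> i \<noteq> 0" using nz by blast
      then have "i \<ge> 2 * n" using False by (metis not_le)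
      then have "\<exists>j<2*d. \<alpha> (2 * n + j) \<noteq> 0" using i by (intro exI[of _ "i - 2 * n"]) auto
      then have "0 < inner ?w ?w" using JH.quad_onfam[OF g(3)] sum_squares_pos by simp
      then have w0: "0 < (norm ?w)\<^sup>2" by (simp add: power2_norm_eq_inner)
      have "schur c ?w ?w \<le> (- (c - l) + 0 + (c - l + 0)\<^sup>2 / (c - a)) * (norm ?w)\<^sup>2"
        by (rule schur_approx_eigenvector[OF l wD]) (simp_all add: Aw)
      also have "\<dots> < 0" using gap_factor_pos[OF l] w0 by (intro mult_neg_pos) auto
      finally show ?thesis unfolding split v0 by simp
    qed
  qed
qed

end

lemma norm_diff_scale_le: "norm (y - c *\<^sub>R w) \<le> norm (y - l *\<^sub>R w) + \<bar>c - l\<bar> * norm w"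
proof -
  have eq: "y - c *\<^sub>R w = (y - l *\<^sub>R w) - (c - l) *\<^sub>R w" by (simp add: algebra_simps)
  show ?thesis by (subst eq) (rule order_trans[OF norm_triangle_ineq4], simp)
qed

context gap_setting
begin

lemma norm_J_comb: "(norm (\<alpha> *\<^sub>R x + \<beta> *\<^sub>R J x))\<^sup>2 = (\<alpha>\<^sup>2 + \<beta>\<^sup>2) * (norm x)\<^sup>2"
proof -
  have "inner x (J x) = 0" "inner (J x) x = 0" "inner (J x) (J x) = inner x x"
    using JH.J_orth[of x] JH.b_J[of x x] by (simp_all add: inner_commute)
  then show ?thesis
    unfolding power2_norm_eq_inner by (simp add: inner_add_left inner_add_right power2_eq_square algebra_simps)
qed

lemma jfam_snoc:
  fixes u :: 'a
  assumes e: "jfam J n e"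
  defines "f \<equiv> e(2 * n := u, 2 * n + 1 := J u)"
  shows "jfam J (Suc n) f"
    and "(\<Sum>i<2 * Suc n. \<alpha> i *\<^sub>R f i) = (\<Sum>i<2*n. \<alpha> i *\<^sub>R e i) + (\<alpha> (2 * n) *\<^sub>R u + \<alpha> (2 * n + 1) *\<^sub>R J u)"
    and "(\<And>i. i < 2 * n \<Longrightarrow> e i \<in> W) \<Longrightarrow> u \<in> W \<Longrightarrow> J u \<in> W \<Longrightarrow> i < 2 * Suc n \<Longrightarrow> f i \<in> W"
proof -
  show "jfam J (Suc n) f" using e by (auto simp: jfam_def f_def less_Suc_eq)
  have "(\<Sum>i<2*n. \<alpha> i *\<^sub>R f i) = (\<Sum>i<2*n. \<alpha> i *\<^sub>R e i)" by (rule sum.cong) (auto simp: f_def)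
  then show "(\<Sum>i<2 * Suc n. \<alpha> i *\<^sub>R f i) = (\<Sum>i<2*n. \<alpha> i *\<^sub>R e i) + (\<alpha> (2 * n) *\<^sub>R u + \<alpha> (2 * n + 1) *\<^sub>R J u)"
    by (simp add: f_def)
  show "(\<And>i. i < 2 * n \<Longrightarrow> e i \<in> W) \<Longrightarrow> u \<in> W \<Longrightarrow> J u \<in> W \<Longrightarrow> i < 2 * Suc n \<Longrightarrow> f i \<in> W"
    by (auto simp: f_def less_Suc_eq)
qed

lemma snoc_coeffs:
  assumes "\<exists>i<2 * Suc n. \<alpha> i \<noteq> 0"
  shows "(\<exists>i<2*n. \<alpha> i \<noteq> 0) \<or> \<alpha> (2 * n) \<noteq> (0::real) \<or> \<alpha> (2 * n + 1) \<noteq> 0"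
  using assms by (auto simp: less_Suc_eq)

end

context gap
begin

text \<open>A spectral value need not be an eigenvalue, so an approximate eigenvector \<open>u\<close> with defect \<open>r\<close>
  is adjoined. On \<open>v + w\<close>, \<open>w \<in> span {u, J u}\<close>, the form \<open>schur c\<close> is negative when \<open>v\<close> is small
  compared with \<open>w\<close>, while \<open>schur l\<close> is negative when it is not and \<open>r\<close> is small.\<close>

lemma neg_index_spectrum:
  assumes l: "a < l" "l < c" and P: "neg_index n l" and spec: "l \<in> op_spectrum D A"
  shows "neg_index (Suc n) c"
proof -
  have c: "a < c" using l by simp
  interpret Sl: sym_form D "schur l" by (rule schur_form[OF l(1)])
  interpret Sc: sym_form D "schur c" by (rule schur_form[OF c])
  obtain e where e: "jfam J n e" "\<And>i. i < 2 * n \<Longrightarrow> e i \<in> D"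
    "\<And>\<alpha>. schur l (\<Sum>i<2*n. \<alpha> i *\<^sub>R e i) (\<Sum>i<2*n. \<alpha> i *\<^sub>R e i) = - (\<Sum>i<2*n. (\<alpha> i)\<^sup>2)"
    by (rule neg_indexE[OF l(1) P]) (rule that)
  \<comment> \<open>Half of the gap factor; the other half absorbs the defect \<open>r\<close> of
    the approximate eigenvector.\<close>
  define \<theta> where "\<theta> = ((c - l) - (c - l)\<^sup>2 / (c - a)) / 2"
  have \<theta>: "0 < \<theta>" using gap_factor_pos[OF l] by (simp add: \<theta>_def)
  define \<kappa> where "\<kappa> = sqrt (\<Sum>i<2*n. (norm (lift l (e i)))\<^sup>2)"
  define \<kappa>' where "\<kappa>' = sqrt (\<Sum>i<2*n. (norm (lift c (e i)))\<^sup>2)"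
  have \<kappa>: "0 \<le> \<kappa>" "0 \<le> \<kappa>'" by (auto simp: \<kappa>_def \<kappa>'_def intro!: sum_nonneg)
  \<comment> \<open>\<open>L\<close> controls the mixed term of \<open>schur c\<close>,
    \<open>M\<close> the diagonal term of \<open>schur l\<close> on the new vectors. \<tau> is the
    ratio of \<open>v\<close> to \<open>w\<close> at which the argument switches from level
    \<open>c\<close> to level \<open>l\<close>; \<open>Q\<close> and \<open>R\<close> tell how small
    \<open>r\<close> must be in the two cases.\<close>
  define L where "L = (c - l + 1) * \<kappa>'"
  define M where "M = 1 + 1 / (l - a)"
  define \<tau> where "\<tau> = \<theta> / (4 * L + 1)"
  define Q where "Q = 1 + (2 * (c - l) + 1) / (c - a)"
  have L: "0 \<le> L" using l \<kappa> by (simp add: L_def)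
  have M: "0 < M" using l by (simp add: M_def add_pos_pos)
  have \<tau>: "0 < \<tau>" using \<theta> L by (simp add: \<tau>_def)
  have Q: "0 < Q" using l by (simp add: Q_def add_pos_pos)
  define R where "R = 2 * \<kappa> / \<tau> + M / \<tau>\<^sup>2 + 1"
  have R: "0 < R" using \<kappa> \<tau> M by (simp add: R_def add_nonneg_pos)
  define r where "r = min 1 (min (\<theta> / Q) (1 / R))"
  have r: "0 < r" "r \<le> 1" "r * Q \<le> \<theta>" "r * R \<le> 1"
  proof -
    show "0 < r" "r \<le> 1" using \<theta> Q R by (auto simp: r_def)
    have "r \<le> \<theta> / Q" "r \<le> 1 / R" by (auto simp: r_def)
    then show "r * Q \<le> \<theta>" "r * R \<le> 1" using Q R by (simp_all add: pos_le_divide_eq)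
  qed
  obtain u where u: "u \<in> D" "norm u = 1" "norm (A u - l *\<^sub>R u) < r" by (rule spectrum_approx[OF spec r(1)]) (rule that)
  define f where "f = e(2 * n := u, 2 * n + 1 := J u)"
  have fD: "f i \<in> D" if "i < 2 * Suc n" for i unfolding f_def by (rule jfam_snoc(3)[OF e(1,2) u(1) J_D[OF u(1)] that])
  show ?thesis
  proof (rule neg_indexI[OF c jfam_snoc(1)[OF e(1), of u, folded f_def] fD])
    fix \<alpha> :: "nat \<Rightarrow> real" assume nz: "\<exists>i<2 * Suc n. \<alpha> i \<noteq> 0"
    let ?v = "\<Sum>i<2*n. \<alpha> i *\<^sub>R e i" and ?w = "\<alpha> (2 * n) *\<^sub>R u + \<alpha> (2 * n + 1) *\<^sub>R J u"
    define N where "N = (\<Sum>i<2*n. (\<alpha> i)\<^sup>2)"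
    define s where "s = sqrt N"
    define \<rho> where "\<rho> = norm ?w"
    have N0: "0 \<le> N" unfolding N_def by (intro sum_nonneg) simp
    have s: "0 \<le> s" "s\<^sup>2 = N" using N0 by (auto simp: s_def)
    have \<rho>: "0 \<le> \<rho>" "\<rho>\<^sup>2 = (\<alpha> (2 * n))\<^sup>2 + (\<alpha> (2 * n + 1))\<^sup>2" unfolding \<rho>_def using norm_J_comb u(2) by auto
    have vD: "?v \<in> D" using e(2) by (intro subspace_sum[OF subD]) auto
    have wD: "?w \<in> D" using u(1) J_D by auto
    have defect: "norm (A ?w - l *\<^sub>R ?w) \<le> r * \<rho>"
    proof -
      have "A ?w - l *\<^sub>R ?w = \<alpha> (2 * n) *\<^sub>R (A u - l *\<^sub>R u) + \<alpha> (2 * n + 1) *\<^sub>R J (A u - l *\<^sub>R u)"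
        using u(1) J_D A_J by (simp add: A_add A_scale D_scale linear_diff[OF JH.linJ] linear_scale[OF JH.linJ] algebra_simps)
      then have "(norm (A ?w - l *\<^sub>R ?w))\<^sup>2 = \<rho>\<^sup>2 * (norm (A u - l *\<^sub>R u))\<^sup>2" using norm_J_comb \<rho> by simp
      also have "\<dots> \<le> \<rho>\<^sup>2 * r\<^sup>2" using u(3) by (intro mult_left_mono power_mono) auto
      finally have "(norm (A ?w - l *\<^sub>R ?w))\<^sup>2 \<le> (r * \<rho>)\<^sup>2" by (simp add: power_mult_distrib mult.commute)
      then show ?thesis by (rule power2_le_imp_le) (use r \<rho> in simp)
    qed
    have lv: "norm (lift l ?v) \<le> \<kappa> * s" "norm (lift c ?v) \<le> \<kappa>' * s"
    proof -
      have "(norm (lift l ?v))\<^sup>2 \<le> (\<kappa> * s)\<^sup>2"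
        using norm_comb_le[of \<alpha> "\<lambda>i. lift l (e i)" "2 * n"] lift_sum[OF l(1) e(2), where \<alpha> = \<alpha>] s
        by (simp add: N_def \<kappa>_def power_mult_distrib sum_nonneg)
      then show "norm (lift l ?v) \<le> \<kappa> * s" by (rule power2_le_imp_le) (use \<kappa> s in simp)
      have "(norm (lift c ?v))\<^sup>2 \<le> (\<kappa>' * s)\<^sup>2"
        using norm_comb_le[of \<alpha> "\<lambda>i. lift c (e i)" "2 * n"] lift_sum[OF c e(2), where \<alpha> = \<alpha>] s
        by (simp add: N_def \<kappa>'_def power_mult_distrib sum_nonneg)
      then show "norm (lift c ?v) \<le> \<kappa>' * s" by (rule power2_le_imp_le) (use \<kappa> s in simp)
    qed
    have Slv: "schur l ?v ?v = - s\<^sup>2" using e(3)[of \<alpha>] s by (simp add: N_def)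
    have Slvw: "schur l ?v ?w \<le> r * \<kappa> * \<rho> * s"
    proof -
      have "schur l ?v ?w \<le> norm (A ?w - l *\<^sub>R ?w) * norm (lift l ?v)" using schur_le_norms[of l ?v ?w] l(1) by simp
      also have "\<dots> \<le> (r * \<rho>) * (\<kappa> * s)" using defect lv \<rho> r by (intro mult_mono) auto
      finally show ?thesis by (simp add: mult_ac)
    qed
    have Slw: "schur l ?w ?w \<le> r * M * \<rho>\<^sup>2"
    proof -
      have "norm (lift l ?w) \<le> \<rho> + (r * \<rho>) / (l - a)"
        using norm_lift_le[OF l(1), of ?w] divide_right_mono[OF defect, of "l - a"] l by (simp add: \<rho>_def)
      also have "\<dots> \<le> \<rho> + \<rho> / (l - a)"
        using r \<rho> l by (intro add_left_mono divide_right_mono) (auto simp: mult_left_le_one_le)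
      also have "\<dots> = M * \<rho>" using l by (simp add: M_def field_simps)
      finally have 1: "norm (lift l ?w) \<le> M * \<rho>" .
      have "schur l ?w ?w \<le> norm (A ?w - l *\<^sub>R ?w) * norm (lift l ?w)" using schur_le_norms[of l ?w ?w] l(1) by simp
      also have "\<dots> \<le> (r * \<rho>) * (M * \<rho>)" using defect 1 \<rho> r by (intro mult_mono) auto
      finally show ?thesis by (simp add: power2_eq_square mult_ac)
    qed
    have Scvw: "schur c ?v ?w \<le> L * \<rho> * s"
    proof -
      have "norm (A ?w - c *\<^sub>R ?w) \<le> norm (A ?w - l *\<^sub>R ?w) + (c - l) * \<rho>"
        using norm_diff_scale_le[of "A ?w" c ?w l] l by (simp add: \<rho>_def)
      also have "\<dots> \<le> r * \<rho> + (c - l) * \<rho>" using defect by simp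
      also have "\<dots> \<le> 1 * \<rho> + (c - l) * \<rho>" using r \<rho> by (intro add_right_mono mult_right_mono) auto
      finally have 1: "norm (A ?w - c *\<^sub>R ?w) \<le> (c - l + 1) * \<rho>" by (simp add: algebra_simps)
      have "schur c ?v ?w \<le> norm (A ?w - c *\<^sub>R ?w) * norm (lift c ?v)" using schur_le_norms[of c ?v ?w] c by simp
      also have "\<dots> \<le> ((c - l + 1) * \<rho>) * (\<kappa>' * s)" using 1 lv \<rho> l by (intro mult_mono) auto
      finally show ?thesis by (simp add: L_def mult_ac)
    qed
    have Scw: "schur c ?w ?w \<le> - \<theta> * \<rho>\<^sup>2"
    proof -
      have "schur c ?w ?w \<le> (- (c - l) + r + (c - l + r)\<^sup>2 / (c - a)) * (norm ?w)\<^sup>2"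
        by (rule schur_approx_eigenvector[OF l wD]) (use r defect in \<open>auto simp: \<rho>_def\<close>)
      also have "\<dots> \<le> - \<theta> * (norm ?w)\<^sup>2"
      proof (rule mult_right_mono)
        have t2: "2 * \<theta> = (c - l) - (c - l)\<^sup>2 / (c - a)" by (simp add: \<theta>_def)
        have rQ: "r * Q = r + r * ((2 * (c - l) + 1) / (c - a))" unfolding Q_def distrib_left by simp
        have "r\<^sup>2 \<le> r" using r by (simp add: power2_eq_square mult_left_le)
        moreover have "(c - l + r)\<^sup>2 = (c - l)\<^sup>2 + r\<^sup>2 + 2 * (c - l) * r" by (rule power2_sum)
        moreover have "r * (2 * (c - l) + 1) = 2 * (c - l) * r + r" by (simp add: algebra_simps)
        ultimately have "(c - l + r)\<^sup>2 \<le> (c - l)\<^sup>2 + r * (2 * (c - l) + 1)" by linarith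
        then have "(c - l + r)\<^sup>2 / (c - a) \<le> ((c - l)\<^sup>2 + r * (2 * (c - l) + 1)) / (c - a)" using c by (intro divide_right_mono) auto
        also have "\<dots> = (c - l)\<^sup>2 / (c - a) + r * ((2 * (c - l) + 1) / (c - a))"
          by (simp only: add_divide_distrib[of "(c - l)\<^sup>2" "r * (2 * (c - l) + 1)"] times_divide_eq_right)
        finally have "- (c - l) + r + (c - l + r)\<^sup>2 / (c - a) \<le> - 2 * \<theta> + r * Q"
          using t2 rQ by linarith
        then show "- (c - l) + r + (c - l + r)\<^sup>2 / (c - a) \<le> - \<theta>" using r(3) by linarith
      qed simp
      finally show ?thesis by (simp add: \<rho>_def)
    qed
    have Scv: "schur c ?v ?v \<le> 0" using schur_antimono[OF l(1) less_imp_le[OF l(2)] vD] Slv by (smt (verit) zero_le_power2)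
    have "schur c (?v + ?w) (?v + ?w) < 0"
    proof (cases "s \<le> \<tau> * \<rho>")
      case True
      have "0 < \<rho>"
      proof (rule ccontr)
        assume "\<not> 0 < \<rho>"
        then have "\<rho> = 0" using \<rho> by simp
        then have z: "\<alpha> (2 * n) = 0" "\<alpha> (2 * n + 1) = 0" "s = 0" using \<rho>(2) True s by (auto simp: sum_power2_eq_zero_iff)
        then have "\<exists>i<2*n. \<alpha> i \<noteq> 0" using snoc_coeffs[OF nz] by blast
        then have "0 < N" unfolding N_def by (rule sum_squares_pos)
        then show False using z(3) s(2) by simp
      qed
      have "schur c (?v + ?w) (?v + ?w) \<le> 2 * (L * \<rho> * s) - \<theta> * \<rho>\<^sup>2"
        unfolding Sc.quad_add[OF vD wD] using Scv Scvw Scw by linarith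
      also have "\<dots> \<le> 2 * (L * \<rho> * (\<tau> * \<rho>)) - \<theta> * \<rho>\<^sup>2"
        using True L \<rho> by (intro diff_right_mono mult_left_mono) auto
      also have "\<dots> = (2 * L * \<tau> - \<theta>) * \<rho>\<^sup>2" by (simp add: power2_eq_square algebra_simps)
      also have "\<dots> < 0"
      proof (rule mult_neg_pos)
        have "2 * L * \<tau> < \<theta>" using L \<theta> by (simp add: \<tau>_def field_simps add_pos_nonneg)
        then show "2 * L * \<tau> - \<theta> < 0" by simp
        show "0 < \<rho>\<^sup>2" using \<open>0 < \<rho>\<close> by simp
      qed
      finally show ?thesis .
    next
      case False
      then have lt: "\<tau> * \<rho> < s" by simp
      then have s0: "0 < s" using \<tau> \<rho> by (smt (verit) mult_nonneg_nonneg)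
      have \<rho>s: "\<rho> \<le> s / \<tau>" using lt \<tau> by (simp add: field_simps)
      have "schur c (?v + ?w) (?v + ?w) \<le> schur l (?v + ?w) (?v + ?w)"
        by (rule schur_antimono) (use l vD wD in auto)
      also have "\<dots> \<le> - s\<^sup>2 + 2 * (r * \<kappa> * \<rho> * s) + r * M * \<rho>\<^sup>2"
        unfolding Sl.quad_add[OF vD wD] using Slv Slvw Slw by linarith
      also have "\<dots> \<le> - s\<^sup>2 + 2 * (r * \<kappa> * (s / \<tau>) * s) + r * M * (s / \<tau>)\<^sup>2"
        using \<rho>s \<rho> s r \<kappa> M by (intro add_mono mult_left_mono mult_right_mono power_mono) auto
      also have "\<dots> = (r * (2 * \<kappa> / \<tau> + M / \<tau>\<^sup>2) - 1) * s\<^sup>2"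
        by (simp add: power2_eq_square power_divide algebra_simps)
      also have "\<dots> < 0"
      proof (rule mult_neg_pos)
        have "r * (2 * \<kappa> / \<tau> + M / \<tau>\<^sup>2) < r * R" using r by (simp add: R_def)
        then show "r * (2 * \<kappa> / \<tau> + M / \<tau>\<^sup>2) - 1 < 0" using r(4) by linarith
        show "0 < s\<^sup>2" using s0 by simp
      qed
      finally show ?thesis .
    qed
    then show "schur c (\<Sum>i<2 * Suc n. \<alpha> i *\<^sub>R f i) (\<Sum>i<2 * Suc n. \<alpha> i *\<^sub>R f i) < 0"
      unfolding f_def jfam_snoc(2)[OF e(1)] .
  qed
qed

lemma maximal_neg_index: "\<not> neg_index (Suc m) l \<Longrightarrow> \<exists>n\<le>m. neg_index n l \<and> \<not> neg_index (Suc n) l"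
proof (induction m)
  case 0
  then show ?case using neg_index_0 by blast
next
  case (Suc m)
  then show ?case by (cases "neg_index (Suc m) l") (use le_SucI in blast)+
qed

text \<open>A vector with negative value could be adjoined together with its image under
  \<open>J\<close>: both are orthogonal to the family, because its span is
  \<open>J\<close>-invariant, and the index would exceed \<open>n\<close>.\<close>

lemma neg_index_complement_nonneg:
  assumes l: "a < l" and e: "jfam J n e" "\<And>i. i < 2 * n \<Longrightarrow> e i \<in> D"
    and eneg: "\<And>\<alpha>. schur l (\<Sum>i<2*n. \<alpha> i *\<^sub>R e i) (\<Sum>i<2*n. \<alpha> i *\<^sub>R e i) = - (\<Sum>i<2*n. (\<alpha> i)\<^sup>2)"
    and max: "\<not> neg_index (Suc n) l" and f: "f \<in> D" and orth: "\<And>i. i < 2 * n \<Longrightarrow> schur l f (e i) = 0"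
  shows "0 \<le> schur l f f"
proof (rule ccontr)
  assume "\<not> ?thesis"
  then have neg: "schur l f f < 0" by simp
  interpret S: sym_form D "schur l" by (rule schur_form[OF l])
  interpret N: jform D "\<lambda>f g. - schur l f g" J by (rule neg_schur_jform[OF l])
  have Jf: "J f \<in> D" by (rule J_D[OF f])
  have fo: "schur l f x = 0" if "x \<in> span (e ` {..<2*n})" for x
  proof -
    obtain \<alpha> where x: "x = (\<Sum>i<2*n. \<alpha> i *\<^sub>R e i)" using \<open>x \<in> span (e ` {..<2*n})\<close> unfolding span_family by (rule exE)
    have "schur l x f = (\<Sum>i<2*n. \<alpha> i * schur l (e i) f)" unfolding x by (rule S.comb_left[OF e(2) f])
    also have "\<dots> = 0" using orth S.sym[OF e(2) f] by (intro sum.neutral) auto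
    finally show ?thesis using S.sym[OF f, of x] S.comb_in[OF e(2), where \<alpha> = \<alpha>] x by simp
  qed
  define g where "g = e(2 * n := f, 2 * n + 1 := J f)"
  have gD: "g i \<in> D" if "i < 2 * Suc n" for i unfolding g_def by (rule jfam_snoc(3)[OF e f Jf that])
  have "neg_index (Suc n) l"
  proof (rule neg_indexI[OF l jfam_snoc(1)[OF e(1), of f, folded g_def] gD])
    fix \<alpha> :: "nat \<Rightarrow> real" assume nz: "\<exists>i<2 * Suc n. \<alpha> i \<noteq> 0"
    let ?v = "\<Sum>i<2*n. \<alpha> i *\<^sub>R e i" and ?w = "\<alpha> (2 * n) *\<^sub>R f + \<alpha> (2 * n + 1) *\<^sub>R J f"
    have vD: "?v \<in> D" by (rule S.comb_in[OF e(2)])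
    have wD: "?w \<in> D" using f Jf by auto
    have vs: "?v \<in> span (e ` {..<2*n})" unfolding span_family by (rule exI[of _ \<alpha>]) simp
    have "schur l f ?v = 0" by (rule fo[OF vs])
    moreover have "schur l (J f) ?v = 0"
      using fo[OF N.span_jfam_invariant[OF e(1) vs]] N.J_left[OF f vD] by simp
    ultimately have "schur l ?w ?v = 0" using f Jf vD by (simp add: S.add_left S.scale_left S.V_scale)
    then have vw: "schur l ?v ?w = 0" using S.sym[OF vD wD] by simp
    have "schur l f (J f) = 0" "schur l (J f) f = 0" "schur l (J f) (J f) = schur l f f"
      using N.J_orth[OF f] S.sym[OF f Jf] N.b_J[OF f f] by auto
    then have ww: "schur l ?w ?w = ((\<alpha> (2 * n))\<^sup>2 + (\<alpha> (2 * n + 1))\<^sup>2) * schur l f f"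
      using f Jf by (simp add: S.quad_add S.quad_scale S.scale_left S.scale_right S.V_scale power2_eq_square algebra_simps)
    have total: "schur l (?v + ?w) (?v + ?w) = - (\<Sum>i<2*n. (\<alpha> i)\<^sup>2) + ((\<alpha> (2 * n))\<^sup>2 + (\<alpha> (2 * n + 1))\<^sup>2) * schur l f f"
      unfolding S.quad_add[OF vD wD] eneg vw ww by simp
    have s0: "0 \<le> (\<Sum>i<2*n. (\<alpha> i)\<^sup>2)" by (intro sum_nonneg) simp
    have t0: "((\<alpha> (2 * n))\<^sup>2 + (\<alpha> (2 * n + 1))\<^sup>2) * schur l f f \<le> 0" using neg by (intro mult_nonneg_nonpos) auto
    have "schur l (?v + ?w) (?v + ?w) < 0"
    proof (cases "\<exists>i<2*n. \<alpha> i \<noteq> 0")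
      case True
      then show ?thesis unfolding total using sum_squares_pos[OF True] t0 by linarith
    next
      case False
      then have "0 < (\<alpha> (2 * n))\<^sup>2 + (\<alpha> (2 * n + 1))\<^sup>2" using snoc_coeffs[OF nz] by (auto simp: sum_power2_gt_zero_iff)
      then have "((\<alpha> (2 * n))\<^sup>2 + (\<alpha> (2 * n + 1))\<^sup>2) * schur l f f < 0" using neg by (rule mult_pos_neg)
      then show ?thesis unfolding total using s0 by linarith
    qed
    then show "schur l (\<Sum>i<2 * Suc n. \<alpha> i *\<^sub>R g i) (\<Sum>i<2 * Suc n. \<alpha> i *\<^sub>R g i) < 0"
      unfolding g_def jfam_snoc(2)[OF e(1)] .
  qed
  then show False using max by simp
qed

text \<open>Coercivity: if \<open>f\<close> is \<open>schur l\<close>-orthogonal to a maximal negative subspace and \<open>lift l f\<close> is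
  orthogonal to the eigenspace, then Cauchy-Schwarz against the solution \<open>g\<close> of
  \<open>(A - l) g = lift l f\<close> bounds \<open>\<parallel>lift l f\<parallel>\<^sup>2\<close> by \<open>schur l f f\<close>.\<close>

lemma schur_coercive:
  assumes l: "a < l" and ess: "l \<notin> ess_spectrum D A"
    and e: "jfam J n e" "\<And>i. i < 2 * n \<Longrightarrow> e i \<in> D" "onfam (\<lambda>f g. - schur l f g) (2 * n) e"
    and eneg: "\<And>\<alpha>. schur l (\<Sum>i<2*n. \<alpha> i *\<^sub>R e i) (\<Sum>i<2*n. \<alpha> i *\<^sub>R e i) = - (\<Sum>i<2*n. (\<alpha> i)\<^sup>2)"
    and max: "\<not> neg_index (Suc n) l"
  obtains C where "0 < C" "\<And>f. f \<in> D \<Longrightarrow> (\<And>i. i < 2 * n \<Longrightarrow> schur l f (e i) = 0) \<Longrightarrow>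
     (\<And>k. k \<in> eigenspace_op D A l \<Longrightarrow> inner (lift l f) k = 0) \<Longrightarrow> (norm (lift l f))\<^sup>2 \<le> C * schur l f f"
proof -
  interpret S: sym_form D "schur l" by (rule schur_form[OF l])
  interpret B: sa_op D "\<lambda>x. A x - l *\<^sub>R x" by (rule sa_opI[OF sa_shift])
  obtain \<delta> where \<delta>: "0 < \<delta>"
    "\<And>x. x \<in> D \<Longrightarrow> (\<And>k. k \<in> eigenspace_op D A l \<Longrightarrow> inner x k = 0) \<Longrightarrow> \<delta> * norm x \<le> norm (A x - l *\<^sub>R x)"
    using nonessential_bounded_below[OF ess] by blast
  define s where "s = (\<Sum>i<2*n. (norm (lift l (e i)))\<^sup>2)"
  \<comment> \<open>The summands come from \<open>norm g\<close>, from the dual part of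
    \<open>lift l g\<close>, and from the correction \<open>p\<close> of \<open>g\<close>.\<close>
  define C where "C = 1 / \<delta> + 1 / (l - a) + s"
  have "0 \<le> s" unfolding s_def by (intro sum_nonneg) simp
  then have C: "0 < C" using \<delta> l by (simp add: C_def add_pos_nonneg)
  let ?Z = "{z \<in> D. \<forall>i<2*n. schur l z (e i) = 0}"
  have Z: "subspace ?Z"
    using subD e(2) by (auto simp: subspace_def S.zero_left S.add_left S.scale_left)
  have Znn: "0 \<le> schur l z z" if "z \<in> ?Z" for z
    using that by (intro neg_index_complement_nonneg[OF l e(1,2) eneg max]) auto
  show ?thesis
  proof (rule that[OF C])
    fix f assume f: "f \<in> D" and fe: "\<And>i. i < 2 * n \<Longrightarrow> schur l f (e i) = 0"
      and fk: "\<And>k. k \<in> eigenspace_op D A l \<Longrightarrow> inner (lift l f) k = 0"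
    let ?w = "lift l f"
    have fZ: "f \<in> ?Z" using f fe by simp
    obtain g where g: "g \<in> D" "A g - l *\<^sub>R g = ?w" "\<delta> * norm g \<le> norm ?w"
      by (rule B.solvable_on_complement[OF eigenspace_subspace eigenspace_closed _ _ \<delta> fk])
        (auto simp: eigenspace_op_def intro: that)
    \<comment> \<open>\<open>g + p\<close> is the projection of \<open>g\<close> onto the complement
      of the negative subspace; the sign is plus because
      \<open>schur l (e i) (e i) = -1\<close>.\<close>
    define p where "p = (\<Sum>i<2*n. schur l g (e i) *\<^sub>R e i)"
    have pD: "p \<in> D" unfolding p_def by (rule S.comb_in[OF e(2)])
    have pe: "schur l p (e j) = - schur l g (e j)" if j: "j < 2 * n" for j
    proof -
      have "schur l p (e j) = (\<Sum>i<2*n. schur l g (e i) * schur l (e i) (e j))" unfolding p_def by (rule S.comb_left[OF e(2) e(2)[OF j]])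
      also have "\<dots> = (\<Sum>i<2*n. if i = j then - schur l g (e i) else 0)"
      proof (rule sum.cong[OF refl])
        fix i assume "i \<in> {..<2*n}"
        then have "- schur l (e i) (e j) = (if i = j then 1 else 0)" using onfamD[OF e(3) _ j] by simp
        then have "schur l (e i) (e j) = (if i = j then -1 else 0)" by (simp split: if_splits)
        then show "schur l g (e i) * schur l (e i) (e j) = (if i = j then - schur l g (e i) else 0)" by simp
      qed
      also have "\<dots> = - schur l g (e j)" using j by simp
      finally show ?thesis .
    qed
    have gpZ: "g + p \<in> ?Z" using g(1) pD pe e(2) by (auto simp: S.add_left)
    have fg: "schur l f (g + p) = (norm ?w)\<^sup>2"
    proof -
      have "schur l f p = 0"
      proof -
        have "schur l p f = (\<Sum>i<2*n. schur l g (e i) * schur l (e i) f)" unfolding p_def by (rule S.comb_left[OF e(2) f])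
        also have "\<dots> = 0" using fe S.sym[OF e(2) f] by (intro sum.neutral) auto
        finally show ?thesis using S.sym[OF f pD] by simp
      qed
      moreover have "schur l f g = (norm ?w)\<^sup>2" by (simp add: schur_def g(2) power2_norm_eq_inner)
      ultimately show ?thesis using f g(1) pD by (simp add: S.add_right)
    qed
    have gp: "schur l (g + p) (g + p) \<le> C * (norm ?w)\<^sup>2"
    proof -
      have gpp: "schur l (g + p) p = 0"
      proof -
        have "schur l p (g + p) = (\<Sum>i<2*n. schur l g (e i) * schur l (e i) (g + p))"
          unfolding p_def by (rule S.comb_left[OF e(2)]) (use g(1) pD p_def in auto)
        also have "\<dots> = 0" using gpZ S.sym[OF e(2), of _ "g + p"] g(1) pD by (intro sum.neutral) (auto simp: D_add)
        finally show ?thesis using S.sym[of p "g + p"] g(1) pD by (simp add: D_add)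
      qed
      have "schur l (g + p) (g + p) = schur l (g + p) g"
        using gpp g(1) pD by (simp add: S.add_right D_add)
      also have "\<dots> = schur l g g + schur l p g" using g(1) pD by (simp add: S.add_left)
      also have "schur l p g = (\<Sum>i<2*n. (schur l g (e i))\<^sup>2)"
        unfolding p_def by (subst S.comb_left[OF e(2) g(1)]) (auto simp: power2_eq_square S.sym[OF e(2) g(1)])
      also have "\<dots> \<le> (\<Sum>i<2*n. (norm (lift l (e i)))\<^sup>2 * (norm ?w)\<^sup>2)"
      proof (rule sum_mono)
        fix i assume i: "i \<in> {..<2*n}"
        have "\<bar>schur l g (e i)\<bar> \<le> norm (lift l (e i)) * norm ?w"
          using schur_le_norms[OF l, of "e i" g] S.sym[OF g(1) e(2), of i] i by (simp add: g(2) mult.commute)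
        then have "\<bar>schur l g (e i)\<bar>\<^sup>2 \<le> (norm (lift l (e i)) * norm ?w)\<^sup>2" by (rule power_mono) simp
        then show "(schur l g (e i))\<^sup>2 \<le> (norm (lift l (e i)))\<^sup>2 * (norm ?w)\<^sup>2" by (simp add: power_mult_distrib)
      qed
      also have "\<dots> = s * (norm ?w)\<^sup>2" by (simp add: s_def sum_distrib_right)
      finally have 1: "schur l (g + p) (g + p) \<le> schur l g g + s * (norm ?w)\<^sup>2" by simp
      have "schur l g g \<le> norm ?w * norm (lift l g)" using schur_le_norms[OF l, of g g] by (simp add: g(2))
      also have "\<dots> \<le> norm ?w * ((1 / \<delta> + 1 / (l - a)) * norm ?w)"
      proof (rule mult_left_mono)
        have "norm (lift l g) \<le> norm g + norm ?w / (l - a)" using norm_lift_le[OF l, of g] by (simp add: g(2))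
        also have "norm g \<le> norm ?w / \<delta>" using g(3) \<delta>(1) by (simp add: field_simps)
        finally show "norm (lift l g) \<le> (1 / \<delta> + 1 / (l - a)) * norm ?w" by (simp add: distrib_right)
      qed simp
      also have "\<dots> = (1 / \<delta> + 1 / (l - a)) * (norm ?w)\<^sup>2" by (simp add: power2_eq_square mult_ac)
      finally show ?thesis using 1 by (simp add: C_def distrib_right)
    qed
    have "(norm ?w)\<^sup>2 * (norm ?w)\<^sup>2 \<le> schur l f f * schur l (g + p) (g + p)"
      using S.Cauchy_Schwarz[OF Znn Z _ fZ gpZ] by (simp add: fg power2_eq_square)
    also have "\<dots> \<le> schur l f f * (C * (norm ?w)\<^sup>2)" using gp Znn[OF fZ] by (intro mult_left_mono)
    finally have "(norm ?w)\<^sup>2 * (norm ?w)\<^sup>2 \<le> (C * schur l f f) * (norm ?w)\<^sup>2" by (simp add: mult_ac)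
    then show "(norm ?w)\<^sup>2 \<le> C * schur l f f"
      by (rule self_mult_le_cancel) (use C Znn[OF fZ] in auto)
  qed
qed

text \<open>Dimension count: with \<open>d\<close> half the real dimension of the eigenspace, a
  larger index at \<open>c\<close> would give a space of real dimension
  \<open>2 * Suc (m + d)\<close>, hence a nonzero vector meeting the \<open>2 * n + 2 * d\<close>
  conditions of the coercivity estimate. For \<open>c - l < 1 / C\<close> that estimate makes
  \<open>schur c\<close> nonnegative at it.\<close>

lemma neg_index_upper:
  assumes l: "a < l" and ess: "l \<notin> ess_spectrum D A" and fin: "fin_dim (eigenspace_op D A l)"
    and not: "\<not> neg_index (Suc m) l"
  obtains \<epsilon> where "0 < \<epsilon>" "\<And>c. l < c \<Longrightarrow> c < l + \<epsilon> \<Longrightarrow> \<not> neg_index (Suc (m + dim (eigenspace_op D A l) div 2)) c"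
proof -
  let ?K = "eigenspace_op D A l"
  interpret S: sym_form D "schur l" by (rule schur_form[OF l])
  obtain n where n: "n \<le> m" "neg_index n l" "\<not> neg_index (Suc n) l" using maximal_neg_index[OF not] by blast
  obtain e where e: "jfam J n e" "\<And>i. i < 2 * n \<Longrightarrow> e i \<in> D" "onfam (\<lambda>f g. - schur l f g) (2 * n) e"
    "\<And>\<alpha>. schur l (\<Sum>i<2*n. \<alpha> i *\<^sub>R e i) (\<Sum>i<2*n. \<alpha> i *\<^sub>R e i) = - (\<Sum>i<2*n. (\<alpha> i)\<^sup>2)"
    by (rule neg_indexE[OF l n(2)]) (rule that)
  obtain d g where g: "?K = span (g ` {..<2*d})" "dim ?K = 2 * d"
    by (rule JH.gram_schmidt_fin[OF eigenspace_subspace subset_UNIV eigenspace_J _ fin]) (auto intro: that)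
  obtain C where C: "0 < C" "\<And>f. f \<in> D \<Longrightarrow> (\<And>i. i < 2 * n \<Longrightarrow> schur l f (e i) = 0) \<Longrightarrow>
     (\<And>k. k \<in> ?K \<Longrightarrow> inner (lift l f) k = 0) \<Longrightarrow> (norm (lift l f))\<^sup>2 \<le> C * schur l f f"
    using schur_coercive[OF l ess e n(3)] by blast
  show ?thesis
  proof (rule that[of "1 / C"])
    fix c assume lc: "l < c" "c < l + 1 / C"
    have c: "a < c" using l lc by simp
    have dd: "dim ?K div 2 = d" using g(2) by simp
    show "\<not> neg_index (Suc (m + dim ?K div 2)) c"
    proof
      assume P: "neg_index (Suc (m + dim ?K div 2)) c"
      let ?M = "2 * Suc (m + d)"
      interpret N: jform D "\<lambda>f g. - schur c f g" J by (rule neg_schur_jform[OF c])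
      obtain x where x: "\<And>i. i < ?M \<Longrightarrow> x i \<in> D" "onfam (\<lambda>f g. - schur c f g) ?M x"
        "\<And>\<alpha>. schur c (\<Sum>i<?M. \<alpha> i *\<^sub>R x i) (\<Sum>i<?M. \<alpha> i *\<^sub>R x i) = - (\<Sum>i<?M. (\<alpha> i)\<^sup>2)"
        by (rule neg_indexE[OF c P[unfolded dd]]) (rule that)
      have indep: "\<alpha> i = 0" if "(\<Sum>i<?M. \<alpha> i *\<^sub>R x i) = 0" "i < ?M" for \<alpha> i
        by (rule N.onfam_independent[OF x(2,1) that])
      \<comment> \<open>The first \<open>2 * n\<close> columns encode orthogonality to the negative
        subspace, the remaining \<open>2 * d\<close> orthogonality of the lift to a spanning family
        of the eigenspace.\<close>
      define b where "b i j = (if j < 2 * n then schur l (x i) (e j) else inner (lift l (x i)) (g (j - 2 * n)))" for i j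
      obtain \<alpha> where \<alpha>: "\<exists>i<?M. \<alpha> i \<noteq> 0" "\<And>j. j < 2 * n + 2 * d \<Longrightarrow> (\<Sum>i<?M. \<alpha> i * b i j) = 0"
      proof (rule homogeneous_system[where a = b and w = x and L = "2 * n + 2 * d" and M = ?M])
        show "2 * n + 2 * d < ?M" using n(1) by simp
        show "\<alpha> i = 0" if "(\<Sum>i<?M. \<alpha> i *\<^sub>R x i) = 0" "i < ?M" for \<alpha> i by (rule indep[OF that])
      qed (rule that)
      define f where "f = (\<Sum>i<?M. \<alpha> i *\<^sub>R x i)"
      have f: "f \<in> D" unfolding f_def by (rule S.comb_in[OF x(1)])
      have fe: "schur l f (e j) = 0" if j: "j < 2 * n" for j
      proof -
        have "schur l f (e j) = (\<Sum>i<?M. \<alpha> i * schur l (x i) (e j))" unfolding f_def by (rule S.comb_left[OF x(1) e(2)[OF j]])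
        also have "\<dots> = (\<Sum>i<?M. \<alpha> i * b i j)" using j by (simp add: b_def)
        also have "\<dots> = 0" using j by (intro \<alpha>(2)) simp
        finally show ?thesis .
      qed
      have fg: "inner (lift l f) (g j) = 0" if j: "j < 2 * d" for j
      proof -
        have ls: "lift l (\<Sum>i<?M. \<alpha> i *\<^sub>R x i) = (\<Sum>i<?M. \<alpha> i *\<^sub>R lift l (x i))"
          by (rule lift_sum[OF l]) (rule x(1))
        have "inner (lift l f) (g j) = (\<Sum>i<?M. \<alpha> i * inner (lift l (x i)) (g j))"
          unfolding f_def ls by (simp only: inner_sum_left inner_scaleR_left)
        also have "\<dots> = (\<Sum>i<?M. \<alpha> i * b i (2 * n + j))" by (simp add: b_def)
        also have "\<dots> = 0" using j by (intro \<alpha>(2)) simp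
        finally show ?thesis .
      qed
      have fk: "inner (lift l f) k = 0" if k: "k \<in> ?K" for k
      proof -
        obtain \<beta> where "k = (\<Sum>j<2*d. \<beta> j *\<^sub>R g j)" using k unfolding g(1) span_family by (rule exE)
        then show ?thesis using fg by (simp add: inner_sum_right)
      qed
      have co: "(norm (lift l f))\<^sup>2 \<le> C * schur l f f" by (rule C(2)[OF f fe fk])
      then have S0: "0 \<le> schur l f f" using C(1) by (smt (verit) zero_le_power2 mult_less_0_iff zero_le_mult_iff)
      have "(c - l) * (norm (lift l f))\<^sup>2 \<le> (c - l) * (C * schur l f f)" using co lc by (intro mult_left_mono) auto
      also have "\<dots> = ((c - l) * C) * schur l f f" by simp
      also have "\<dots> \<le> 1 * schur l f f" using lc C(1) S0 by (intro mult_right_mono) (auto simp: field_simps)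
      finally have "0 \<le> schur c f f" using schur_shift_ge[OF l c f] by simp
      moreover have "schur c f f < 0" unfolding f_def x(3) using sum_squares_pos[OF \<alpha>(1)] by simp
      ultimately show False by simp
    qed
  qed (use C(1) in simp)
qed

end

section \<open>The minimax levels\<close>

context gap
begin

lemma schur_tendsto:
  assumes c: "a < c" and X: "X \<longlonglongrightarrow> x" "(\<lambda>n. A (X n)) \<longlonglongrightarrow> A x" and Z: "Z \<longlonglongrightarrow> z" "(\<lambda>n. A (Z n)) \<longlonglongrightarrow> A z"
  shows "(\<lambda>n. schur c (X n) (Z n)) \<longlonglongrightarrow> schur c x z"
proof -
  have "(\<lambda>n. dual c (A (X n) - c *\<^sub>R X n)) \<longlonglongrightarrow> dual c (A x - c *\<^sub>R x)"
    by (rule bounded_linear.tendsto[OF bounded_linear_dual[OF c]]) (intro tendsto_intros X)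
  then show ?thesis unfolding schur_def lift_def by (intro tendsto_intros X Z)
qed

text \<open>Negative definiteness on a finite family is an open condition and \<open>schur c\<close> is continuous in the
  graph norm, so vectors of a core suffice.\<close>

lemma neg_index_core:
  assumes c: "a < c" and P: "neg_index k c"
    and F: "subspace F" "\<And>x. x \<in> F \<Longrightarrow> J x \<in> F" "F \<subseteq> D"
    and core: "\<And>x r. x \<in> D \<Longrightarrow> 0 < r \<Longrightarrow> \<exists>y\<in>F. norm (x - y) + norm (A x - A y) < r"
  obtains f where "jfam J k f" "\<And>i. i < 2 * k \<Longrightarrow> f i \<in> F"
    "\<And>\<alpha>. \<exists>i<2*k. \<alpha> i \<noteq> 0 \<Longrightarrow> schur c (\<Sum>i<2*k. \<alpha> i *\<^sub>R f i) (\<Sum>i<2*k. \<alpha> i *\<^sub>R f i) < 0"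
proof -
  interpret S: sym_form D "schur c" by (rule schur_form[OF c])
  obtain e where e: "jfam J k e" "\<And>i. i < 2 * k \<Longrightarrow> e i \<in> D" "onfam (\<lambda>f g. - schur c f g) (2 * k) e"
    using P unfolding neg_index_def by blast
  have "\<exists>X. (\<forall>n. X n \<in> F) \<and> X \<longlonglongrightarrow> x \<and> (\<lambda>n. A (X n)) \<longlonglongrightarrow> A x" if x: "x \<in> D" for x
  proof -
    have "\<exists>y\<in>F. norm (x - y) + norm (A x - A y) < 1 / real (Suc n)" for n using core[OF x] by simp
    then obtain X where X: "\<And>n. X n \<in> F" "\<And>n. norm (x - X n) + norm (A x - A (X n)) < 1 / real (Suc n)" by metis
    have lim0: "(\<lambda>n. 1 / real (Suc n)) \<longlonglongrightarrow> 0" using LIMSEQ_inverse_real_of_nat by (simp add: inverse_eq_divide)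
    have le: "norm (X n - x) \<le> 1 / real (Suc n)" "norm (A (X n) - A x) \<le> 1 / real (Suc n)" for n
      using X(2)[of n] norm_ge_zero[of "x - X n"] norm_ge_zero[of "A x - A (X n)"]
      by (simp_all only: norm_minus_commute)
    have "X \<longlonglongrightarrow> x"
      by (rule LIM_zero_cancel, rule Lim_null_comparison[OF _ lim0]) (use le in simp)
    moreover have "(\<lambda>n. A (X n)) \<longlonglongrightarrow> A x"
      by (rule LIM_zero_cancel, rule Lim_null_comparison[OF _ lim0]) (use le in simp)
    ultimately show ?thesis using X(1) by blast
  qed
  then obtain app where app: "\<And>x n. x \<in> D \<Longrightarrow> app x n \<in> F" "\<And>x. x \<in> D \<Longrightarrow> app x \<longlonglongrightarrow> x"
    "\<And>x. x \<in> D \<Longrightarrow> (\<lambda>n. A (app x n)) \<longlonglongrightarrow> A x" by metis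
  \<comment> \<open>Only even members are approximated; odd ones are their images under
    \<open>J\<close>, which keeps the perturbed family a \<open>jfam\<close>. Graph convergence
    persists because \<open>A\<close> commutes with \<open>J\<close>.\<close>
  define f where "f n i = (if even i then app (e i) n else J (app (e (i - 1)) n))" for n i
  have blJ: "bounded_linear J"
  proof (rule bounded_linear_intro[where K = 1])
    show "norm (J x) \<le> norm x * 1" for x using JH.b_J[of x x] by (simp add: norm_eq_sqrt_inner)
  qed (auto simp: linear_add[OF JH.linJ] linear_scale[OF JH.linJ])
  have f: "f n i \<in> F" "(\<lambda>n. f n i) \<longlonglongrightarrow> e i" "(\<lambda>n. A (f n i)) \<longlonglongrightarrow> A (e i)" if i: "i < 2 * k" for n i
  proof -
    have "f n i \<in> F \<and> (\<lambda>n. f n i) \<longlonglongrightarrow> e i \<and> (\<lambda>n. A (f n i)) \<longlonglongrightarrow> A (e i)"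
    proof (cases "even i")
      case True
      then show ?thesis using app e(2)[OF i] by (simp add: f_def)
    next
      case False
      then obtain j where j: "i = 2 * j + 1" by (elim oddE)
      then have eD: "e (2 * j) \<in> D" and ei: "e i = J (e (2 * j))" using e(1,2) i by (auto simp: jfam_def)
      have fi: "f n i = J (app (e (2 * j)) n)" for n using j by (simp add: f_def)
      have appD: "app (e (2 * j)) n \<in> D" for n using app(1)[OF eD] F(3) by blast
      have Afi: "A (f n i) = J (A (app (e (2 * j)) n))" for n unfolding fi by (rule A_J[OF appD])
      have Aei: "A (e i) = J (A (e (2 * j)))" unfolding ei by (rule A_J[OF eD])
      have "f n i \<in> F" unfolding fi by (rule F(2)[OF app(1)[OF eD]])
      moreover have "(\<lambda>n. f n i) \<longlonglongrightarrow> e i" unfolding fi ei by (rule bounded_linear.tendsto[OF blJ app(2)[OF eD]])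
      moreover have "(\<lambda>n. A (f n i)) \<longlonglongrightarrow> A (e i)" unfolding Afi Aei by (rule bounded_linear.tendsto[OF blJ app(3)[OF eD]])
      ultimately show ?thesis by blast
    qed
    then show "f n i \<in> F" "(\<lambda>n. f n i) \<longlonglongrightarrow> e i" "(\<lambda>n. A (f n i)) \<longlonglongrightarrow> A (e i)" by blast+
  qed
  \<comment> \<open>Entrywise errors below \<eta> in a matrix of size \<open>2 * k\<close> change
    its quadratic form by at most \<open>\<eta> * (2 * real k)\<close> times the sum of
    squares.\<close>
  define \<eta> where "\<eta> = 1 / (2 * real k + 1)"
  have \<eta>: "0 < \<eta>" "\<eta> * (2 * real k) < 1" by (simp_all add: \<eta>_def field_simps)
  have "\<forall>\<^sub>F n in sequentially. \<forall>i\<in>{..<2*k}. \<forall>j\<in>{..<2*k}. dist (schur c (f n i) (f n j)) (schur c (e i) (e j)) < \<eta>"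
  proof (intro eventually_ball_finite ballI)
    fix i j assume ij: "i \<in> {..<2*k}" "j \<in> {..<2*k}"
    have "(\<lambda>n. schur c (f n i) (f n j)) \<longlonglongrightarrow> schur c (e i) (e j)"
      using f ij by (intro schur_tendsto[OF c]) auto
    then show "\<forall>\<^sub>F n in sequentially. dist (schur c (f n i) (f n j)) (schur c (e i) (e j)) < \<eta>"
      using \<eta>(1) by (rule tendstoD)
  qed simp_all
  then obtain n where n: "\<And>i j. i < 2 * k \<Longrightarrow> j < 2 * k \<Longrightarrow> \<bar>schur c (f n i) (f n j) - schur c (e i) (e j)\<bar> < \<eta>"
    unfolding eventually_sequentially by (force simp: dist_real_def)
  show ?thesis
  proof (rule that[of "f n"])
    show "jfam J k (f n)" by (auto simp: jfam_def f_def)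
    show "f n i \<in> F" if "i < 2 * k" for i by (rule f(1)[OF that])
    fix \<alpha> :: "nat \<Rightarrow> real" assume nz: "\<exists>i<2*k. \<alpha> i \<noteq> 0"
    let ?x = "\<Sum>i<2*k. \<alpha> i *\<^sub>R f n i" and ?s = "\<Sum>i<2*k. (\<alpha> i)\<^sup>2"
    have fD: "i < 2 * k \<Longrightarrow> f n i \<in> D" for i using f(1) F(3) by blast
    have xD: "?x \<in> D" by (rule S.comb_in[OF fD])
    have s: "0 < ?s" by (rule sum_squares_pos[OF nz])
    have "schur c ?x ?x = (\<Sum>i<2*k. \<alpha> i * schur c (f n i) ?x)" by (rule S.comb_left[OF fD xD])
    also have "\<dots> = (\<Sum>i<2*k. \<alpha> i * (\<Sum>j<2*k. \<alpha> j * schur c (f n i) (f n j)))"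
    proof (rule sum.cong[OF refl])
      fix i assume "i \<in> {..<2*k}"
      then have i: "f n i \<in> D" using fD by simp
      have "schur c ?x (f n i) = (\<Sum>j<2*k. \<alpha> j * schur c (f n j) (f n i))" by (rule S.comb_left[OF fD i])
      also have "\<dots> = (\<Sum>j<2*k. \<alpha> j * schur c (f n i) (f n j))" using S.sym[OF i fD] by (intro sum.cong) auto
      finally show "\<alpha> i * schur c (f n i) ?x = \<alpha> i * (\<Sum>j<2*k. \<alpha> j * schur c (f n i) (f n j))"
        using S.sym[OF i xD] by simp
    qed
    also have "\<dots> = (\<Sum>i<2*k. \<Sum>j<2*k. \<alpha> i * \<alpha> j * schur c (f n i) (f n j))" by (simp add: sum_distrib_left mult.assoc)
    also have "\<dots> \<le> (\<Sum>i<2*k. \<Sum>j<2*k. (if i = j then - (\<alpha> i)\<^sup>2 else 0) + \<eta> * (\<bar>\<alpha> i\<bar> * \<bar>\<alpha> j\<bar>))"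
    proof (intro sum_mono)
      fix i j assume ij: "i \<in> {..<2*k}" "j \<in> {..<2*k}"
      let ?d = "schur c (f n i) (f n j) - schur c (e i) (e j)"
      have "- schur c (e i) (e j) = (if i = j then 1 else 0)" using onfamD[OF e(3)] ij by simp
      then have se: "schur c (e i) (e j) = (if i = j then -1 else 0)" by (simp split: if_splits)
      have "\<alpha> i * \<alpha> j * ?d \<le> \<bar>\<alpha> i * \<alpha> j\<bar> * \<bar>?d\<bar>" by (metis abs_ge_self abs_mult)
      also have "\<dots> \<le> \<bar>\<alpha> i * \<alpha> j\<bar> * \<eta>" using n[of i j] ij by (intro mult_left_mono) auto
      finally have "\<alpha> i * \<alpha> j * schur c (f n i) (f n j) \<le> \<alpha> i * \<alpha> j * schur c (e i) (e j) + \<eta> * (\<bar>\<alpha> i\<bar> * \<bar>\<alpha> j\<bar>)"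
        by (simp add: right_diff_distrib abs_mult mult_ac)
      then show "\<alpha> i * \<alpha> j * schur c (f n i) (f n j) \<le> (if i = j then - (\<alpha> i)\<^sup>2 else 0) + \<eta> * (\<bar>\<alpha> i\<bar> * \<bar>\<alpha> j\<bar>)"
        unfolding se by (simp add: power2_eq_square split: if_splits)
    qed
    also have "\<dots> = - ?s + \<eta> * (\<Sum>i<2*k. \<Sum>j<2*k. \<bar>\<alpha> i\<bar> * \<bar>\<alpha> j\<bar>)"
      by (simp add: sum.distrib sum_distrib_left sum_negf sum_subtractf)
    also have "(\<Sum>i<2*k. \<Sum>j<2*k. \<bar>\<alpha> i\<bar> * \<bar>\<alpha> j\<bar>) = (\<Sum>i<2*k. 1 * \<bar>\<alpha> i\<bar>)\<^sup>2"
      by (simp add: power2_eq_square sum_product)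
    also have "\<eta> * (\<Sum>i<2*k. 1 * \<bar>\<alpha> i\<bar>)\<^sup>2 \<le> \<eta> * ((\<Sum>i<2*k. 1\<^sup>2) * (\<Sum>i<2*k. \<bar>\<alpha> i\<bar>\<^sup>2))"
      using \<eta>(1) by (intro mult_left_mono Cauchy_Schwarz_ineq_sum) simp
    also have "\<dots> = \<eta> * (2 * real k) * ?s" by simp
    also have "- ?s + \<eta> * (2 * real k) * ?s < 0" using mult_strict_right_mono[OF \<eta>(2) s] by simp
    finally show "schur c ?x ?x < 0" by simp
  qed
qed

end

text \<open>\<open>dim\<close> takes the value \<open>0\<close> on spaces without a finite basis, so
  a nonzero value certifies finite dimension.\<close>

lemma fin_dim_if_dim: "dim V \<noteq> 0 \<Longrightarrow> fin_dim V"
proof -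
  assume d: "dim V \<noteq> 0"
  obtain B where B: "V \<subseteq> span B" "card B = dim V" by (rule basis_exists)
  then have "finite B" using d by (metis card.infinite)
  then show ?thesis using B unfolding fin_dim_def by blast
qed

locale decomposition = abs_sqrt D A DS S
  for D :: "'a::{real_inner, complete_space} set" and A DS S +
  fixes J Pp Pm :: "'a \<Rightarrow> 'a" and Hp Hm F :: "'a set"
  assumes J: "complex_structure J"
    and clin: "J ` D \<subseteq> D" "\<forall>x\<in>D. A (J x) = J (A x)"
    and Hp: "subspace Hp" "J ` Hp \<subseteq> Hp"
    and Hm: "subspace Hm" "J ` Hm \<subseteq> Hm"
    and orth: "\<forall>u\<in>Hp. \<forall>v\<in>Hm. inner u v = 0"
    and proj: "\<forall>x. Pp x \<in> Hp \<and> Pm x \<in> Hm \<and> Pp x + Pm x = x"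
    and core: "subspace F" "J ` F \<subseteq> F" "F \<subseteq> D"
      "\<forall>x\<in>D. \<forall>e>0. \<exists>y\<in>F. norm (x - y) + norm (A x - A y) < e"
    and i: "Pp ` F \<subseteq> DS" "Pm ` F \<subseteq> DS"
begin

lemma linJ: "linear J" and JJ: "J (J x) = - x"
  using J by (auto simp: complex_structure_def)

lemma decomp_unique:
  assumes "u \<in> Hp" "v \<in> Hm" "u + v = x" shows "Pp x = u" "Pm x = v"
proof -
  have x: "Pp x \<in> Hp" "Pm x \<in> Hm" "Pp x + Pm x = x" using proj by auto
  have d: "Pp x - u = v - Pm x" using x(3) assms(3) by (simp add: algebra_simps)
  have "Pp x - u \<in> Hp" using x assms Hp by (simp add: subspace_diff)
  moreover have "Pp x - u \<in> Hm" unfolding d using x assms Hm by (simp add: subspace_diff)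
  ultimately have "inner (Pp x - u) (Pp x - u) = 0" using orth by blast
  then show "Pp x = u" by simp
  then show "Pm x = v" using d by simp
qed

lemma P_in: "Pp x \<in> Hp" "Pm x \<in> Hm" and P_sum: "Pp x + Pm x = x"
  using proj by auto

lemma P_add: "Pp (x + y) = Pp x + Pp y" "Pm (x + y) = Pm x + Pm y"
proof -
  have "(Pp x + Pp y) + (Pm x + Pm y) = x + y" using P_sum[of x] P_sum[of y] by (metis add.assoc add.left_commute)
  then show "Pp (x + y) = Pp x + Pp y" "Pm (x + y) = Pm x + Pm y"
    using decomp_unique[of "Pp x + Pp y" "Pm x + Pm y" "x + y"] P_in Hp Hm by (auto simp: subspace_add)
qed

lemma P_scale: "Pp (r *\<^sub>R x) = r *\<^sub>R Pp x" "Pm (r *\<^sub>R x) = r *\<^sub>R Pm x"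
proof -
  have "r *\<^sub>R Pp x + r *\<^sub>R Pm x = r *\<^sub>R x" using P_sum[of x] by (metis scaleR_add_right)
  then show "Pp (r *\<^sub>R x) = r *\<^sub>R Pp x" "Pm (r *\<^sub>R x) = r *\<^sub>R Pm x"
    using decomp_unique[of "r *\<^sub>R Pp x" "r *\<^sub>R Pm x" "r *\<^sub>R x"] P_in Hp Hm by (auto simp: subspace_scale)
qed

lemma P_J: "Pp (J x) = J (Pp x)" "Pm (J x) = J (Pm x)"
proof -
  have "J (Pp x) + J (Pm x) = J x" using P_sum[of x] linear_add[OF linJ] by metis
  moreover have "J (Pp x) \<in> Hp" "J (Pm x) \<in> Hm" using P_in Hp(2) Hm(2) by blast+
  ultimately show "Pp (J x) = J (Pp x)" "Pm (J x) = J (Pm x)"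
    using decomp_unique[of "J (Pp x)" "J (Pm x)" "J x"] by auto
qed

lemma linear_P: "linear Pp" "linear Pm"
  by (auto intro!: linearI simp: P_add P_scale)

lemma P_P: "Pp (Pp x) = Pp x" "Pp (Pm x) = 0"
  using decomp_unique[of "Pp x" 0 "Pp x"] decomp_unique[of 0 "Pm x" "Pm x"] P_in Hp Hm
  by (auto simp: subspace_0)

lemma norm_P: "(norm x)\<^sup>2 = (norm (Pp x))\<^sup>2 + (norm (Pm x))\<^sup>2"
proof -
  have a: "inner (Pp x) (Pm x) = 0" using orth P_in by blast
  then have "inner (Pm x) (Pp x) = 0" by (subst inner_commute)
  with a have "inner (Pp x + Pm x) (Pp x + Pm x) = inner (Pp x) (Pp x) + inner (Pm x) (Pm x)"
    by (simp add: inner_add_left inner_add_right)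
  then show ?thesis by (simp add: P_sum power2_norm_eq_inner)
qed

interpretation Q: sym_form DS "form_bilin D A" by (rule sym_form_bilin)

sublocale gap_setting D A J "Pm ` F" "form_bilin D A"
proof
  show "complex_structure J" by (rule J)
  show "J x \<in> D" if "x \<in> D" for x using clin(1) that by blast
  show "A (J x) = J (A x)" if "x \<in> D" for x using clin(2) that by blast
  show "subspace (Pm ` F)" by (rule linear_subspace_image[OF linear_P(2) core(1)])
  have YD: "y \<in> DS" if "y \<in> Pm ` F" for y using i(2) that by blast
  show "form_bilin D A (x + y) z = form_bilin D A x z + form_bilin D A y z" if "x \<in> Pm ` F" "y \<in> Pm ` F" "z \<in> Pm ` F" for x y z
    using that YD by (intro Q.add_left)
  show "form_bilin D A (r *\<^sub>R x) z = r * form_bilin D A x z" if "x \<in> Pm ` F" "z \<in> Pm ` F" for r x z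
    using that YD by (intro Q.scale_left)
  show "form_bilin D A x y = form_bilin D A y x" if "x \<in> Pm ` F" "y \<in> Pm ` F" for x y
    using that YD by (intro Q.sym)
  show "J y \<in> Pm ` F" if "y \<in> Pm ` F" for y using that core(2) P_J by (metis image_iff image_subset_iff)
  show "form_bilin D A (J y) (J y) = form_bilin D A y y" if "y \<in> Pm ` F" for y
    using complex_structure_form[OF J clin(1) _ YD[OF that]] clin(2) YD[OF that] by (simp add: form_bilin_diag)
qed

text \<open>For \<open>f\<close> in the operator domain the mixed term of the form is
  \<open>inner (A f) y\<close>. This identity connects the closed form with
  \<open>energy\<close>.\<close>

lemma form_val_energy:
  assumes f: "f \<in> D" and y: "y \<in> Pm ` F"
  shows "form_val D A (f + y) - c * (norm (f + y))\<^sup>2 = energy c f y"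
proof -
  have fDS: "f \<in> DS" and yDS: "y \<in> DS" using D_subset f i(2) y by auto
  have "form_val D A (f + y) = form_bilin D A f f + 2 * form_bilin D A f y + form_bilin D A y y"
    using Q.quad_add[OF fDS yDS] form_bilin_diag[OF Q.V_add[OF fDS yDS]] by simp
  then have "form_val D A (f + y) = inner (A f) f + 2 * inner (A f) y + form_bilin D A y y"
    using form_bilin_op[OF f fDS] form_bilin_op[OF f yDS] by simp
  then show ?thesis
    by (simp add: energy_def power2_norm_eq_inner inner_diff_left inner_add_left inner_add_right inner_commute algebra_simps)
qed

lemma rayleigh_le_iff: "x \<noteq> 0 \<Longrightarrow> rayleigh D A x \<le> ereal c \<longleftrightarrow> form_val D A x \<le> c * (norm x)\<^sup>2"
  by (simp add: rayleigh_def pos_divide_le_eq)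

text \<open>Basis vectors of \<open>V\<close> are lifted to \<open>F\<close> through
  \<open>Pp\<close>. Rayleigh quotients on \<open>V + F\<^sub>-\<close> stay below some
  \<open>c1 < c\<close>, so the energy is at most \<open>- (c - c1)\<close> times the squared norm
  of the positive part, a bound that does not involve the competitor \<open>y\<close> and so
  survives the supremum.\<close>

lemma lambda_plus_less_imp:
  assumes gap: "gap D A J (Pm ` F) (form_bilin D A) a" and c: "a < c" and k: "1 \<le> k"
    and less: "lambda_plus D A J (Pp ` F) (Pm ` F) k < ereal c"
  shows "neg_index k c"
proof -
  interpret gap D A J "Pm ` F" "form_bilin D A" a by (rule gap)
  obtain V where V: "V \<in> csubspaces_dim J (Pp ` F) k" "(SUP x \<in> dsum V (Pm ` F) - {0}. rayleigh D A x) < ereal c"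
    using less unfolding lambda_plus_def INF_less_iff by blast
  obtain z where z: "(SUP x \<in> dsum V (Pm ` F) - {0}. rayleigh D A x) < z" "z < ereal c" using dense_order_class.dense[OF V(2)] by blast
  then obtain c1 where c1: "z = ereal c1" by (cases z) auto
  have cc1: "c1 < c" using z c1 by simp
  have ray: "form_val D A x \<le> c1 * (norm x)\<^sup>2" if "x \<in> dsum V (Pm ` F)" "x \<noteq> 0" for x
  proof -
    have "rayleigh D A x \<le> (SUP x \<in> dsum V (Pm ` F) - {0}. rayleigh D A x)" using that by (intro SUP_upper) simp
    then have "rayleigh D A x \<le> ereal c1" using z(1) c1 by simp
    then show ?thesis using rayleigh_le_iff[OF that(2)] by simp
  qed
  have Vp: "V \<subseteq> Pp ` F" "subspace V" "J ` V \<subseteq> V" "dim V = 2 * k" using V(1) by (auto simp: csubspaces_dim_def)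
  have JV: "J x \<in> V" if "x \<in> V" for x using Vp(3) that by blast
  \<comment> \<open>\<open>1 \<le> k\<close> matters here: \<open>dim V = 0\<close> would not
    exclude an infinite-dimensional \<open>V\<close>.\<close>
  have finV: "fin_dim V" by (rule fin_dim_if_dim) (use Vp(4) k in simp)
  obtain k' v where v': "onfam inner (2 * k') v" "jfam J k' v" "\<And>i. i < 2 * k' \<Longrightarrow> v i \<in> V" "dim V = 2 * k'"
    by (rule JH.gram_schmidt_fin[OF Vp(2) subset_UNIV JV _ finV]) (auto intro: that)
  then have kk: "k' = k" using Vp(4) by simp
  note v = v'[unfolded kk]
  define h where "h = inv_into F Pp"
  have h: "h x \<in> F" "Pp (h x) = x" if "x \<in> V" for x
    using that Vp(1) inv_into_into[of x Pp F] f_inv_into_f[of x Pp F] by (auto simp: h_def)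
  \<comment> \<open>Preimages are chosen at even positions and transported by \<open>J\<close>, so
    that the lifted family is again a \<open>jfam\<close>.\<close>
  define f where "f i = (if even i then h (v i) else J (h (v (i - 1))))" for i
  have f: "f i \<in> F \<and> Pp (f i) = v i" if i: "i < 2 * k" for i
  proof (cases "even i")
    case True
    then show ?thesis using h v(3)[OF i] by (simp add: f_def)
  next
    case False
    then obtain j where j: "i = 2 * j + 1" by (elim oddE)
    then have "v (2 * j) \<in> V" "v i = J (v (2 * j))" using v(2,3) i by (auto simp: jfam_def)
    then show ?thesis using h[of "v (2 * j)"] core(2) j by (auto simp: f_def P_J)
  qed
  have fD: "i < 2 * k \<Longrightarrow> f i \<in> D" for i using f core(3) by blast
  show ?thesis
  proof (rule neg_indexI[OF c _ fD])
    show "jfam J k f" by (simp add: jfam_def f_def)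
    fix \<alpha> :: "nat \<Rightarrow> real" assume nz: "\<exists>i<2*k. \<alpha> i \<noteq> 0"
    let ?x = "\<Sum>i<2*k. \<alpha> i *\<^sub>R f i"
    have xF: "?x \<in> F" using f core(1) by (intro subspace_sum subspace_scale) auto
    then have xD: "?x \<in> D" using core(3) by blast
    have "Pp ?x = (\<Sum>i<2*k. \<alpha> i *\<^sub>R Pp (f i))" by (simp add: linear_sum[OF linear_P(1)] P_scale)
    also have "\<dots> = (\<Sum>i<2*k. \<alpha> i *\<^sub>R v i)" using f by (intro sum.cong) auto
    finally have Px: "Pp ?x = (\<Sum>i<2*k. \<alpha> i *\<^sub>R v i)" .
    have PxV: "Pp ?x \<in> V" unfolding Px using v(3) Vp(2) by (intro subspace_sum subspace_scale) auto
    have "inner (Pp ?x) (Pp ?x) = (\<Sum>i<2*k. (\<alpha> i)\<^sup>2)" unfolding Px by (rule JH.quad_onfam[OF v(1)]) simp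
    then have Pxn: "0 < (norm (Pp ?x))\<^sup>2" using sum_squares_pos[OF nz] by (simp add: power2_norm_eq_inner)
    obtain X where X: "\<And>n. X n \<in> Pm ` F" "(\<lambda>n. energy c ?x (X n)) \<longlonglongrightarrow> schur c ?x ?x"
      by (rule energy_approx[OF c xD]) (rule that)
    have "energy c ?x (X n) \<le> - ((c - c1) * (norm (Pp ?x))\<^sup>2)" for n
    proof -
      let ?z = "?x + X n"
      have "Pp (X n) = 0" using X(1)[of n] P_P by auto
      then have Pz: "Pp ?z = Pp ?x" by (simp add: P_add)
      have "?z = Pp ?x + (Pm ?x + X n)" unfolding add.assoc[symmetric] P_sum ..
      moreover have "Pm ?x + X n \<in> Pm ` F" using xF X(1) by (intro q.V_add) auto
      ultimately have zd: "?z \<in> dsum V (Pm ` F)" unfolding dsum_def using PxV by blast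
      have z0: "?z \<noteq> 0"
      proof
        assume "?z = 0"
        then have "Pp ?x = 0" using Pz linear_0[OF linear_P(1)] by simp
        then show False using Pxn by simp
      qed
      have "energy c ?x (X n) = form_val D A ?z - c * (norm ?z)\<^sup>2" by (rule form_val_energy[OF xD X(1), symmetric])
      also have "\<dots> \<le> - ((c - c1) * (norm ?z)\<^sup>2)" using ray[OF zd z0] by (simp add: algebra_simps)
      also have "\<dots> \<le> - ((c - c1) * (norm (Pp ?x))\<^sup>2)"
        using norm_P[of ?z] cc1 by (simp add: Pz mult_left_mono)
      finally show ?thesis .
    qed
    then have "schur c ?x ?x \<le> - ((c - c1) * (norm (Pp ?x))\<^sup>2)" by (intro LIMSEQ_le_const2[OF X(2)]) auto
    also have "\<dots> < 0" using cc1 Pxn by simp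
    finally show "schur c ?x ?x < 0" .
  qed
qed

text \<open>Lowering the level to \<open>c'\<close> first leaves room for strictness, as the
  supremum is only bounded by \<open>c'\<close>. The trial space is the projection under
  \<open>Pp\<close> of a negative family taken from the core.\<close>

lemma lambda_plus_less_if:
  assumes gap: "gap D A J (Pm ` F) (form_bilin D A) a" and c: "a < c"
    and P: "neg_index k c"
  shows "lambda_plus D A J (Pp ` F) (Pm ` F) k < ereal c"
proof -
  interpret gap D A J "Pm ` F" "form_bilin D A" a by (rule gap)
  obtain c' where c': "a < c'" "c' < c" "neg_index k c'" by (rule neg_index_left_cont[OF c P]) (rule that)
  have JF: "\<And>x. x \<in> F \<Longrightarrow> J x \<in> F" using core(2) by blast
  have core': "\<exists>y\<in>F. norm (x - y) + norm (A x - A y) < r" if "x \<in> D" "0 < r" for x r using core(4) that by blast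
  obtain f where f: "jfam J k f" "\<And>i. i < 2 * k \<Longrightarrow> f i \<in> F"
    "\<And>\<alpha>. \<exists>i<2*k. \<alpha> i \<noteq> 0 \<Longrightarrow> schur c' (\<Sum>i<2*k. \<alpha> i *\<^sub>R f i) (\<Sum>i<2*k. \<alpha> i *\<^sub>R f i) < 0"
    by (rule neg_index_core[OF c'(1,3) core(1) JF core(3) core']) (assumption | rule that)+
  interpret S: sym_form D "schur c'" by (rule schur_form[OF c'(1)])
  have PpC: "Pp (\<Sum>i<2*k. \<alpha> i *\<^sub>R f i) = (\<Sum>i<2*k. \<alpha> i *\<^sub>R Pp (f i))" for \<alpha>
    by (simp add: linear_sum[OF linear_P(1)] P_scale)
  have combF: "(\<Sum>i<2*k. \<alpha> i *\<^sub>R f i) \<in> F" for \<alpha> using f(2) core(1) by (intro subspace_sum subspace_scale) auto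
  have combD: "(\<Sum>i<2*k. \<alpha> i *\<^sub>R f i) \<in> D" for \<alpha> using combF core(3) by blast
  define g where "g i = Pp (f i)" for i
  have indep: "\<alpha> i = 0" if z: "(\<Sum>i<2*k. \<alpha> i *\<^sub>R g i) = 0" and i: "i < 2 * k" for \<alpha> i
  proof (rule ccontr)
    assume "\<alpha> i \<noteq> 0"
    then have neg: "schur c' (\<Sum>i<2*k. \<alpha> i *\<^sub>R f i) (\<Sum>i<2*k. \<alpha> i *\<^sub>R f i) < 0" using i by (intro f(3)) blast
    let ?x = "\<Sum>i<2*k. \<alpha> i *\<^sub>R f i"
    \<comment> \<open>If \<open>Pp ?x = 0\<close>, then \<open>?x\<close> itself lies in
      \<open>F\<^sub>-\<close>, and the competitor \<open>- ?x\<close> has total vector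
      \<open>0\<close> and energy \<open>0\<close>, contrary to negativity of the supremum.\<close>
    have "Pp ?x = 0" unfolding PpC using z by (simp add: g_def)
    then have eqx: "Pm ?x = ?x" using P_sum[of ?x] by simp
    have "Pm ?x \<in> Pm ` F" by (rule imageI[OF combF])
    then have xY: "?x \<in> Pm ` F" unfolding eqx .
    have mY: "- ?x \<in> Pm ` F" using q.V_scale[OF xY, of "-1"] by simp
    have f0: "form_val D A 0 = 0" using form_bilin_diag[OF Q.V_zero] Q.zero_left[OF Q.V_zero] by simp
    have "energy c' ?x (- ?x) = 0" using form_val_energy[OF combD[of \<alpha>] mY, where c = c'] f0 by simp
    then show False using energy_le[OF c'(1) combD[of \<alpha>] mY] neg by simp
  qed
  let ?V = "span (g ` {..<2*k})"
  have jg: "jfam J k g" using f(1) by (simp add: jfam_def g_def P_J)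
  have V: "?V \<in> csubspaces_dim J (Pp ` F) k"
    unfolding csubspaces_dim_def
  proof (intro CollectI conjI)
    show "?V \<subseteq> Pp ` F"
    proof
      fix x assume "x \<in> ?V"
      then obtain \<alpha> where "x = (\<Sum>i<2*k. \<alpha> i *\<^sub>R g i)" unfolding span_family by (rule exE)
      then have "x = Pp (\<Sum>i<2*k. \<alpha> i *\<^sub>R f i)" unfolding PpC g_def .
      then show "x \<in> Pp ` F" using combF by blast
    qed
    show "J ` ?V \<subseteq> ?V" using JH.span_jfam_invariant[OF jg] by blast
    show "dim ?V = 2 * k" by (rule independent_family(4)) (rule indep)
  qed (rule subspace_span)
  have "(SUP x \<in> dsum ?V (Pm ` F) - {0}. rayleigh D A x) \<le> ereal c'"
  proof (rule SUP_least)
    fix x assume x: "x \<in> dsum ?V (Pm ` F) - {0}"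
    then obtain v y where vy: "v \<in> ?V" "y \<in> Pm ` F" "x = v + y" by (auto simp: dsum_def)
    obtain \<alpha> where v: "v = (\<Sum>i<2*k. \<alpha> i *\<^sub>R g i)" using vy(1) unfolding span_family by (rule exE)
    let ?f = "\<Sum>i<2*k. \<alpha> i *\<^sub>R f i"
    have vP: "v = Pp ?f" unfolding PpC v g_def ..
    \<comment> \<open>Absorbing \<open>Pm ?f\<close> into \<open>y\<close> rewrites
      \<open>Pp ?f + y\<close> as \<open>?f\<close> plus an element of
      \<open>F\<^sub>-\<close>.\<close>
    have y': "y - Pm ?f \<in> Pm ` F" using vy(2) combF by (intro q.V_diff) auto
    have xf: "x = ?f + (y - Pm ?f)" unfolding vy(3) vP using P_sum[of ?f] by (simp add: algebra_simps)
    have "schur c' ?f ?f \<le> 0"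
    proof (cases "\<exists>i<2*k. \<alpha> i \<noteq> 0")
      case True
      then show ?thesis using f(3)[of \<alpha>] by simp
    next
      case False
      then have "?f = 0" by (intro sum.neutral) auto
      then show ?thesis using S.zero_left[OF S.V_zero] by simp
    qed
    then have "energy c' ?f (y - Pm ?f) \<le> 0" using energy_le[OF c'(1) combD y'] by (rule order_trans[rotated])
    then have "form_val D A x \<le> c' * (norm x)\<^sup>2" unfolding form_val_energy[OF combD y', symmetric] xf[symmetric] by simp
    then show "rayleigh D A x \<le> ereal c'" using rayleigh_le_iff x by simp
  qed
  then have "lambda_plus D A J (Pp ` F) (Pm ` F) k \<le> ereal c'"
    unfolding lambda_plus_def using V by (meson INF_lower2)
  also have "\<dots> < ereal c" using c' by simp
  finally show ?thesis .
qed

lemma gap_if: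
  assumes "(SUP x \<in> Pm ` F - {0}. rayleigh D A x) < ereal a"
  shows "gap D A J (Pm ` F) (form_bilin D A) a"
proof
  fix y assume y: "y \<in> Pm ` F"
  show "form_bilin D A y y \<le> a * (norm y)\<^sup>2"
  proof (cases "y = 0")
    case True
    then show ?thesis using q.zero_left[OF q.V_zero] by simp
  next
    case False
    then have "rayleigh D A y \<le> (SUP x \<in> Pm ` F - {0}. rayleigh D A x)" using y by (intro SUP_upper) simp
    then have "rayleigh D A y \<le> ereal a" using assms by simp
    then show ?thesis using rayleigh_le_iff[OF False] form_bilin_diag[of y] y i(2) by auto
  qed
qed

end

section \<open>Counting eigenvalues\<close>

lemma ereal_real_between:
  assumes "x < ereal c" obtains a where "x < ereal a" "a < c"
proof -
  obtain z where z: "x < z" "z < ereal c" using dense_order_class.dense[OF assms] by blast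
  then show ?thesis using that by (cases z) auto
qed

lemma dim_zero_singleton: "dim {0::'a::real_vector} = 0"
  by (rule dim_unique[of "{}"]) (auto simp: independent_empty)

text \<open>\<open>am\<close> may be minus infinity and the estimates need a real bound strictly
  below the level, so each use picks a real \<open>a\<close> between the two.\<close>

locale gap_limit = gap_setting D A J Y q for D :: "'a::{real_inner, complete_space} set" and A J Y q +
  fixes am :: ereal
  assumes gap_above: "\<And>a. am < ereal a \<Longrightarrow> gap D A J Y q a"
begin

lemma gap_below:
  assumes "am < ereal l" obtains a where "am < ereal a" "a < l" "gap D A J Y q a"
  by (rule ereal_real_between[OF assms]) (rule that, assumption, assumption, rule gap_above)

lemma index_mono: assumes "am < ereal l" "l \<le> c" "neg_index k l" shows "neg_index k c"
proof -
  obtain a where "a < l" "gap D A J Y q a" by (rule gap_below[OF assms(1)]) (rule that)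
  then show ?thesis using gap.neg_index_mono assms(2,3) by blast
qed

lemma index_left_cont:
  assumes "am < ereal c" "neg_index k c" obtains c' where "am < ereal c'" "c' < c" "neg_index k c'"
proof -
  obtain a where a: "am < ereal a" "a < c" "gap D A J Y q a" by (rule gap_below[OF assms(1)]) (rule that)
  obtain c' where c': "a < c'" "c' < c" "neg_index k c'" by (rule gap.neg_index_left_cont[OF a(3,2) assms(2)]) (rule that)
  have "am < ereal c'" using a(1) c'(1) by (meson ereal_less_eq(3) less_imp_le less_le_trans)
  then show ?thesis using that c' by blast
qed

lemma index_spectrum:
  assumes "am < ereal l" "l < c" "neg_index n l" "l \<in> op_spectrum D A" shows "neg_index (Suc n) c"
proof -
  obtain a where "a < l" "gap D A J Y q a" by (rule gap_below[OF assms(1)]) (rule that)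
  then show ?thesis using gap.neg_index_spectrum assms(2-4) by blast
qed

lemma index_eigenspace:
  assumes "am < ereal l" "l < c" "neg_index n l"
    "jfam J d g" "\<And>i. i < 2 * d \<Longrightarrow> g i \<in> eigenspace_op D A l" "onfam inner (2 * d) g"
  shows "neg_index (n + d) c"
proof -
  obtain a where a: "a < l" "gap D A J Y q a" by (rule gap_below[OF assms(1)]) (rule that)
  show ?thesis by (rule gap.neg_index_eigenspace[OF a(2,1) assms(2-6)])
qed

lemma index_upper:
  assumes "am < ereal l" "l \<notin> ess_spectrum D A" "fin_dim (eigenspace_op D A l)" "\<not> neg_index (Suc m) l"
  obtains \<epsilon> where "0 < \<epsilon>" "\<And>c. l < c \<Longrightarrow> c < l + \<epsilon> \<Longrightarrow> \<not> neg_index (Suc (m + dim (eigenspace_op D A l) div 2)) c"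
proof -
  obtain a where a: "a < l" "gap D A J Y q a" by (rule gap_below[OF assms(1)]) (rule that)
  show ?thesis by (rule gap.neg_index_upper[OF a(2,1) assms(2-4)]) (rule that)
qed

text \<open>The level sweeps upward through \<open>T\<close>, and crossing each spectral point
  raises the index; the induction therefore takes off the largest point.\<close>

lemma index_spectrum_finite:
  assumes "finite T" shows "\<And>c. am < ereal c \<Longrightarrow> T \<subseteq> op_spectrum D A \<inter> {t. am < ereal t \<and> t < c} \<Longrightarrow> neg_index (card T) c"
  using assms
proof (induction T rule: finite_linorder_max_induct)
  case empty
  show ?case using neg_index_0 by simp
next
  case (insert b T)
  have b: "am < ereal b" "b < c" "b \<in> op_spectrum D A" using insert.prems by auto
  have "neg_index (card T) b" using insert.prems insert.hyps(2) by (intro insert.IH[OF b(1)]) auto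
  then have "neg_index (Suc (card T)) c" by (rule index_spectrum[OF b(1,2) _ b(3)])
  moreover have "b \<notin> T" using insert.hyps(2) by blast
  ultimately show ?case using insert.hyps(1) by simp
qed

text \<open>The same sweep counted with multiplicities, on top of an index \<open>p\<close> present
  at every level above \<open>am\<close>.\<close>

lemma index_eigenvalues:
  assumes "finite T" and base: "\<And>t. am < ereal t \<Longrightarrow> neg_index p t"
    and fin: "\<And>t. t \<in> T \<Longrightarrow> fin_dim (eigenspace_op D A t)"
  shows "\<And>c. am < ereal c \<Longrightarrow> T \<subseteq> {t. am < ereal t \<and> t < c} \<Longrightarrow> neg_index (p + (\<Sum>t\<in>T. dim (eigenspace_op D A t) div 2)) c"
  using assms(1) fin
proof (induction T rule: finite_linorder_max_induct)
  case empty
  then show ?case using base by simp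
next
  case (insert b T)
  let ?E = "eigenspace_op D A"
  have b: "am < ereal b" "b < c" using insert.prems by auto
  have IH: "neg_index (p + (\<Sum>t\<in>T. dim (?E t) div 2)) b"
    using insert.prems insert.hyps(2) by (intro insert.IH[OF b(1)]) auto
  obtain k g where g: "onfam inner (2 * k) g" "jfam J k g" "\<And>i. i < 2 * k \<Longrightarrow> g i \<in> ?E b" "dim (?E b) = 2 * k"
    by (rule JH.gram_schmidt_fin[OF eigenspace_subspace subset_UNIV eigenspace_J _ insert.prems(3)[OF insertI1]]) (auto intro: that)
  have "neg_index (p + (\<Sum>t\<in>T. dim (?E t) div 2) + k) c"
    by (rule index_eigenspace[OF b IH g(2,3,1)])
  moreover have "b \<notin> T" using insert.hyps(2) by blast
  ultimately show ?case using insert.hyps(1) g(4) by (simp add: ac_simps)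
qed

lemma infinite_spectrum_near_nonisolated:
  assumes l: "l \<in> op_spectrum D A" and iso: "\<And>e. 0 < e \<Longrightarrow> op_spectrum D A \<inter> ball l e \<noteq> {l}" and e: "0 < e"
  shows "infinite (op_spectrum D A \<inter> ball l e)"
proof
  assume fin: "finite (op_spectrum D A \<inter> ball l e)"
  let ?T = "op_spectrum D A \<inter> ball l e - {l}"
  have T: "finite ?T" using fin by simp
  define e' where "e' = Min (insert e ((\<lambda>t. dist l t) ` ?T))"
  have "0 < e'" unfolding e'_def using T e by (subst Min_gr_iff) auto
  moreover have "op_spectrum D A \<inter> ball l e' = {l}"
  proof (rule antisym)
    show "op_spectrum D A \<inter> ball l e' \<subseteq> {l}"
    proof
      fix t assume t: "t \<in> op_spectrum D A \<inter> ball l e'"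
      have "e' \<le> e" unfolding e'_def using T by (intro Min_le) auto
      show "t \<in> {l}"
      proof (rule ccontr)
        assume "t \<notin> {l}"
        then have "t \<in> ?T" using t \<open>e' \<le> e\<close> by auto
        then have "e' \<le> dist l t" unfolding e'_def using T by (intro Min_le) auto
        then show False using t by simp
      qed
    qed
    show "{l} \<subseteq> op_spectrum D A \<inter> ball l e'" using l \<open>0 < e'\<close> by simp
  qed
  ultimately show False using iso by blast
qed

text \<open>Infinite multiplicity gives arbitrarily long orthonormal families in one eigenspace.
  Otherwise \<open>l\<close> is not isolated, and infinitely many spectral points between
  \<open>am\<close> and \<open>c\<close> each raise the index.\<close>

lemma index_essential:
  assumes l: "am < ereal l" "l < c" and ess: "l \<in> ess_spectrum D A"
  shows "neg_index k c"
proof (cases "fin_dim (eigenspace_op D A l)")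
  case False
  obtain g where g: "onfam inner (2 * k) g" "jfam J k g" "\<And>i. i < 2 * k \<Longrightarrow> g i \<in> eigenspace_op D A l"
    by (rule JH.gram_schmidt_infin[OF eigenspace_subspace subset_UNIV eigenspace_J _ False]) (auto intro: that)
  have "neg_index (0 + k) c" by (rule index_eigenspace[OF l neg_index_0 g(2,3,1)])
  then show ?thesis by simp
next
  case True
  have ls: "l \<in> op_spectrum D A" using ess by (simp add: ess_spectrum_def)
  have iso: "op_spectrum D A \<inter> ball l e \<noteq> {l}" if "0 < e" for e
    using ess True ls that by (auto simp: ess_spectrum_def disc_spectrum_def)
  obtain a where a: "am < ereal a" "a < l" by (rule ereal_real_between[OF l(1)]) (rule that)
  \<comment> \<open>The ball of this radius around \<open>l\<close> stays above \<open>a\<close>,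
    hence above \<open>am\<close>, and below \<open>c\<close>.\<close>
  define e where "e = min (l - a) (c - l)"
  have e: "0 < e" using a l by (simp add: e_def)
  obtain T where T: "finite T" "card T = k" "T \<subseteq> op_spectrum D A \<inter> ball l e"
    using infinite_arbitrarily_large[OF infinite_spectrum_near_nonisolated[OF ls iso e]] by blast
  have "T \<subseteq> op_spectrum D A \<inter> {t. am < ereal t \<and> t < c}"
  proof
    fix t assume "t \<in> T"
    then have t: "t \<in> op_spectrum D A" "\<bar>l - t\<bar> < e" using T(3) by (auto simp: dist_real_def)
    then have "a < t" "t < c" by (auto simp: e_def)
    then show "t \<in> op_spectrum D A \<inter> {t. am < ereal t \<and> t < c}"
      using t(1) a(1) less_trans[of am "ereal a" "ereal t"] by simp
  qed
  moreover have "am < ereal c" using less_trans[of am "ereal l" "ereal c"] l by simp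
  ultimately show ?thesis using index_spectrum_finite[OF T(1)] T(2) by blast
qed

lemma eig_count_finite:
  assumes fin: "finite (op_spectrum D A \<inter> I)" and dims: "\<And>t. t \<in> I \<Longrightarrow> fin_dim (eigenspace_op D A t)"
  shows "eig_count D A I = enat (\<Sum>t\<in>op_spectrum D A \<inter> I. dim (eigenspace_op D A t) div 2)"
proof -
  let ?E = "eigenspace_op D A"
  have "span (\<Union>t\<in>I. ?E t) = span (\<Union>t\<in>op_spectrum D A \<inter> I. ?E t)"
  proof (rule antisym)
    have "(\<Union>t\<in>I. ?E t) \<subseteq> span (\<Union>t\<in>op_spectrum D A \<inter> I. ?E t)"
    proof
      fix x assume "x \<in> (\<Union>t\<in>I. ?E t)"
      then obtain t where t: "t \<in> I" "x \<in> ?E t" by blast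
      show "x \<in> span (\<Union>t\<in>op_spectrum D A \<inter> I. ?E t)"
      proof (cases "t \<in> op_spectrum D A")
        case True
        then show ?thesis using t by (intro span_base) blast
      next
        case False
        then show ?thesis using t(2) eigenspace_trivial[OF False] by (simp add: span_zero)
      qed
    qed
    then show "span (\<Union>t\<in>I. ?E t) \<subseteq> span (\<Union>t\<in>op_spectrum D A \<inter> I. ?E t)" by (rule span_minimal) (rule subspace_span)
    show "span (\<Union>t\<in>op_spectrum D A \<inter> I. ?E t) \<subseteq> span (\<Union>t\<in>I. ?E t)" by (rule span_mono) blast
  qed
  moreover have "fin_dim (span (\<Union>t\<in>op_spectrum D A \<inter> I. ?E t)) \<and>
    dim (span (\<Union>t\<in>op_spectrum D A \<inter> I. ?E t)) = 2 * (\<Sum>t\<in>op_spectrum D A \<inter> I. dim (?E t) div 2)"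
    by (rule eigenspaces_dim[OF J J_D A_J fin]) (use dims in auto)
  ultimately show ?thesis by (simp add: eig_count_def Let_def)
qed

text \<open>Until essential spectrum is met, the index at a level above \<open>am\<close> is
  \<open>k0 - 1\<close> plus the multiplicities passed so far. Evaluated at \<open>mu\<close> and
  slightly beyond, this gives \<open>k0 - 1 + N mu < k < k0 + N mu + d\<close> with \<open>d\<close>
  the multiplicity of \<open>mu\<close>, which is the rank condition for
  \<open>k - k0 + 1\<close>.\<close>

lemma kth_eigenvalue_or_bottom:
  fixes lp :: "nat \<Rightarrow> ereal"
  assumes lp: "\<And>k c. 1 \<le> k \<Longrightarrow> am < ereal c \<Longrightarrow> lp k < ereal c \<longleftrightarrow> neg_index k c"
    and ex: "\<exists>k\<ge>1. am < lp k"
  defines "k0 \<equiv> LEAST k. 1 \<le> k \<and> am < lp k"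
    and "bm \<equiv> INF mu \<in> ess_spectrum D A \<inter> {mu. am < ereal mu}. ereal mu"
  assumes k: "k0 \<le> k"
  shows "(\<exists>mu. lp k = ereal mu \<and> kth_eig_incr D A am bm (k - k0 + 1) mu) \<or> lp k = bm"
proof -
  let ?E = "eigenspace_op D A"
  have k0: "1 \<le> k0" "am < lp k0" using LeastI_ex[of "\<lambda>k. 1 \<le> k \<and> am < lp k"] ex unfolding k0_def by blast+
  have k1: "1 \<le> k" using k0 k by simp
  have lp_mono: "lp k0 \<le> lp k"
  proof (rule ccontr)
    assume "\<not> lp k0 \<le> lp k"
    then have "max am (lp k) < lp k0" using k0 by simp
    then obtain z where z: "max am (lp k) < z" "z < lp k0" using dense_order_class.dense by blast
    then obtain c where c: "z = ereal c" by (cases z) auto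
    have "neg_index k c" using lp[OF k1, of c] z c by simp
    then have "neg_index k0 c" by (rule neg_index_antimono[OF _ k])
    then have "lp k0 < ereal c" using lp[OF k0(1), of c] z c by simp
    then show False using z c by simp
  qed
  have am: "am < lp k" using k0(2) lp_mono by (rule less_le_trans)
  have le_bm: "lp k \<le> bm"
    unfolding bm_def
  proof (rule INF_greatest)
    fix mu assume mu: "mu \<in> ess_spectrum D A \<inter> {mu. am < ereal mu}"
    show "lp k \<le> ereal mu"
    proof (rule ccontr)
      assume "\<not> lp k \<le> ereal mu"
      then have "ereal mu < lp k" by simp
      then obtain z where z: "ereal mu < z" "z < lp k" using dense_order_class.dense by blast
      then obtain c where c: "z = ereal c" by (cases z) auto
      have "neg_index k c" by (rule index_essential[of mu]) (use mu z c in auto)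
      moreover have "am < ereal c" using mu z c by (metis IntD2 less_trans mem_Collect_eq)
      ultimately have "lp k < ereal c" using lp[OF k1] by simp
      then show False using z c by simp
    qed
  qed
  show ?thesis
  proof (cases "lp k = bm")
    case False
    then have lt: "lp k < bm" using le_bm by simp
    then obtain mu where mu: "lp k = ereal mu" using am by (cases "lp k") auto
    have am_mu: "am < ereal mu" using am mu by simp
    have noness: "t \<notin> ess_spectrum D A" if "am < ereal t" "t \<le> mu" for t
    proof
      assume "t \<in> ess_spectrum D A"
      then have "bm \<le> ereal t" unfolding bm_def using that by (intro INF_lower) simp
      then show False using lt mu that(2) by (metis ereal_less_eq(3) leD order_trans)
    qed
    have fin: "fin_dim (?E t)" if t: "am < ereal t" "t \<le> mu" for t
    proof (cases "t \<in> op_spectrum D A")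
      case True
      then show ?thesis using noness[OF t] by (simp add: ess_spectrum_def disc_spectrum_def)
    next
      case False
      then show ?thesis using eigenspace_trivial[OF False] unfolding fin_dim_def by (intro exI[of _ "{}"]) simp
    qed
    define I where "I c = op_spectrum D A \<inter> {t. am < ereal t \<and> t < c}" for c
    define N where "N c = (\<Sum>t\<in>I c. dim (?E t) div 2)" for c
    have not_mu: "\<not> neg_index k mu" using lp[OF k1 am_mu] mu by simp
    have finI_mu: "finite (I mu)"
    proof (rule ccontr)
      assume "infinite (I mu)"
      then obtain T where T: "finite T" "card T = k" "T \<subseteq> I mu" using infinite_arbitrarily_large by blast
      then have "neg_index k mu" using index_spectrum_finite[OF T(1) am_mu] unfolding I_def by simp
      then show False using not_mu by simp
    qed
    have I_mono: "c \<le> c' \<Longrightarrow> I c \<subseteq> I c'" for c c' by (auto simp: I_def)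
    have finI: "finite (I c)" if "c \<le> mu" for c using finite_subset[OF I_mono[OF that] finI_mu] .
    \<comment> \<open>By minimality of \<open>k0\<close> the preceding value
      \<open>lp (k0 - 1)\<close> does not exceed \<open>am\<close>; for \<open>k0 = 1\<close> there
      is nothing to count.\<close>
    have base: "neg_index (k0 - 1) t" if t: "am < ereal t" for t
    proof (cases "k0 = 1")
      case True
      then show ?thesis using neg_index_0 by simp
    next
      case False
      then have "1 \<le> k0 - 1" "k0 - 1 < k0" using k0 by auto
      moreover have "\<not> (1 \<le> k0 - 1 \<and> am < lp (k0 - 1))" using \<open>k0 - 1 < k0\<close> unfolding k0_def by (rule not_less_Least)
      ultimately have "lp (k0 - 1) \<le> am" by simp
      then have "lp (k0 - 1) < ereal t" using t by (rule le_less_trans)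
      then show ?thesis using lp[OF \<open>1 \<le> k0 - 1\<close> t] by simp
    qed
    have "neg_index (k0 - 1 + N mu) mu"
      unfolding N_def by (rule index_eigenvalues[OF finI_mu base _ am_mu]) (auto simp: I_def intro: fin)
    then have lower: "k0 - 1 + N mu < k" using not_mu neg_index_antimono not_le by blast
    \<comment> \<open>A starting level for the upper count, at which the index is exactly
      \<open>k0 - 1\<close>.\<close>
    obtain c1 where c1: "am < ereal c1" "ereal c1 < lp k0"
    proof -
      obtain z where z: "am < z" "z < lp k0" using dense_order_class.dense[OF k0(2)] by blast
      then show ?thesis using that by (cases z) auto
    qed
    have c1mu: "c1 < mu" using c1(2) lp_mono mu by (metis ereal_less_eq(3) leD leI order_trans)
    have not_c1: "\<not> neg_index k0 c1" using lp[OF k0(1) c1(1)] c1(2) by (auto dest: less_trans)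
    have am_ge: "am < ereal t" if "c1 \<le> t" for t
      using c1(1) that by (metis ereal_less_eq(3) less_le_trans)
    have step: "\<exists>\<epsilon>>0. \<forall>c. s < c \<and> c < s + \<epsilon> \<longrightarrow> \<not> neg_index (k0 + N s + dim (?E s) div 2) c"
      if s: "c1 \<le> s" "s \<le> mu" "\<not> neg_index (k0 + N s) s" for s
    proof -
      have "Suc (k0 - 1 + N s) = k0 + N s" using k0 by simp
      then have "\<not> neg_index (Suc (k0 - 1 + N s)) s" using s(3) by simp
      then obtain \<epsilon> where eps: "0 < \<epsilon>"
        "\<And>c. s < c \<Longrightarrow> c < s + \<epsilon> \<Longrightarrow> \<not> neg_index (Suc (k0 - 1 + N s + dim (?E s) div 2)) c"
        using index_upper[OF am_ge[OF s(1)] noness[OF am_ge[OF s(1)] s(2)] fin[OF am_ge[OF s(1)] s(2)]] by blast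
      have "Suc (k0 - 1 + N s + dim (?E s) div 2) = k0 + N s + dim (?E s) div 2" using k0 by simp
      then show ?thesis using eps by auto
    qed
    \<comment> \<open>The index grows only by the multiplicities met on the way from \<open>c1\<close> to \<open>mu\<close>: consider the infimum of
      the points where this fails.\<close>
    have upper_mu: "\<not> neg_index (k0 + N mu) mu"
    proof
      assume bad: "neg_index (k0 + N mu) mu"
      let ?B = "{c. c1 \<le> c \<and> c \<le> mu \<and> neg_index (k0 + N c) c}"
      define s where "s = Inf ?B"
      have muB: "mu \<in> ?B" using bad c1mu by simp
      have bdd: "bdd_below ?B" by (rule bdd_belowI[of _ c1]) simp
      have s: "c1 \<le> s" "s \<le> mu" unfolding s_def using muB bdd by (auto intro: cInf_greatest cInf_lower)
      have N_mono: "N c \<le> N c'" if "c \<le> c'" "c' \<le> mu" for c c'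
        unfolding N_def by (rule sum_mono2[OF finI[OF that(2)] I_mono[OF that(1)]]) simp
      show False
      proof (cases "s \<in> ?B")
        \<comment> \<open>If the infimum is attained, left continuity moves the failure to a smaller
          level, where \<open>N\<close> is no larger.\<close>
        case True
        then have "s \<noteq> c1" using not_c1 neg_index_antimono[of "k0 + N s" s k0] by auto
        then have c1s: "c1 < s" using s by simp
        have nis: "neg_index (k0 + N s) s" using True by simp
        obtain c' where c': "am < ereal c'" "c' < s" "neg_index (k0 + N s) c'"
          by (rule index_left_cont[OF am_ge[OF s(1)] nis]) (rule that)
        define c where "c = max c' c1"
        have c: "c1 \<le> c" "c < s" "c' \<le> c" using c' c1s by (auto simp: c_def)
        have "neg_index (k0 + N s) c" by (rule index_mono[OF c'(1) c(3) c'(3)])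
        then have "neg_index (k0 + N c) c" by (rule neg_index_antimono) (use N_mono[of c s] c s in simp)
        then have "c \<in> ?B" using c s by simp
        then have "s \<le> c" unfolding s_def using bdd by (rule cInf_lower)
        then show False using c by simp
      next
        \<comment> \<open>Otherwise failures occur arbitrarily close above \<open>s\<close>, where
          \<open>N\<close> already includes the multiplicity of \<open>s\<close>; this contradicts
          \<open>step\<close>.\<close>
        case False
        then have "\<not> neg_index (k0 + N s) s" using s by simp
        then obtain \<epsilon> where eps: "0 < \<epsilon>" "\<And>c. s < c \<Longrightarrow> c < s + \<epsilon> \<Longrightarrow> \<not> neg_index (k0 + N s + dim (?E s) div 2) c"
          using step[OF s] by blast
        have "Inf ?B < s + \<epsilon>" using eps(1) by (simp add: s_def)
        then obtain c where c: "c \<in> ?B" "c < s + \<epsilon>" using muB bdd by (metis (no_types, lifting) cInf_lessD empty_iff)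
        have "s \<le> c" unfolding s_def using c(1) bdd by (rule cInf_lower)
        then have sc: "s < c" using c(1) False by (cases "s = c") auto
        have cmu: "c \<le> mu" using c(1) by simp
        have "N s + dim (?E s) div 2 \<le> N c"
        proof (cases "s \<in> op_spectrum D A")
          case True
          have sI: "s \<notin> I s" by (simp add: I_def)
          have "N s + dim (?E s) div 2 = (\<Sum>t\<in>insert s (I s). dim (?E t) div 2)"
            using finI[OF s(2)] sI by (simp add: N_def)
          also have "\<dots> \<le> N c" unfolding N_def
            using sc True am_ge[OF s(1)] by (intro sum_mono2[OF finI[OF cmu]]) (auto simp: I_def)
          finally show ?thesis .
        next
          case False
          have "dim (?E s) = 0" unfolding eigenspace_trivial[OF False] by (rule dim_zero_singleton)
          then show ?thesis using N_mono[of s c] sc cmu by simp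
        qed
        then have "k0 + N s + dim (?E s) div 2 \<le> k0 + N c" by simp
        moreover have "neg_index (k0 + N c) c" using c(1) by simp
        ultimately have "neg_index (k0 + N s + dim (?E s) div 2) c" using neg_index_antimono by blast
        then show False using eps(2)[OF sc c(2)] by simp
      qed
    qed
    obtain \<epsilon> where eps: "0 < \<epsilon>" "\<And>c. mu < c \<Longrightarrow> c < mu + \<epsilon> \<Longrightarrow> \<not> neg_index (k0 + N mu + dim (?E mu) div 2) c"
      using step[OF less_imp_le[OF c1mu] order_refl upper_mu] by blast
    \<comment> \<open>\<open>lp k = mu\<close> lies strictly below this level, so the index there
      reaches \<open>k\<close> while obeying the bound just obtained.\<close>
    have "neg_index k (mu + \<epsilon> / 2)" using lp[OF k1 am_ge, of "mu + \<epsilon> / 2"] mu eps(1) c1mu by simp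
    moreover have "\<not> neg_index (k0 + N mu + dim (?E mu) div 2) (mu + \<epsilon> / 2)" using eps(1) by (intro eps(2)) auto
    ultimately have upper: "k < k0 + N mu + dim (?E mu) div 2" using neg_index_antimono not_le by blast
    have d: "dim (?E mu) div 2 \<noteq> 0" using upper lower by simp
    have c_lt: "eig_count D A {t. am < ereal t \<and> t < mu} = enat (N mu)"
      using eig_count_finite[of "{t. am < ereal t \<and> t < mu}"] finI_mu fin unfolding I_def N_def by auto
    have "mu \<in> op_spectrum D A"
    proof (rule ccontr)
      assume "mu \<notin> op_spectrum D A"
      then have "dim (?E mu) = 0" using eigenspace_trivial dim_zero_singleton by metis
      then show False using d by simp
    qed
    then have I_le: "op_spectrum D A \<inter> {t. am < ereal t \<and> t \<le> mu} = insert mu (I mu)" using am_mu by (auto simp: I_def)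
    have "eig_count D A {t. am < ereal t \<and> t \<le> mu} = enat (\<Sum>t\<in>insert mu (I mu). dim (?E t) div 2)"
      using eig_count_finite[of "{t. am < ereal t \<and> t \<le> mu}"] finI_mu fin unfolding I_le by auto
    also have "(\<Sum>t\<in>insert mu (I mu). dim (?E t) div 2) = N mu + dim (?E mu) div 2"
      using finI_mu by (simp add: N_def I_def)
    finally have c_le: "eig_count D A {t. am < ereal t \<and> t \<le> mu} = enat (N mu + dim (?E mu) div 2)" .
    have "?E mu \<noteq> {0}"
    proof
      assume "?E mu = {0}"
      then have "dim (?E mu) = 0" by (simp add: dim_zero_singleton)
      then show False using d by simp
    qed
    then have "kth_eig_incr D A am bm (k - k0 + 1) mu"
      unfolding kth_eig_incr_def c_lt c_le using am_mu lt mu lower upper k k0 by auto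
    then show ?thesis using mu by blast
  qed simp
qed

end

context decomposition
begin

theorem lambda_plus_kth_eigenvalue:
  defines "am \<equiv> SUP x \<in> Pm ` F - {0}. rayleigh D A x"
    and "lp \<equiv> lambda_plus D A J (Pp ` F) (Pm ` F)"
  defines "k0 \<equiv> LEAST k. 1 \<le> k \<and> am < lp k"
    and "bm \<equiv> INF mu \<in> ess_spectrum D A \<inter> {mu. am < ereal mu}. ereal mu"
  assumes ex: "\<exists>k\<ge>1. am < lp k" and k: "k0 \<le> k"
  shows "(\<exists>mu. lp k = ereal mu \<and> kth_eig_incr D A am bm (k - k0 + 1) mu) \<or> lp k = bm"
proof -
  interpret L: gap_limit D A J "Pm ` F" "form_bilin D A" am
    by unfold_locales (use gap_if in \<open>auto simp: am_def gap_def gap_axioms_def\<close>)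
  have lp: "lp k < ereal c \<longleftrightarrow> neg_index k c" if k: "1 \<le> k" and c: "am < ereal c" for k c
  proof -
    obtain a where a: "a < c" "gap D A J (Pm ` F) (form_bilin D A) a" by (rule L.gap_below[OF c]) (rule that)
    show ?thesis unfolding lp_def
      using lambda_plus_less_imp[OF a(2,1) k] lambda_plus_less_if[OF a(2,1)] by blast
  qed
  show ?thesis using L.kth_eigenvalue_or_bottom[OF lp ex] k unfolding k0_def bm_def by blast
qed

end

section \<open>Reflection\<close>

lemma mem_uminus_image: "x \<in> uminus ` T \<longleftrightarrow> - x \<in> T" for x :: real
proof
  assume "- x \<in> T"
  then show "x \<in> uminus ` T" by (intro image_eqI[of x uminus "- x"]) simp_all
qed auto

lemma uminus_image_Collect: "uminus ` {t::real. P t} = {t. P (- t)}"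
  by (simp add: set_eq_iff mem_uminus_image)

lemma uminus_less_ereal_uminus: "- a < ereal (- t) \<longleftrightarrow> ereal t < a"
  by (metis ereal_minus_less_minus uminus_ereal.simps(1))

lemma ereal_uminus_less_uminus: "ereal (- t) < - a \<longleftrightarrow> a < ereal t"
  by (metis ereal_minus_less_minus uminus_ereal.simps(1))

lemma bij_betw_uminus_iff: "bij_betw (\<lambda>x. - f x) D UNIV \<longleftrightarrow> bij_betw f D (UNIV :: 'a::real_vector set)"
proof -
  have "bij_betw (\<lambda>x. - g x) D UNIV" if "bij_betw g D UNIV" for g :: "'b \<Rightarrow> 'a"
    using bij_betw_trans[OF that, of uminus UNIV] bij_uminus by (simp add: o_def)
  from this[of f] this[of "\<lambda>x. - f x"] show ?thesis by auto
qed

lemma op_spectrum_uminus: "l \<in> op_spectrum D (\<lambda>x. - A x) \<longleftrightarrow> - l \<in> op_spectrum D A"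
proof -
  have "(\<lambda>x. - A x - l *\<^sub>R x) = (\<lambda>x. - (A x - (- l) *\<^sub>R x))" by (simp add: algebra_simps)
  then show ?thesis unfolding op_spectrum_def mem_Collect_eq by (simp only: bij_betw_uminus_iff)
qed

lemma eigenspace_op_uminus: "eigenspace_op D (\<lambda>x. - A x) l = eigenspace_op D A (- l)"
proof -
  have "- A x = l *\<^sub>R x \<longleftrightarrow> A x = (- l) *\<^sub>R x" for x
    unfolding scaleR_minus_left by (metis minus_minus)
  then show ?thesis unfolding eigenspace_op_def by simp
qed

lemma disc_spectrum_uminus: "l \<in> disc_spectrum D (\<lambda>x. - A x) \<longleftrightarrow> - l \<in> disc_spectrum D A"
proof -
  have eq: "op_spectrum D (\<lambda>x. - A x) \<inter> ball l e = {l} \<longleftrightarrow> op_spectrum D A \<inter> ball (- l) e = {- l}" for e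
  proof -
    have "op_spectrum D (\<lambda>x. - A x) \<inter> ball l e = uminus ` (op_spectrum D A \<inter> ball (- l) e)"
      by (simp add: set_eq_iff mem_uminus_image op_spectrum_uminus dist_real_def abs_minus_commute)
    moreover have "{l} = uminus ` {- l}" by simp
    ultimately show ?thesis by (metis inj_image_eq_iff inj_uminus)
  qed
  show ?thesis by (simp add: disc_spectrum_def op_spectrum_uminus eigenspace_op_uminus eq)
qed

lemma ess_spectrum_uminus: "l \<in> ess_spectrum D (\<lambda>x. - A x) \<longleftrightarrow> - l \<in> ess_spectrum D A"
  by (simp add: ess_spectrum_def op_spectrum_uminus disc_spectrum_uminus)

lemma eig_count_uminus: "eig_count D (\<lambda>x. - A x) I = eig_count D A (uminus ` I)"
  by (simp add: eig_count_def eigenspace_op_uminus)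

lemma kth_eig_uminus:
  assumes "kth_eig_incr D (\<lambda>x. - A x) (- a) (- b) j (- mu)"
  shows "kth_eig_decr D A b a j mu"
proof -
  have "uminus ` {t. - a < ereal t \<and> t < - mu} = {t. mu < t \<and> ereal t < a}"
    unfolding uminus_image_Collect uminus_less_ereal_uminus by auto
  moreover have "uminus ` {t. - a < ereal t \<and> t \<le> - mu} = {t. mu \<le> t \<and> ereal t < a}"
    unfolding uminus_image_Collect uminus_less_ereal_uminus by auto
  ultimately show ?thesis
    using assms unfolding kth_eig_incr_def kth_eig_decr_def eig_count_uminus eigenspace_op_uminus
    by (simp add: uminus_less_ereal_uminus ereal_uminus_less_uminus)
qed

context decomposition
begin

text \<open>The same \<open>S\<close> serves \<open>- A\<close>, since only the norms of
  \<open>A x\<close> enter its definition; the two subspaces exchange their roles.\<close>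

lemma decomposition_uminus: "decomposition D (\<lambda>x. - A x) DS S J Pm Pp Hm Hp F"
proof -
  interpret m: abs_sqrt D "\<lambda>x. - A x" DS S by (rule abs_sqrt_uminus)
  show ?thesis
  proof
    show "complex_structure J" "J ` D \<subseteq> D" by (rule J, rule clin(1))
    show "\<forall>x\<in>D. - A (J x) = J (- A x)" using clin(2) linJ by (simp add: linear_neg)
    show "\<forall>u\<in>Hm. \<forall>v\<in>Hp. inner u v = 0" using orth inner_commute by metis
    show "\<forall>x. Pm x \<in> Hm \<and> Pp x \<in> Hp \<and> Pm x + Pp x = x" using proj by (simp add: add.commute)
    have "norm (- A x - - A y) = norm (A x - A y)" for x y by (simp add: norm_minus_commute)
    then show "\<forall>x\<in>D. \<forall>e>0. \<exists>y\<in>F. norm (x - y) + norm (- A x - - A y) < e" using core(4) by simp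
  qed (use Hp Hm core i in auto)
qed

lemma rayleigh_uminus: "x \<in> DS \<Longrightarrow> rayleigh D (\<lambda>x. - A x) x = - rayleigh D A x"
  by (simp add: rayleigh_def form_val_uminus)

text \<open>The sum spaces lie in the form domain, where passing to \<open>- A\<close> changes the
  sign of the form and exchanges suprema with infima.\<close>

lemma lambda_plus_uminus: "lambda_plus D (\<lambda>x. - A x) J (Pm ` F) (Pp ` F) k = - lambda_minus D A J (Pp ` F) (Pm ` F) k"
proof -
  have "(SUP x \<in> dsum V (Pp ` F) - {0}. rayleigh D (\<lambda>x. - A x) x) = - (INF x \<in> dsum V (Pp ` F) - {0}. rayleigh D A x)"
    if V: "V \<in> csubspaces_dim J (Pm ` F) k" for V
  proof -
    have "dsum V (Pp ` F) \<subseteq> DS"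
    proof
      fix x assume "x \<in> dsum V (Pp ` F)"
      then obtain v w where "x = v + w" "v \<in> V" "w \<in> Pp ` F" unfolding dsum_def by blast
      moreover have "V \<subseteq> Pm ` F" using V by (simp add: csubspaces_dim_def)
      ultimately show "x \<in> DS" using i S.D_add by blast
    qed
    then have "(SUP x \<in> dsum V (Pp ` F) - {0}. rayleigh D (\<lambda>x. - A x) x) = (SUP x \<in> dsum V (Pp ` F) - {0}. - rayleigh D A x)"
      using rayleigh_uminus by (intro SUP_cong) auto
    then show ?thesis by (simp add: ereal_SUP_uminus_eq)
  qed
  then have "lambda_plus D (\<lambda>x. - A x) J (Pm ` F) (Pp ` F) k
      = (INF V \<in> csubspaces_dim J (Pm ` F) k. - (INF x \<in> dsum V (Pp ` F) - {0}. rayleigh D A x))"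
    unfolding lambda_plus_def by (intro INF_cong) auto
  then show ?thesis by (simp add: ereal_INF_uminus_eq lambda_minus_def)
qed

theorem lambda_minus_kth_eigenvalue:
  defines "ap \<equiv> INF x \<in> Pp ` F - {0}. rayleigh D A x"
    and "lm \<equiv> lambda_minus D A J (Pp ` F) (Pm ` F)"
  defines "k0 \<equiv> LEAST k. 1 \<le> k \<and> lm k < ap"
    and "bp \<equiv> SUP mu \<in> ess_spectrum D A \<inter> {mu. ereal mu < ap}. ereal mu"
  assumes ex: "\<exists>k\<ge>1. lm k < ap" and k: "k0 \<le> k"
  shows "(\<exists>mu. lm k = ereal mu \<and> kth_eig_decr D A bp ap (k - k0 + 1) mu) \<or> lm k = bp"
proof -
  interpret m: decomposition D "\<lambda>x. - A x" DS S J Pm Pp Hm Hp F by (rule decomposition_uminus)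
  have lp: "lambda_plus D (\<lambda>x. - A x) J (Pm ` F) (Pp ` F) = (\<lambda>k. - lm k)"
    by (rule ext) (simp add: lambda_plus_uminus lm_def)
  have "(SUP x \<in> Pp ` F - {0}. rayleigh D (\<lambda>x. - A x) x) = (SUP x \<in> Pp ` F - {0}. - rayleigh D A x)"
    using rayleigh_uminus i by (intro SUP_cong) auto
  then have am: "(SUP x \<in> Pp ` F - {0}. rayleigh D (\<lambda>x. - A x) x) = - ap" by (simp add: ereal_SUP_uminus_eq ap_def)
  have "(INF mu \<in> ess_spectrum D (\<lambda>x. - A x) \<inter> {mu. - ap < ereal mu}. ereal mu)
      = (INF mu \<in> ess_spectrum D A \<inter> {mu. ereal mu < ap}. - ereal mu)"
  proof -
    have "ess_spectrum D (\<lambda>x. - A x) \<inter> {mu. - ap < ereal mu} = uminus ` (ess_spectrum D A \<inter> {mu. ereal mu < ap})"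
      using uminus_less_ereal_uminus[of ap "- _"]
      by (simp add: set_eq_iff mem_uminus_image ess_spectrum_uminus del: uminus_ereal.simps)
    then show ?thesis by (simp add: image_image)
  qed
  then have bm: "(INF mu \<in> ess_spectrum D (\<lambda>x. - A x) \<inter> {mu. - ap < ereal mu}. ereal mu) = - bp"
    by (simp add: ereal_INF_uminus_eq bp_def del: uminus_ereal.simps)
  have less: "- ap < - lm k \<longleftrightarrow> lm k < ap" for k by simp
  have ex': "\<exists>k\<ge>1. - ap < - lm k" using ex by simp
  have "(\<exists>mu. - lm k = ereal mu \<and> kth_eig_incr D (\<lambda>x. - A x) (- ap) (- bp) (k - k0 + 1) mu) \<or> - lm k = - bp"
    using m.lambda_plus_kth_eigenvalue[unfolded am lp bm less, OF ex[unfolded], folded k0_def, OF k] .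
  then show ?thesis
  proof (elim disjE exE conjE)
    fix mu assume mu: "- lm k = ereal mu" "kth_eig_incr D (\<lambda>x. - A x) (- ap) (- bp) (k - k0 + 1) mu"
    have "lm k = ereal (- mu)" using mu(1) by (metis ereal_uminus_uminus uminus_ereal.simps(1))
    moreover have "kth_eig_decr D A bp ap (k - k0 + 1) (- mu)" using mu(2) by (intro kth_eig_uminus) simp
    ultimately show ?thesis by blast
  qed simp
qed

end

theorem theorem1:
  fixes D :: "'a::{real_inner, complete_space} set"
    and A J Pp Pm :: "'a \<Rightarrow> 'a"
    and Hp Hm F :: "'a set"
  assumes J: "complex_structure J"
    and sa: "self_adjoint_op D A"
    and clin: "J ` D \<subseteq> D" "\<forall>x\<in>D. A (J x) = J (A x)"
    and Hp: "subspace Hp" "closed Hp" "J ` Hp \<subseteq> Hp"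
    and Hm: "subspace Hm" "closed Hm" "J ` Hm \<subseteq> Hm"
    and orth: "\<forall>u\<in>Hp. \<forall>v\<in>Hm. inner u v = 0"
    and proj: "\<forall>x. Pp x \<in> Hp \<and> Pm x \<in> Hm \<and> Pp x + Pm x = x"
    and core: "subspace F" "J ` F \<subseteq> F" "F \<subseteq> D"
      "\<forall>x\<in>D. \<forall>e>0. \<exists>y\<in>F. norm (x - y) + norm (A x - A y) < e"
    and i: "Pp ` F \<subseteq> form_dom D A" "Pm ` F \<subseteq> form_dom D A"
  shows
   "(let am = (SUP x \<in> Pm ` F - {0}. rayleigh D A x);
         lp = lambda_plus D A J (Pp ` F) (Pm ` F);
         k0 = (LEAST k. 1 \<le> k \<and> lp k > am);
         bm = (INF mu \<in> ess_spectrum D A \<inter> {mu. am < ereal mu}. ereal mu)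
     in am < \<infinity> \<and> (\<exists>k\<ge>1. lp k > am) \<longrightarrow>
        (\<forall>k\<ge>k0. (\<exists>mu. lp k = ereal mu \<and> kth_eig_incr D A am bm (k - k0 + 1) mu) \<or> lp k = bm))
    \<and>
    (let ap = (INF x \<in> Pp ` F - {0}. rayleigh D A x);
         lm = lambda_minus D A J (Pp ` F) (Pm ` F);
         k0 = (LEAST k. 1 \<le> k \<and> lm k < ap);
         bp = (SUP mu \<in> ess_spectrum D A \<inter> {mu. ereal mu < ap}. ereal mu)
     in ap > - \<infinity> \<and> (\<exists>k\<ge>1. lm k < ap) \<longrightarrow>
        (\<forall>k\<ge>k0. (\<exists>mu. lm k = ereal mu \<and> kth_eig_decr D A bp ap (k - k0 + 1) mu) \<or> lm k = bp))"
proof -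
  \<comment> \<open>\<open>form_dom\<close> would be empty if no square root existed; since it
    contains \<open>Pp 0\<close>, a square root can be taken from it.\<close>
  have "Pp 0 \<in> form_dom D A" using i(1) subspace_0[OF core(1)] by blast
  then obtain DS S where S: "is_abs_sqrt D A DS S" by (auto simp: form_dom_def)
  interpret abs_sqrt D A DS S by unfold_locales (use sa S in auto)
  interpret decomposition D A DS S J Pp Pm Hp Hm F
    by unfold_locales (use J clin Hp Hm orth proj core i in \<open>auto simp: form_dom_eq\<close>)
  show ?thesis
    unfolding Let_def using lambda_plus_kth_eigenvalue lambda_minus_kth_eigenvalue by blast
qed

end
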